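(* Let $V$ be a Kato-decomposable potential such that $V(x)\to\infty$ as $|x|\to\infty$. (1) If the semigroup $\{T_t:t\ge 0\}$ is intrinsically ultracontractive (IUC), then for any $\varepsilon\in(0,1]$ $$\lim_{|x|\to\infty}\frac{\sup_{y\in B(x,\varepsilon)}V(y)}{\log|x|}=\infty.$$ (2) If the semigroup $\{T_t:t\ge 0\}$ is asymptotically intrinsically ultracontractive (AIUC), then there exists a constant $C_V>0$ such that for every $\varepsilon\in(0,1]$ there is $R_\varepsilon>2$ such that for all $|x|>R_\varepsilon$ $$\frac{\sup_{y\in B(x,\varepsilon)}V(y)}{\log|x|}\ge C_V.$$
   Context: Let $d\ge 1$, $\alpha\in(0,2)$, and let $(X_t)_{t\ge 0}$ be the rotationally invariant $\alpha$-stable process on $\mathbf{R}^d$ with càdlàg paths, $\mathbf{E}^0[e^{i\xi\cdot X_t}]=e^{-t|\xi|^\alpha}$; $\mathbf{P}^x,\mathbf{E}^x$ are law and expectation for the process started at $x$. $B(x,r)$ is the open ball. A Borel function $W$ on $\mathbf{R}^d$ is in $\mathcal{K}^\alpha$ if $\lim_{t\to 0}\sup_x\int_0^t\mathbf{E}^x[|W(X_s)|]ds=0$, and in $\mathcal{K}^\alpha_{\rm loc}$ if $W\mathbf{1}_B\in\mathcal{K}^\alpha$ for every ball $B$. A Borel function $V:\mathbf{R}^d\to\mathbf{R}$ is Kato-decomposable if its positive and negative parts ($V=V_+-V_-$) satisfy $V_+\in\mathcal{K}^\alpha_{\rm loc}$, $V_-\in\mathcal{K}^\alpha$. The Feynman-Kac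 semigroup is $T_tf(x)=\mathbf{E}^x[e^{-\int_0^tV(X_s)ds}f(X_t)]$; it is a strongly continuous symmetric semigroup on $L^2(\mathbf{R}^d)$, and $H_\alpha$ denotes the self-adjoint operator bounded from below with $e^{-tH_\alpha}=T_t$. For $t>0$, $T_t$ has a bounded, continuous, symmetric, strictly positive integral kernel $u(t,x,y)$. Under the assumption on $V$ the operators $T_t$, $t>0$, are compact; $\lambda_0=\inf\operatorname{Spec}H_\alpha$ is an isolated eigenvalue with eigenfunction $\varphi_0$ (ground state), $\|\varphi_0\|_2=1$, taken in its strictly positive, bounded, continuous version. Put $\widetilde u(t,x,y)=\frac{e^{\lambda_0t}u(t,x,y)}{\varphi_0(x)\varphi_0(y)}$. $\{T_t\}$ is IUC if for every $t>0$ there is a constant $C_{V,t}>0$ with $\widetilde u(t,x,y)\le C_{V,t}$ for all $x,y\in\mathbf{R}^d$. It is AIUC if there exists $t_0>0$ such that for every $t\ge t_0$ there is a constant $C_{V,t}>0$ with $\widetilde u(t,x,y)\le C_{V,t}$ for all $x,y\in\mathbf{R}^d$. *)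

theory Defs
  imports "HOL-Probability.Probability"
begin

text \<open>
  The type \<open>'a\<close> is Euclidean space of dimension \<open>DIM('a) \<ge> 1\<close>. Time is indexed by \<open>real\<close>, and only
  times \<open>t \<ge> 0\<close> matter. The process starts at the origin, and \<open>\<lambda>t \<omega>. x + X t \<omega>\<close> is the
  process started at \<open>x\<close>. Hence \<open>\<E>\<^sup>x\<close> of a path functional is written below as an integral over
  \<open>M\<close> of that functional along \<open>x + X\<close>.
\<close>

locale stable_process = prob_space M
  for M :: "'w measure" +
  fixes \<alpha> :: real and X :: "real \<Rightarrow> 'w \<Rightarrow> 'a::euclidean_space"
  assumes index: "0 < \<alpha>" "\<alpha> < 2"
    and rv: "\<And>t. t \<ge> 0 \<Longrightarrow> X t \<in> borel_measurable M"
    and start: "AE \<omega> in M. X 0 \<omega> = 0"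
    and indep_increments:
      "\<And>\<tau> n. 0 \<le> \<tau> 0 \<Longrightarrow> (\<And>i. i < n \<Longrightarrow> \<tau> i \<le> \<tau> (Suc i)) \<Longrightarrow>
         indep_vars (\<lambda>_. borel) (\<lambda>i \<omega>. X (\<tau> (Suc i)) \<omega> - X (\<tau> i) \<omega>) {..<n::nat}"
    and stationary_increments:
      "\<And>s t. 0 \<le> s \<Longrightarrow> s \<le> t \<Longrightarrow>
         distr M borel (\<lambda>\<omega>. X t \<omega> - X s \<omega>) = distr M borel (X (t - s))"
    and char_exponent:
      "\<And>t \<xi>. t \<ge> 0 \<Longrightarrow>
         (CLINT \<omega>|M. exp (\<i> * complex_of_real (\<xi> \<bullet> X t \<omega>)))
           = complex_of_real (exp (- t * norm \<xi> powr \<alpha>))"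
    and right_continuous:
      "\<And>\<omega> t. \<omega> \<in> space M \<Longrightarrow> t \<ge> 0 \<Longrightarrow> ((\<lambda>s. X s \<omega>) \<longlongrightarrow> X t \<omega>) (at_right t)"
    and left_limits:
      "\<And>\<omega> t. \<omega> \<in> space M \<Longrightarrow> t > 0 \<Longrightarrow> \<exists>l. ((\<lambda>s. X s \<omega>) \<longlongrightarrow> l) (at_left t)"

definition kato_class ::
    "'w measure \<Rightarrow> (real \<Rightarrow> 'w \<Rightarrow> 'a::euclidean_space) \<Rightarrow> ('a \<Rightarrow> real) set" where
  "kato_class M X = {W. W \<in> borel_measurable borel \<and>
     ((\<lambda>t. SUP x. \<integral>\<^sup>+ s \<in> {0..t}. (\<integral>\<^sup>+ \<omega>. ennreal \<bar>W (x + X s \<omega>)\<bar> \<partial>M) \<partial>lborel)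
        \<longlongrightarrow> 0) (at_right 0)}"

definition kato_class_loc ::
    "'w measure \<Rightarrow> (real \<Rightarrow> 'w \<Rightarrow> 'a::euclidean_space) \<Rightarrow> ('a \<Rightarrow> real) set" where
  "kato_class_loc M X = {W. W \<in> borel_measurable borel \<and>
     (\<forall>z r. 0 < r \<longrightarrow> (\<lambda>y. W y * indicator (ball z r) y) \<in> kato_class M X)}"

definition kato_decomposable ::
    "'w measure \<Rightarrow> (real \<Rightarrow> 'w \<Rightarrow> 'a::euclidean_space) \<Rightarrow> ('a \<Rightarrow> real) \<Rightarrow> bool" where
  "kato_decomposable M X V \<longleftrightarrow> V \<in> borel_measurable borel \<and>
     (\<lambda>y. max (V y) 0) \<in> kato_class_loc M X \<and> (\<lambda>y. max (- V y) 0) \<in> kato_class M X"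

definition feynman_kac ::
    "'w measure \<Rightarrow> (real \<Rightarrow> 'w \<Rightarrow> 'a::euclidean_space) \<Rightarrow> ('a \<Rightarrow> real) \<Rightarrow> real \<Rightarrow>
     ('a \<Rightarrow> complex) \<Rightarrow> 'a \<Rightarrow> complex" where
  "feynman_kac M X V t f x =
     (CLINT \<omega>|M. complex_of_real (exp (- (LINT s:{0..t}|lborel. V (x + X s \<omega>)))) * f (x + X t \<omega>))"

text \<open>
  Elements of \<open>L\<^sup>2\<close> are represented by Borel functions, and identities in \<open>L\<^sup>2\<close> are
  accordingly required almost everywhere or in norm.
\<close>

definition L2 :: "('a::euclidean_space \<Rightarrow> complex) set" where
  "L2 = {f. f \<in> borel_measurable borel \<and> integrable lborel (\<lambda>x. (norm (f x))\<^sup>2)}"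

definition L2_norm :: "('a::euclidean_space \<Rightarrow> complex) \<Rightarrow> real" where
  "L2_norm f = sqrt (LINT x|lborel. (norm (f x))\<^sup>2)"

text \<open>
  The graph of \<open>H\<close>, the operator with \<open>e\<^bsup>-tH\<^esup> = T\<^sub>t\<close>, that is, minus the generator of
  the semigroup: \<open>(f, g)\<close> belongs to the graph iff \<open>(f - T\<^sub>t f) / t\<close> converges to \<open>g\<close> in
  \<open>L\<^sup>2\<close> as \<open>t\<close> decreases to \<open>0\<close>. For a strongly continuous symmetric semigroup this is the unique
  self-adjoint operator, bounded from below, that generates the semigroup in this sense. The
  convergence is stated with the extended nonnegative integral, so that a difference quotient
  outside \<open>L\<^sup>2\<close> would have infinite distance to \<open>g\<close>.
\<close>

definition hamiltonian ::
    "'w measure \<Rightarrow> (real \<Rightarrow> 'w \<Rightarrow> 'a::euclidean_space) \<Rightarrow> ('a \<Rightarrow> real) \<Rightarrow>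
     (('a \<Rightarrow> complex) \<times> ('a \<Rightarrow> complex)) set" where
  "hamiltonian M X V = {(f, g). f \<in> L2 \<and> g \<in> L2 \<and>
     ((\<lambda>t. \<integral>\<^sup>+ x. ennreal ((norm ((f x - feynman_kac M X V t f x) / complex_of_real t - g x))\<^sup>2) \<partial>lborel)
        \<longlongrightarrow> 0) (at_right 0)}"

text \<open>
  Spectrum of an operator in \<open>L\<^sup>2\<close> given by its graph: \<open>z\<close> lies in the resolvent set iff
  \<open>H - z\<close> maps its domain onto \<open>L\<^sup>2\<close> and has a bounded inverse. The norm estimate also yields
  injectivity.
\<close>

definition resolvent_set ::
    "(('a::euclidean_space \<Rightarrow> complex) \<times> ('a \<Rightarrow> complex)) set \<Rightarrow> complex set" where
  "resolvent_set H = {z.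
     (\<forall>g\<in>L2. \<exists>f h. (f, h) \<in> H \<and> (AE x in lborel. h x - z * f x = g x)) \<and>
     (\<exists>C. \<forall>(f, h)\<in>H. L2_norm f \<le> C * L2_norm (\<lambda>x. h x - z * f x))}"

definition spectrum ::
    "(('a::euclidean_space \<Rightarrow> complex) \<times> ('a \<Rightarrow> complex)) set \<Rightarrow> complex set" where
  "spectrum H = - resolvent_set H"

definition ground_energy ::
    "'w measure \<Rightarrow> (real \<Rightarrow> 'w \<Rightarrow> 'a::euclidean_space) \<Rightarrow> ('a \<Rightarrow> real) \<Rightarrow> real" where
  "ground_energy M X V = Inf {r. complex_of_real r \<in> spectrum (hamiltonian M X V)}"

definition ground_state ::
    "'w measure \<Rightarrow> (real \<Rightarrow> 'w \<Rightarrow> 'a::euclidean_space) \<Rightarrow> ('a \<Rightarrow> real) \<Rightarrow> ('a \<Rightarrow> real) \<Rightarrow> bool" where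
  "ground_state M X V \<phi> \<longleftrightarrow>
     ((\<lambda>x. complex_of_real (\<phi> x)),
      (\<lambda>x. complex_of_real (ground_energy M X V) * complex_of_real (\<phi> x))) \<in> hamiltonian M X V \<and>
     L2_norm (\<lambda>x. complex_of_real (\<phi> x)) = 1 \<and>
     (\<forall>x. 0 < \<phi> x) \<and> bounded (range \<phi>) \<and> continuous_on UNIV \<phi>"

text \<open>By continuity, the kernel is uniquely determined by the semigroup.\<close>

definition feynman_kac_kernel ::
    "'w measure \<Rightarrow> (real \<Rightarrow> 'w \<Rightarrow> 'a::euclidean_space) \<Rightarrow> ('a \<Rightarrow> real) \<Rightarrow>
     (real \<Rightarrow> 'a \<Rightarrow> 'a \<Rightarrow> real) \<Rightarrow> bool" where
  "feynman_kac_kernel M X V u \<longleftrightarrow> (\<forall>t>0.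
     bounded (range (\<lambda>(x, y). u t x y)) \<and>
     continuous_on UNIV (\<lambda>(x, y). u t x y) \<and>
     (\<forall>x y. u t x y = u t y x) \<and>
     (\<forall>x y. 0 < u t x y) \<and>
     (\<forall>f\<in>L2. AE x in lborel.
        feynman_kac M X V t f x = (CLINT y|lborel. complex_of_real (u t x y) * f y)))"

definition intrinsic_kernel ::
    "real \<Rightarrow> (real \<Rightarrow> 'a \<Rightarrow> 'a \<Rightarrow> real) \<Rightarrow> ('a \<Rightarrow> real) \<Rightarrow> real \<Rightarrow> 'a \<Rightarrow> 'a \<Rightarrow> real" where
  "intrinsic_kernel E0 u \<phi> t x y = exp (E0 * t) * u t x y / (\<phi> x * \<phi> y)"

definition IUC :: "real \<Rightarrow> (real \<Rightarrow> 'a \<Rightarrow> 'a \<Rightarrow> real) \<Rightarrow> ('a \<Rightarrow> real) \<Rightarrow> bool" where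
  "IUC E0 u \<phi> \<longleftrightarrow> (\<forall>t>0. \<exists>C>0. \<forall>x y. intrinsic_kernel E0 u \<phi> t x y \<le> C)"

definition AIUC :: "real \<Rightarrow> (real \<Rightarrow> 'a \<Rightarrow> 'a \<Rightarrow> real) \<Rightarrow> ('a \<Rightarrow> real) \<Rightarrow> bool" where
  "AIUC E0 u \<phi> \<longleftrightarrow> (\<exists>t\<^sub>0>0. \<forall>t\<ge>t\<^sub>0. \<exists>C>0. \<forall>x y. intrinsic_kernel E0 u \<phi> t x y \<le> C)"

text \<open>
  A Kato-decomposable potential may be unbounded above on balls, so its supremum is taken in the
  extended reals.
\<close>

definition sup_log_ratio :: "('a::euclidean_space \<Rightarrow> real) \<Rightarrow> real \<Rightarrow> 'a \<Rightarrow> ereal" where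
  "sup_log_ratio V \<epsilon> x = (SUP y\<in>ball x \<epsilon>. ereal (V y)) / ereal (ln (norm x))"

end

theory Submission
  imports Defs
begin

text \<open>
  Fix a time \<open>t\<close> with \<open>intrinsic_kernel t \<le> A\<close> and a ball \<open>B = ball x \<epsilon>\<close> far from the origin, and let \<open>K\<close> be
  the supremum of \<open>V\<close> on \<open>B\<close>. A path that starts near \<open>x\<close> and moves by at most \<open>\<epsilon> / 2\<close> up to time \<open>t\<close>
  stays in \<open>B\<close> and collects an action of at most \<open>t * K\<close>. Hence \<open>T\<^sub>t 1\<^sub>B \<ge> exp (- t * K) * p\<close> near
  \<open>x\<close>, where the probability \<open>p\<close> of such a small displacement does not depend on \<open>x\<close>. On the other hand
  the bound on the intrinsic kernel dominates \<open>T\<^sub>t 1\<^sub>B\<close> by a constant times \<open>\<phi> * \<integral>\<^sub>B \<phi>\<close>. If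
  \<open>\<phi>\<close> decays at least like \<open>norm x powr - \<delta>\<close>, taking logarithms gives \<open>t * K \<ge> 2 * \<delta> * ln (norm x) - c\<close>
  with \<open>c\<close> independent of \<open>x\<close>, and so \<open>K / ln (norm x) \<ge> \<delta> / t\<close> for large \<open>norm x\<close>
  (\<open>sup_log_ratio_lower_bound\<close>). IUC allows every \<open>t > 0\<close>, so the ratio tends to infinity. AIUC
  provides one \<open>t\<close>, and \<open>\<delta> / t\<close> is the constant, the same for all \<open>\<epsilon>\<close>.

  Two facts carry this argument. The first is that \<open>p > 0\<close> for all \<open>t\<close> and \<open>\<epsilon>\<close> (\<open>prob_stay_pos\<close>): cut
  \<open>[0, t]\<close> into \<open>n\<close> blocks and ask in each block for a displacement of at most \<open>\<eta>\<close> and an increment that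
  does not point away from the origin. The squared distance then grows by at most \<open>\<eta>\<^sup>2\<close> per block, and since
  \<open>\<alpha> < 2\<close> one can take \<open>\<eta>\<close> of order \<open>n powr - (1/2)\<close> while every block still succeeds with probability at
  least \<open>1/4\<close>.

  The second is that the ground state decays with \<open>\<delta> = \<alpha> / 2\<close> (\<open>eigenfunction_decay\<close>). In
  \<open>\<phi> = exp (\<lambda>\<^sub>0 * T) * T\<^sub>T \<phi>\<close>, a path from \<open>x\<close> that moves by less than \<open>norm x / 2\<close> sees a large potential
  and the values of \<open>\<phi>\<close> outside a ball of half the radius. All other paths together have a probability of
  order \<open>norm x powr - \<alpha>\<close>, and by Cauchy-Schwarz their contribution is of the order of its square root. The
  supremum of \<open>\<phi>\<close> outside the ball of radius \<open>2 * r\<close> is thus a small multiple of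
  the supremum outside radius \<open>r\<close> plus a term of order \<open>r powr - (\<alpha> / 2)\<close>, and iteration over dyadic radii gives
  the rate.

  The identity for \<open>\<phi>\<close> has to be recovered from the generator, because the ground state is an eigenfunction of
  the derivative of the semigroup at \<open>0\<close> only (\<open>eigenfunction_of_generator\<close>). This uses the semigroup
  property, which rests on the Markov property for functionals of whole paths (\<open>nn_integral_markov\<close>), and bounds
  on \<open>L\<^sup>2\<close> for short times, which come from Khasminskii's lemma for the negative part of \<open>V\<close>
  (\<open>khasminskii\<close>, \<open>short_time_exists\<close>).
\<close>

section \<open>Sampled increments of the process\<close>

lemma finite_set_enumeration:
  fixes F :: "'b::linorder set"
  assumes "finite F" "F \<noteq> {}"
  obtains \<tau> :: "nat \<Rightarrow> 'b" and n where "\<tau> ` {..n} = F" "strict_mono_on {..n} \<tau>" "n = card F - 1"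
proof -
  let ?l = "sorted_list_of_set F"
  have len: "length ?l = card F" and set: "set ?l = F" and str: "sorted_wrt (<) ?l"
    using assms by auto
  have pos: "card F > 0" using assms by (simp add: card_gt_0_iff)
  have "(\<lambda>i. ?l ! i) ` {..card F - 1} = F"
  proof -
    have "{..card F - 1} = {0..<length ?l}" using pos len by auto
    then show ?thesis using set by (metis list.set_map map_nth set_upt)
  qed
  moreover have "strict_mono_on {..card F - 1} (\<lambda>i. ?l ! i)"
    using str len pos by (auto simp: strict_mono_on_def sorted_wrt_iff_nth_less)
  ultimately show ?thesis using that by blast
qed

lemma strict_mono_on_le_iff:
  fixes \<tau> :: "nat \<Rightarrow> 'b::linorder"
  assumes "strict_mono_on A \<tau>" "i \<in> A" "j \<in> A"
  shows "\<tau> i \<le> \<tau> j \<longleftrightarrow> i \<le> j"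
  using assms strict_mono_on_leD strict_mono_onD by (metis leD le_less_linear)

context stable_process
begin

lemma measurable_increment [measurable]:
  "0 \<le> s \<Longrightarrow> 0 \<le> t \<Longrightarrow> (\<lambda>\<omega>. X t \<omega> - X s \<omega>) \<in> borel_measurable M"
  using rv by (intro borel_measurable_diff) auto

text \<open>
  The times in \<open>J\<close>, \<open>0\<close>, \<open>s\<close> and the shifted times in \<open>K\<close> form one increasing grid. Both families are partial
  sums of the increments over this grid: the first uses only those before \<open>s\<close>, the second only those after \<open>s\<close>.
\<close>
lemma indep_past_future_finite:
  assumes "finite J" "J \<subseteq> {0..s}" "finite K" "K \<subseteq> {0..}" "0 \<le> s"
  shows "indep_var (PiM J (\<lambda>_. borel)) (\<lambda>\<omega>. \<lambda>j\<in>J. X j \<omega> - X 0 \<omega>)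
                   (PiM K (\<lambda>_. borel)) (\<lambda>\<omega>. \<lambda>k\<in>K. X (s + k) \<omega> - X s \<omega>)"
proof -
  define F where "F = {0, s} \<union> J \<union> (+) s ` K"
  have F: "finite F" "F \<noteq> {}" "F \<subseteq> {0..}" using assms by (auto simp: F_def)
  obtain \<tau> :: "nat \<Rightarrow> real" and n where \<tau>: "\<tau> ` {..n} = F" "strict_mono_on {..n} \<tau>"
    using finite_set_enumeration[OF F(1,2)] by blast
  have "\<forall>r\<in>F. \<exists>i\<le>n. \<tau> i = r" using \<tau>(1) by fastforce
  then obtain ix where ix: "\<And>r. r \<in> F \<Longrightarrow> ix r \<le> n \<and> \<tau> (ix r) = r" by metis
  have mem: "0 \<in> F" "s \<in> F" "\<And>j. j \<in> J \<Longrightarrow> j \<in> F" "\<And>k. k \<in> K \<Longrightarrow> s + k \<in> F"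
    by (auto simp: F_def)
  have ix_le: "ix r \<le> ix r' \<longleftrightarrow> r \<le> r'" if "r \<in> F" "r' \<in> F" for r r'
    using strict_mono_on_le_iff[OF \<tau>(2), of "ix r" "ix r'"] ix that by auto
  have ix0: "ix 0 \<le> ix r" if "r \<in> F" for r using ix_le[OF mem(1) that] F(3) that by auto
  define D where "D i \<omega> = X (\<tau> (Suc i)) \<omega> - X (\<tau> i) \<omega>" for i \<omega>
  have tele: "X (\<tau> j) \<omega> - X (\<tau> i) \<omega> = (\<Sum>k\<in>{i..<j}. D k \<omega>)" if "i \<le> j" for i j \<omega>
    unfolding D_def using that sum_Suc_diff'[of i j "\<lambda>i. X (\<tau> i) \<omega>"] by simp
  have \<tau>nn: "0 \<le> \<tau> i" if "i \<le> n" for i using \<tau>(1) F(3) that by auto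
  have ind: "indep_vars (\<lambda>_. borel) D {..<n}"
    unfolding D_def
    using \<tau>nn strict_mono_on_le_iff[OF \<tau>(2)] by (intro indep_increments) auto
  define m where "m = ix s"
  have mn: "m \<le> n" using ix mem by (simp add: m_def)
  have "indep_var (PiM {..<m} (\<lambda>_. borel)) (\<lambda>\<omega>. restrict (\<lambda>i. D i \<omega>) {..<m})
                  (PiM {m..<n} (\<lambda>_. borel)) (\<lambda>\<omega>. restrict (\<lambda>i. D i \<omega>) {m..<n})"
    by (rule indep_var_restrict[OF ind]) (use mn in auto)
  then have "indep_var (PiM J (\<lambda>_. borel))
       ((\<lambda>p. \<lambda>j\<in>J. \<Sum>k\<in>{ix 0..<ix j}. p k) \<circ> (\<lambda>\<omega>. restrict (\<lambda>i. D i \<omega>) {..<m}))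
       (PiM K (\<lambda>_. borel))
       ((\<lambda>p. \<lambda>j\<in>K. \<Sum>k\<in>{m..<ix (s + j)}. p k) \<circ> (\<lambda>\<omega>. restrict (\<lambda>i. D i \<omega>) {m..<n}))"
  proof (rule indep_var_compose)
    show "(\<lambda>p. \<lambda>j\<in>J. \<Sum>k = ix 0..<ix j. p k) \<in> Pi\<^sub>M {..<m} (\<lambda>_. borel) \<rightarrow>\<^sub>M Pi\<^sub>M J (\<lambda>_. borel::'a measure)"
      using assms mem ix_le unfolding m_def
      by (intro measurable_restrict borel_measurable_sum measurable_component_singleton)
         (auto, meson atLeastAtMost_iff less_le_trans subsetD)
    show "(\<lambda>p. \<lambda>j\<in>K. \<Sum>k = m..<ix (s + j). p k) \<in> Pi\<^sub>M {m..<n} (\<lambda>_. borel) \<rightarrow>\<^sub>M Pi\<^sub>M K (\<lambda>_. borel::'a measure)"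
      using mem ix by (intro measurable_restrict borel_measurable_sum measurable_component_singleton)
         (auto, meson less_le_trans)
  qed
  moreover have "(\<lambda>p. \<lambda>j\<in>J. \<Sum>k\<in>{ix 0..<ix j}. p k) \<circ> (\<lambda>\<omega>. restrict (\<lambda>i. D i \<omega>) {..<m})
      = (\<lambda>\<omega>. \<lambda>j\<in>J. X j \<omega> - X 0 \<omega>)"
  proof (intro ext)
    fix \<omega> j
    show "((\<lambda>p. \<lambda>j\<in>J. \<Sum>k\<in>{ix 0..<ix j}. p k) \<circ> (\<lambda>\<omega>. restrict (\<lambda>i. D i \<omega>) {..<m})) \<omega> j
      = (\<lambda>j\<in>J. X j \<omega> - X 0 \<omega>) j"
    proof (cases "j \<in> J")
      case True
      have "ix j \<le> m" using True assms mem ix_le by (auto simp: m_def)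
      then have "(\<Sum>k\<in>{ix 0..<ix j}. restrict (\<lambda>i. D i \<omega>) {..<m} k) = (\<Sum>k\<in>{ix 0..<ix j}. D k \<omega>)"
        by (intro sum.cong) auto
      also have "\<dots> = X j \<omega> - X 0 \<omega>"
        using tele[OF ix0, of j \<omega>] ix mem True by auto
      finally show ?thesis using True by simp
    qed simp
  qed
  moreover have "(\<lambda>p. \<lambda>j\<in>K. \<Sum>k\<in>{m..<ix (s + j)}. p k) \<circ> (\<lambda>\<omega>. restrict (\<lambda>i. D i \<omega>) {m..<n})
      = (\<lambda>\<omega>. \<lambda>k\<in>K. X (s + k) \<omega> - X s \<omega>)"
  proof (intro ext)
    fix \<omega> j
    show "((\<lambda>p. \<lambda>j\<in>K. \<Sum>k\<in>{m..<ix (s + j)}. p k) \<circ> (\<lambda>\<omega>. restrict (\<lambda>i. D i \<omega>) {m..<n})) \<omega> j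
      = (\<lambda>k\<in>K. X (s + k) \<omega> - X s \<omega>) j"
    proof (cases "j \<in> K")
      case True
      have le: "m \<le> ix (s + j)" "ix (s + j) \<le> n"
        using True assms mem ix_le ix unfolding m_def by (auto simp: subset_iff)
      then have "(\<Sum>k\<in>{m..<ix (s+j)}. restrict (\<lambda>i. D i \<omega>) {m..<n} k) = (\<Sum>k\<in>{m..<ix (s+j)}. D k \<omega>)"
        by (intro sum.cong) auto
      also have "\<dots> = X (s+j) \<omega> - X s \<omega>"
        using tele[OF le(1), of \<omega>] ix mem True by (auto simp: m_def)
      finally show ?thesis using True by simp
    qed simp
  qed
  ultimately show ?thesis by simp
qed

text \<open>
  Independence makes the joint law of the grid increments a product, and each factor depends only on the
  length of its interval, so a shift by \<open>s\<close> changes nothing. The time \<open>1\<close> is added to the grid only to keep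
  the family of increments nonempty.
\<close>
lemma law_of_future_finite:
  assumes "finite J" "J \<subseteq> {0..}" "0 \<le> s"
  shows "distr M (PiM J (\<lambda>_. borel)) (\<lambda>\<omega>. \<lambda>j\<in>J. X (s + j) \<omega> - X s \<omega>)
       = distr M (PiM J (\<lambda>_. borel)) (\<lambda>\<omega>. \<lambda>j\<in>J. X j \<omega> - X 0 \<omega>)"
proof -
  define F where "F = {0, 1::real} \<union> J"
  have F: "finite F" "F \<noteq> {}" "F \<subseteq> {0..}" using assms by (auto simp: F_def)
  obtain \<tau> :: "nat \<Rightarrow> real" and n where \<tau>: "\<tau> ` {..n} = F" "strict_mono_on {..n} \<tau>" "n = card F - 1"
    using finite_set_enumeration[OF F(1,2)] by blast
  have "card {0,1::real} \<le> card F" using F(1) by (intro card_mono) (auto simp: F_def)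
  then have npos: "n > 0" using \<tau>(3) by simp
  have "\<forall>r\<in>F. \<exists>i\<le>n. \<tau> i = r" using \<tau>(1) by fastforce
  then obtain ix where ix: "\<And>r. r \<in> F \<Longrightarrow> ix r \<le> n \<and> \<tau> (ix r) = r" by metis
  have mem: "0 \<in> F" "\<And>j. j \<in> J \<Longrightarrow> j \<in> F" by (auto simp: F_def)
  have ix0: "ix 0 \<le> ix r" if "r \<in> F" for r
    using strict_mono_on_le_iff[OF \<tau>(2), of "ix 0" "ix r"] ix that mem F(3) by auto
  have \<tau>nn: "0 \<le> \<tau> i" if "i \<le> n" for i using \<tau>(1) F(3) that by auto
  have \<tau>mono: "\<tau> i \<le> \<tau> (Suc i)" if "i < n" for i using strict_mono_on_le_iff[OF \<tau>(2)] that by auto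
  define D where "D s i \<omega> = X (s + \<tau> (Suc i)) \<omega> - X (s + \<tau> i) \<omega>" for s i \<omega>
  define \<Phi> where "\<Phi> p = (\<lambda>j\<in>J. \<Sum>k\<in>{ix 0..<ix j}. p k)" for p :: "nat \<Rightarrow> 'a"
  have \<Phi>: "\<Phi> \<in> PiM {..<n} (\<lambda>_. borel) \<rightarrow>\<^sub>M PiM J (\<lambda>_. borel)"
    unfolding \<Phi>_def using mem ix
    by (intro measurable_restrict borel_measurable_sum measurable_component_singleton)
       (auto, meson less_le_trans)
  have law: "distr M (PiM J (\<lambda>_. borel)) (\<lambda>\<omega>. \<lambda>j\<in>J. X (s + j) \<omega> - X s \<omega>)
      = distr (PiM {..<n} (\<lambda>i. distr M borel (X (\<tau> (Suc i) - \<tau> i)))) (PiM J (\<lambda>_. borel)) \<Phi>"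
    if s: "0 \<le> s" for s
  proof -
    have meas: "D s i \<in> borel_measurable M" if "i < n" for i
      unfolding D_def using s \<tau>nn that by (intro measurable_increment) auto
    have "indep_vars (\<lambda>_. borel) (D s) {..<n}"
      unfolding D_def using s \<tau>nn \<tau>mono by (intro indep_increments[of "\<lambda>i. s + \<tau> i"]) auto
    then have "distr M (PiM {..<n} (\<lambda>_. borel)) (\<lambda>\<omega>. \<lambda>i\<in>{..<n}. D s i \<omega>)
        = PiM {..<n} (\<lambda>i. distr M borel (D s i))"
      using npos meas by (subst indep_vars_iff_distr_eq_PiM'[symmetric]) auto
    also have "\<dots> = PiM {..<n} (\<lambda>i. distr M borel (X (\<tau> (Suc i) - \<tau> i)))"
    proof (intro PiM_cong refl)
      fix i assume "i \<in> {..<n}"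
      then show "distr M borel (D s i) = distr M borel (X (\<tau> (Suc i) - \<tau> i))"
        unfolding D_def
        using stationary_increments[of "s + \<tau> i" "s + \<tau> (Suc i)"] s \<tau>nn[of i] \<tau>mono[of i] by simp
    qed
    finally have "distr (PiM {..<n} (\<lambda>i. distr M borel (X (\<tau> (Suc i) - \<tau> i)))) (PiM J (\<lambda>_. borel)) \<Phi>
        = distr (distr M (PiM {..<n} (\<lambda>_. borel)) (\<lambda>\<omega>. \<lambda>i\<in>{..<n}. D s i \<omega>)) (PiM J (\<lambda>_. borel)) \<Phi>"
      by simp
    also have "\<dots> = distr M (PiM J (\<lambda>_. borel)) (\<Phi> \<circ> (\<lambda>\<omega>. \<lambda>i\<in>{..<n}. D s i \<omega>))"
      using meas by (intro distr_distr \<Phi> measurable_restrict) auto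
    also have "\<Phi> \<circ> (\<lambda>\<omega>. \<lambda>i\<in>{..<n}. D s i \<omega>) = (\<lambda>\<omega>. \<lambda>j\<in>J. X (s + j) \<omega> - X s \<omega>)"
    proof (intro ext)
      fix \<omega> j
      show "(\<Phi> \<circ> (\<lambda>\<omega>. \<lambda>i\<in>{..<n}. D s i \<omega>)) \<omega> j = (\<lambda>j\<in>J. X (s + j) \<omega> - X s \<omega>) j"
      proof (cases "j \<in> J")
        case True
        have le: "ix 0 \<le> ix j" "ix j \<le> n" using True ix0 ix mem by auto
        have "(\<Sum>k\<in>{ix 0..<ix j}. (\<lambda>i\<in>{..<n}. D s i \<omega>) k) = (\<Sum>k\<in>{ix 0..<ix j}. D s k \<omega>)"
          using le by (intro sum.cong) auto
        also have "\<dots> = X (s + j) \<omega> - X s \<omega>"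
          unfolding D_def using sum_Suc_diff'[OF le(1), of "\<lambda>i. X (s + \<tau> i) \<omega>"] ix mem True by auto
        finally show ?thesis using True by (simp add: \<Phi>_def)
      qed (simp add: \<Phi>_def)
    qed
    finally show ?thesis by (rule sym)
  qed
  show ?thesis using law[OF assms(3)] law[of 0] by simp
qed

end

section \<open>Path laws and the Markov property\<close>

abbreviation path_space :: "real \<Rightarrow> (real \<Rightarrow> 'a::euclidean_space) measure" where
  "path_space T \<equiv> PiM {0..T} (\<lambda>_. borel)"

text \<open>
  The value at \<open>r\<close> of a right-continuous path \<open>p\<close>, read off from countably many sampling times in \<open>{0..T}\<close>.
  It serves to evaluate a path measurably in time and path together, with respect to the product
  \<open>\<sigma>\<close>-algebra, for which evaluation at a varying time is not measurable on all functions.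
\<close>
definition right_val :: "real \<Rightarrow> (real \<Rightarrow> 'a::euclidean_space) \<Rightarrow> real \<Rightarrow> 'a" where
  "right_val T p r = lim (\<lambda>n. p (min T (max 0 ((of_int \<lfloor>2 ^ n * r\<rfloor> + 1) / 2 ^ n))))"

lemma dyadic_successor:
  fixes r :: real and n :: nat
  shows "r < (of_int \<lfloor>2 ^ n * r\<rfloor> + 1) / 2 ^ n" "(of_int \<lfloor>2 ^ n * r\<rfloor> + 1) / 2 ^ n \<le> r + 1 / 2 ^ n"
  by (simp_all add: field_simps) linarith+

lemma right_val_restrict:
  fixes f :: "real \<Rightarrow> 'a::euclidean_space"
  assumes rc: "\<And>r. 0 \<le> r \<Longrightarrow> r < T \<Longrightarrow> (f \<longlongrightarrow> f r) (at_right r)" and r: "r \<in> {0..T}"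
  shows "right_val T (restrict f {0..T}) r = f r"
proof -
  define g :: "nat \<Rightarrow> real" where "g n = (of_int \<lfloor>2 ^ n * r\<rfloor> + 1) / 2 ^ n" for n :: nat
  have g: "r < g n" "g n \<le> r + 1 / 2 ^ n" for n
    using dyadic_successor[where r = r and n = n] by (auto simp: g_def)
  have "(\<lambda>n. restrict f {0..T} (min T (max 0 (g n)))) \<longlonglongrightarrow> f r"
  proof (cases "r = T")
    case True
    then have "restrict f {0..T} (min T (max 0 (g n))) = f r" for n
      using g(1)[of n] r by (simp add: min_def max_def)
    then show ?thesis by simp
  next
    case False
    then have rT: "r < T" using r by auto
    have "(\<lambda>n. r + 1 / 2 ^ n) \<longlonglongrightarrow> r + 0"
      using LIMSEQ_inverse_realpow_zero[of 2]
      by (intro tendsto_add tendsto_const) (auto simp: divide_simps field_simps)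
    then have gr: "g \<longlonglongrightarrow> r"
      using g by (intro tendsto_sandwich[OF _ _ tendsto_const, of _ g _ "\<lambda>n. r + 1 / 2 ^ n"])
        (auto intro!: always_eventually less_imp_le)
    have "filterlim g (at_right r) sequentially"
      using gr g(1) by (auto simp: filterlim_at intro!: always_eventually simp: order_less_imp_not_eq2)
    then have "(\<lambda>n. f (g n)) \<longlonglongrightarrow> f r"
      using rc[of r] rT r by (auto intro: filterlim_compose)
    moreover have "eventually (\<lambda>n. f (g n) = restrict f {0..T} (min T (max 0 (g n)))) sequentially"
      using order_tendstoD(2)[OF gr rT]
    proof eventually_elim
      case (elim n)
      then show ?case using g(1)[of n] r by (simp add: min_def max_def)
    qed
    ultimately show ?thesis by (rule Lim_transform_eventually)
  qed
  then show ?thesis unfolding right_val_def g_def by (rule limI)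
qed

text \<open>
  For each resolution \<open>n\<close> the sampling time takes only countably many values, and for a fixed value the path is
  evaluated at a fixed time. Joint measurability then survives the limit.
\<close>
lemma measurable_right_val:
  assumes "0 \<le> T"
  shows "(\<lambda>(r, p). right_val T p r :: 'a::euclidean_space) \<in> borel \<Otimes>\<^sub>M path_space T \<rightarrow>\<^sub>M borel"
proof -
  have "(\<lambda>z. (snd z) (min T (max 0 ((of_int \<lfloor>2 ^ n * fst z :: real\<rfloor> + 1) / 2 ^ n))))
      \<in> borel \<Otimes>\<^sub>M path_space T \<rightarrow>\<^sub>M (borel :: 'a measure)" for n :: nat
  proof (rule measurable_compose_countable[where g = "\<lambda>z. \<lfloor>2 ^ n * fst z :: real\<rfloor>"
      and f = "\<lambda>i z. (snd z) (min T (max 0 ((real_of_int i + 1) / 2 ^ n)))"])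
    fix i :: int
    show "(\<lambda>z. (snd z) (min T (max 0 ((real_of_int i + 1) / 2 ^ n))))
      \<in> borel \<Otimes>\<^sub>M path_space T \<rightarrow>\<^sub>M (borel :: 'a measure)"
      using assms by (intro measurable_compose[OF measurable_snd] measurable_component_singleton) auto
  next
    show "(\<lambda>z. \<lfloor>2 ^ n * fst z :: real\<rfloor>) \<in> borel \<Otimes>\<^sub>M path_space T \<rightarrow>\<^sub>M count_space UNIV"
      by measurable
  qed
  then show ?thesis
    unfolding right_val_def case_prod_beta by (rule borel_measurable_lim_metric)
qed

lemma Int_stable_vimage:
  assumes "Int_stable P"
  shows "Int_stable {f -` A \<inter> S | A. A \<in> P}"
proof (rule Int_stableI)
  fix a b assume "a \<in> {f -` A \<inter> S | A. A \<in> P}" "b \<in> {f -` A \<inter> S | A. A \<in> P}"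
  then obtain A B where "A \<in> P" "B \<in> P" and ab: "a = f -` A \<inter> S" "b = f -` B \<inter> S" by blast
  then have "A \<inter> B \<in> P" using assms by (auto simp: Int_stable_def)
  moreover have "a \<inter> b = f -` (A \<inter> B) \<inter> S" using ab by auto
  ultimately show "a \<inter> b \<in> {f -` A \<inter> S | A. A \<in> P}" by blast
qed

lemma (in prob_space) indep_var_from_prod_algebra:
  assumes X: "X \<in> M \<rightarrow>\<^sub>M PiM I N" and Y: "Y \<in> M \<rightarrow>\<^sub>M PiM J L"
    and ind: "\<And>A B. A \<in> prod_algebra I N \<Longrightarrow> B \<in> prod_algebra J L \<Longrightarrow>
      prob ((X -` A \<inter> space M) \<inter> (Y -` B \<inter> space M)) = prob (X -` A \<inter> space M) * prob (Y -` B \<inter> space M)"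
  shows "indep_var (PiM I N) X (PiM J L) Y"
proof -
  let ?VX = "{X -` A \<inter> space M | A. A \<in> prod_algebra I N}"
  let ?VY = "{Y -` A \<inter> space M | A. A \<in> prod_algebra J L}"
  have eq: "{f -` A \<inter> space M | A. A \<in> sets (PiM I' N')}
      = sigma_sets (space M) {f -` A \<inter> space M | A. A \<in> prod_algebra I' N'}"
    if "f \<in> M \<rightarrow>\<^sub>M PiM I' N'" for f and I' :: "'x set" and N' :: "'x \<Rightarrow> 'y measure"
    unfolding sets_PiM
    using measurable_space[OF that] by (intro sigma_sets_vimage_commute) (auto simp: space_PiM)
  have "indep_set ?VX ?VY"
    unfolding indep_sets2_eq
    using measurable_sets[OF X] measurable_sets[OF Y] ind by (auto simp: sets_PiM intro: sigma_sets.Basic)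
  then have "indep_set (sigma_sets (space M) ?VX) (sigma_sets (space M) ?VY)"
    by (intro indep_set_sigma_sets Int_stable_vimage Int_stable_prod_algebra)
  moreover have "?VX \<subseteq> Pow (space M)" "?VY \<subseteq> Pow (space M)" by auto
  ultimately show ?thesis
    unfolding indep_var_eq using X Y
    by (simp add: eq sigma_sets_sigma_sets_eq)
qed

text \<open>
  The process starts at \<open>0\<close> for every outcome and not only almost surely, so a path in \<open>{0..s}\<close> is determined by
  its increments without exceptional sets.
\<close>
locale pinned_stable_process = stable_process M \<alpha> X
  for M :: "'w measure" and \<alpha> and X :: "real \<Rightarrow> 'w \<Rightarrow> 'a::euclidean_space" +
  assumes pinned: "\<omega> \<in> space M \<Longrightarrow> X 0 \<omega> = 0"
begin

definition traj :: "real \<Rightarrow> 'w \<Rightarrow> real \<Rightarrow> 'a" where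
  "traj T \<omega> = (\<lambda>r\<in>{0..T}. X r \<omega>)"

definition future :: "real \<Rightarrow> real \<Rightarrow> 'w \<Rightarrow> real \<Rightarrow> 'a" where
  "future s T \<omega> = (\<lambda>r\<in>{0..T}. X (s + r) \<omega> - X s \<omega>)"

lemma measurable_traj [measurable]: "traj T \<in> M \<rightarrow>\<^sub>M path_space T"
  unfolding traj_def by (intro measurable_restrict rv) auto

lemma measurable_future [measurable]: "0 \<le> s \<Longrightarrow> future s T \<in> M \<rightarrow>\<^sub>M path_space T"
  unfolding future_def by (intro measurable_restrict measurable_increment) auto

text \<open>
  Cylinder sets generate the path \<open>\<sigma>\<close>-algebras and are stable under intersection, so it is enough to
  look at finitely many times.
\<close>
lemma indep_past_future:
  assumes s: "0 \<le> s"
  shows "indep_var (path_space s) (traj s) (path_space t) (future s t)"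
proof (rule indep_var_from_prod_algebra)
  fix A B
  assume "A \<in> prod_algebra {0..s} (\<lambda>_. borel :: 'a measure)" "B \<in> prod_algebra {0..t} (\<lambda>_. borel :: 'a measure)"
  then obtain J E K F where A: "A = prod_emb {0..s} (\<lambda>_. borel) J (PiE J E)" "finite J" "J \<subseteq> {0..s}"
      "\<And>i. i \<in> J \<Longrightarrow> E i \<in> sets borel"
    and B: "B = prod_emb {0..t} (\<lambda>_. borel) K (PiE K F)" "finite K" "K \<subseteq> {0..t}"
      "\<And>i. i \<in> K \<Longrightarrow> F i \<in> sets borel"
    by (elim prod_algebraE) blast
  let ?x = "\<lambda>\<omega>. \<lambda>j\<in>J. X j \<omega> - X 0 \<omega>" and ?y = "\<lambda>\<omega>. \<lambda>k\<in>K. X (s + k) \<omega> - X s \<omega>"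
  have 1: "traj s -` A \<inter> space M = ?x -` (PiE J E) \<inter> space M"
    using A(3) pinned by (auto simp: A(1) traj_def prod_emb_def PiE_iff subset_iff)
  have 2: "future s t -` B \<inter> space M = ?y -` (PiE K F) \<inter> space M"
    using B(3) by (auto simp: B(1) future_def prod_emb_def PiE_iff subset_iff)
  have "prob ((\<lambda>\<omega>. (?x \<omega>, ?y \<omega>)) -` (PiE J E \<times> PiE K F) \<inter> space M)
      = prob (?x -` (PiE J E) \<inter> space M) * prob (?y -` (PiE K F) \<inter> space M)"
    using A B s by (intro indep_varD[OF indep_past_future_finite]) (auto intro!: sets_PiM_I_finite)
  moreover have "(\<lambda>\<omega>. (?x \<omega>, ?y \<omega>)) -` (PiE J E \<times> PiE K F) \<inter> space M
      = (?x -` (PiE J E) \<inter> space M) \<inter> (?y -` (PiE K F) \<inter> space M)" by auto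
  ultimately show "prob ((traj s -` A \<inter> space M) \<inter> (future s t -` B \<inter> space M))
     = prob (traj s -` A \<inter> space M) * prob (future s t -` B \<inter> space M)"
    by (simp add: 1 2)
qed (use s in \<open>auto intro: measurable_traj measurable_future\<close>)

lemma law_of_future:
  assumes s: "0 \<le> s"
  shows "distr M (path_space t) (future s t) = distr M (path_space t) (traj t)"
proof (rule measure_eqI_PiM_infinite[where I = "{0..t}" and M = "\<lambda>_. borel"])
  fix E :: "real \<Rightarrow> 'a set" and J assume J: "finite J" "J \<subseteq> {0..t}" "\<And>i. i \<in> J \<Longrightarrow> E i \<in> sets borel"
  let ?x = "\<lambda>\<omega>. \<lambda>j\<in>J. X j \<omega> - X 0 \<omega>" and ?y = "\<lambda>\<omega>. \<lambda>k\<in>J. X (s + k) \<omega> - X s \<omega>"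
  have 1: "traj t -` prod_emb {0..t} (\<lambda>_. borel) J (PiE J E) \<inter> space M = ?x -` (PiE J E) \<inter> space M"
    using J(2) pinned by (auto simp: traj_def prod_emb_def PiE_iff subset_iff)
  have 2: "future s t -` prod_emb {0..t} (\<lambda>_. borel) J (PiE J E) \<inter> space M = ?y -` (PiE J E) \<inter> space M"
    using J(2) by (auto simp: future_def prod_emb_def PiE_iff subset_iff)
  have meas: "?x \<in> M \<rightarrow>\<^sub>M PiM J (\<lambda>_. borel)" "?y \<in> M \<rightarrow>\<^sub>M PiM J (\<lambda>_. borel)"
    using J s by (auto intro!: measurable_restrict measurable_increment)
  have E: "PiE J E \<in> sets (PiM J (\<lambda>_. borel))" using J by (intro sets_PiM_I_finite) auto
  have C: "prod_emb {0..t} (\<lambda>_. borel) J (PiE J E) \<in> sets (path_space t)"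
    using J by (intro sets_PiM_I) auto
  have "emeasure (distr M (PiM J (\<lambda>_. borel)) ?y) (PiE J E) = emeasure (distr M (PiM J (\<lambda>_. borel)) ?x) (PiE J E)"
    using J s by (subst law_of_future_finite) auto
  then have "emeasure M (?y -` (PiE J E) \<inter> space M) = emeasure M (?x -` (PiE J E) \<inter> space M)"
    using meas E by (simp add: emeasure_distr)
  then show "emeasure (distr M (path_space t) (future s t)) (prod_emb {0..t} (\<lambda>_. borel) J (PiE J E))
    = emeasure (distr M (path_space t) (traj t)) (prod_emb {0..t} (\<lambda>_. borel) J (PiE J E))"
    using emeasure_distr[OF measurable_future[OF s] C] emeasure_distr[OF measurable_traj C]
    by (simp only: 1 2)
next
  show "finite_measure (distr M (path_space t) (future s t))"
    using s by (intro prob_space.finite_measure prob_space_distr) simp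
qed simp_all

text \<open>
  The Markov property at time \<open>s\<close> for functionals of the whole path: after \<open>s\<close> the process may be replaced by an
  independent copy of itself.
\<close>
theorem nn_integral_markov:
  assumes s: "0 \<le> s" and \<Phi>: "\<Phi> \<in> borel_measurable (path_space s \<Otimes>\<^sub>M path_space t)"
  shows "(\<integral>\<^sup>+ \<omega>. \<Phi> (traj s \<omega>, future s t \<omega>) \<partial>M) = (\<integral>\<^sup>+ \<omega>. \<integral>\<^sup>+ \<omega>'. \<Phi> (traj s \<omega>, traj t \<omega>') \<partial>M \<partial>M)"
proof -
  let ?P = "distr M (path_space s) (traj s)" and ?F = "distr M (path_space t) (traj t)"
  interpret F: prob_space ?F by (rule prob_space_distr) simp
  have "(\<integral>\<^sup>+ \<omega>. \<Phi> (traj s \<omega>, future s t \<omega>) \<partial>M)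
      = (\<integral>\<^sup>+ z. \<Phi> z \<partial>distr M (path_space s \<Otimes>\<^sub>M path_space t) (\<lambda>\<omega>. (traj s \<omega>, future s t \<omega>)))"
    using s \<Phi> by (subst nn_integral_distr) (auto intro!: measurable_Pair)
  also have "distr M (path_space s \<Otimes>\<^sub>M path_space t) (\<lambda>\<omega>. (traj s \<omega>, future s t \<omega>)) = ?P \<Otimes>\<^sub>M ?F"
    using indep_past_future[OF s, of t] law_of_future[OF s, of t] unfolding indep_var_distribution_eq
    by simp
  also have "(\<integral>\<^sup>+ z. \<Phi> z \<partial>(?P \<Otimes>\<^sub>M ?F)) = (\<integral>\<^sup>+ p. \<integral>\<^sup>+ q. \<Phi> (p, q) \<partial>?F \<partial>?P)"
    using \<Phi> by (intro F.nn_integral_fst[symmetric])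
      (simp cong: measurable_cong_sets sets_pair_measure_cong)
  also have "\<dots> = (\<integral>\<^sup>+ p. \<integral>\<^sup>+ \<omega>'. \<Phi> (p, traj t \<omega>') \<partial>M \<partial>?P)"
    using \<Phi> by (intro nn_integral_cong nn_integral_distr) (auto intro: measurable_compose_Pair1)
  also have "\<dots> = (\<integral>\<^sup>+ \<omega>. \<integral>\<^sup>+ \<omega>'. \<Phi> (traj s \<omega>, traj t \<omega>') \<partial>M \<partial>M)"
  proof (rule nn_integral_distr)
    have "(\<lambda>z. (fst z, traj t (snd z))) \<in> path_space s \<Otimes>\<^sub>M M \<rightarrow>\<^sub>M path_space s \<Otimes>\<^sub>M path_space t"
      by measurable
    from measurable_compose[OF this \<Phi>]
    show "(\<lambda>p. \<integral>\<^sup>+ \<omega>'. \<Phi> (p, traj t \<omega>') \<partial>M) \<in> borel_measurable (distr M (path_space s) (traj s))"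
      by (intro borel_measurable_nn_integral) (simp add: case_prod_beta)
  qed simp
  finally show ?thesis .
qed

lemma right_val_path: "\<omega> \<in> space M \<Longrightarrow> r \<in> {0..T} \<Longrightarrow> right_val T (traj T \<omega>) r = X r \<omega>"
  unfolding traj_def by (rule right_val_restrict) (auto intro: right_continuous)

lemma future_right_continuous:
  assumes "\<omega> \<in> space M" "0 \<le> s" "0 \<le> r"
  shows "((\<lambda>r. X (s + r) \<omega> - X s \<omega>) \<longlongrightarrow> X (s + r) \<omega> - X s \<omega>) (at_right r)"
proof -
  have "filterlim ((+) s) (at_right (s + r)) (at_right r)"
    unfolding filterlim_at by (auto simp: eventually_at_filter intro!: tendsto_eq_intros)
  then have "((\<lambda>r. X (s + r) \<omega>) \<longlongrightarrow> X (s + r) \<omega>) (at_right r)"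
    using right_continuous[of \<omega> "s + r"] assms by (auto intro: filterlim_compose)
  then show ?thesis by (intro tendsto_diff tendsto_const)
qed

lemma right_val_future:
  "\<omega> \<in> space M \<Longrightarrow> 0 \<le> s \<Longrightarrow> r \<in> {0..T} \<Longrightarrow> right_val T (future s T \<omega>) r = X (s + r) \<omega> - X s \<omega>"
  unfolding future_def by (rule right_val_restrict) (auto intro: future_right_continuous)

end

text \<open>
  The integral of \<open>W\<close> along the path that starts at \<open>z\<close>, as a function on path space. Being a function of the path
  alone, it can be fed with the past, with the future, or with an independent copy.
\<close>
definition path_integral :: "('a::euclidean_space \<Rightarrow> real) \<Rightarrow> real \<Rightarrow> 'a \<Rightarrow> (real \<Rightarrow> 'a) \<Rightarrow> real" where
  "path_integral W T z p = (LINT r:{0..T}|lborel. W (z + right_val T p r))"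

lemma measurable_path_integral [measurable]:
  assumes [measurable]: "W \<in> borel_measurable borel" and "0 \<le> T"
  shows "(\<lambda>(z, p). path_integral W T z p) \<in> borel \<Otimes>\<^sub>M path_space T \<rightarrow>\<^sub>M borel"
proof -
  have [measurable]: "(\<lambda>(r, p). right_val T p r :: 'a) \<in> borel \<Otimes>\<^sub>M path_space T \<rightarrow>\<^sub>M borel"
    using assms(2) by (rule measurable_right_val)
  have "(\<lambda>x. right_val T (snd (fst x)) (snd x) :: 'a)
     \<in> (borel \<Otimes>\<^sub>M path_space T) \<Otimes>\<^sub>M lborel \<rightarrow>\<^sub>M borel"
    using measurable_compose[OF _ measurable_right_val[OF assms(2)], of "\<lambda>x. (snd x, snd (fst x))"
      "(borel \<Otimes>\<^sub>M path_space T) \<Otimes>\<^sub>M lborel"] by simp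
  note [measurable] = this
  show ?thesis
    unfolding path_integral_def set_lebesgue_integral_def case_prod_beta
    by (rule lborel.borel_measurable_lebesgue_integral) measurable
qed

lemma measurable_path_integral' [measurable (raw)]:
  assumes "W \<in> borel_measurable borel" "0 \<le> T"
    and "f \<in> borel_measurable N" "g \<in> N \<rightarrow>\<^sub>M path_space T"
  shows "(\<lambda>x. path_integral W T (f x) (g x)) \<in> borel_measurable N"
  using measurable_compose[OF measurable_Pair[OF assms(3,4)] measurable_path_integral[OF assms(1,2)]]
  by simp

context pinned_stable_process
begin

lemma path_integral_path:
  "\<omega> \<in> space M \<Longrightarrow> path_integral W T z (traj T \<omega>) = (LINT r:{0..T}|lborel. W (z + X r \<omega>))"
  unfolding path_integral_def by (intro set_lebesgue_integral_cong) (auto simp: right_val_path)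

lemma path_integral_future:
  "\<omega> \<in> space M \<Longrightarrow> 0 \<le> s \<Longrightarrow>
     path_integral W T z (future s T \<omega>) = (LINT r:{0..T}|lborel. W (z + (X (s + r) \<omega> - X s \<omega>)))"
  unfolding path_integral_def by (intro set_lebesgue_integral_cong) (auto simp: right_val_future)

end

section \<open>Exit probabilities\<close>

text \<open>
  The integral equals \<open>1 - sin y / y\<close>, and \<open>\<bar>sin y / y\<bar> \<le> 1 / \<bar>y\<bar>\<close>.
\<close>
lemma nn_integral_one_minus_cos_ge:
  fixes y :: real
  assumes "2 \<le> \<bar>y\<bar>"
  shows "ennreal (1/2) \<le> (\<integral>\<^sup>+ s. ennreal (1 - cos (s * y)) * indicator {0..1} s \<partial>lborel)"
proof -
  have y: "y \<noteq> 0" using assms by auto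
  have "(\<integral>\<^sup>+ s. ennreal (1 - cos (s * y)) * indicator {0..1} s \<partial>lborel)
      = ennreal ((1 - sin (1 * y) / y) - (0 - sin (0 * y) / y))"
  proof (rule nn_integral_FTC_Icc)
    fix s :: real
    have "((\<lambda>s. s - sin (s * y) / y) has_real_derivative 1 - cos (s * y)) (at s)"
      by (rule derivative_eq_intros refl | use y in simp)+
    then show "((\<lambda>s. s - sin (s * y) / y) has_real_derivative 1 - cos (s * y)) (at s)" .
  qed auto
  moreover have "1/2 \<le> 1 - sin y / y"
  proof -
    have "\<bar>sin y / y\<bar> \<le> 1 / \<bar>y\<bar>" by (simp add: abs_divide divide_right_mono)
    also have "\<dots> \<le> 1 / 2" using assms by (intro divide_left_mono) auto
    finally show ?thesis by linarith
  qed
  ultimately show ?thesis using ennreal_leI[of "1/2" "1 - sin y / y"] by simp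
qed

lemma dyadic_time_in_interval:
  assumes "i \<le> 2 ^ n" "0 \<le> T"
  shows "T * real i / 2 ^ n \<in> {0..T}"
proof -
  have "real i \<le> 2 ^ n" using assms(1) by (metis of_nat_le_iff of_nat_numeral of_nat_power)
  then show ?thesis using assms(2) by (auto simp: field_simps intro: mult_left_mono)
qed

text \<open>
  A strict excess at a time \<open>s < T\<close> persists on an interval to the right of \<open>s\<close>, which contains a dyadic
  fraction of \<open>T\<close>. Hence suprema over an interval are suprema over countably many times.
\<close>
lemma right_continuous_exceeds_iff_dyadic:
  fixes f :: "real \<Rightarrow> 'a::real_normed_vector"
  assumes rc: "\<And>r. 0 \<le> r \<Longrightarrow> r < T \<Longrightarrow> (f \<longlongrightarrow> f r) (at_right r)" and T: "0 \<le> T"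
  shows "(\<exists>s\<in>{0..T}. R < norm (f s)) \<longleftrightarrow> (\<exists>n. \<exists>i\<le>2 ^ n. R < norm (f (T * real i / 2 ^ n)))"
proof
  assume "\<exists>s\<in>{0..T}. R < norm (f s)"
  then obtain s where s: "0 \<le> s" "s \<le> T" "R < norm (f s)" by auto
  show "\<exists>n. \<exists>i\<le>2 ^ n. R < norm (f (T * real i / 2 ^ n))"
  proof (cases "s = T")
    case True
    then show ?thesis using s by (intro exI[of _ 0] exI[of _ 1]) auto
  next
    case False
    then have sT: "s < T" "0 < T" using s by auto
    have "((\<lambda>r. norm (f r)) \<longlongrightarrow> norm (f s)) (at_right s)"
      using rc s(1) sT(1) by (intro tendsto_norm) auto
    then have "eventually (\<lambda>r. R < norm (f r)) (at_right s)" using s(3) by (rule order_tendstoD)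
    then obtain b where b: "s < b" "\<And>y. s < y \<Longrightarrow> y < b \<Longrightarrow> R < norm (f y)"
      using eventually_at_right[OF sT(1)] by auto
    obtain n :: nat where n: "inverse (2 ^ n) < (min b T - s) / T"
      using real_arch_pow_inv[of "(min b T - s) / T" "1/2"] b(1) sT by (auto simp: power_divide inverse_eq_divide)
    define j where "j = nat (\<lfloor>2 ^ n * (s / T)\<rfloor> + 1)"
    have jj: "real j = of_int \<lfloor>2 ^ n * (s / T)\<rfloor> + 1"
      using s sT by (simp add: j_def)
    have "s / T < real j / 2 ^ n" "real j / 2 ^ n \<le> s / T + 1 / 2 ^ n"
      using dyadic_successor[where r = "s / T" and n = n] by (auto simp: jj)
    then have 1: "s < T * real j / 2 ^ n" "T * real j / 2 ^ n \<le> s + T / 2 ^ n"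
      using sT by (auto simp: field_simps)
    moreover have "T / 2 ^ n < min b T - s" using n sT by (simp add: field_simps)
    ultimately have 2: "T * real j / 2 ^ n < min b T" by linarith
    then have "real j < 2 ^ n" using sT by (simp add: field_simps)
    then have "j \<le> 2 ^ n" by (metis less_imp_le of_nat_le_iff of_nat_numeral of_nat_power)
    then show ?thesis using b(2)[OF 1(1)] 2 by auto
  qed
next
  assume "\<exists>n. \<exists>i\<le>2 ^ n. R < norm (f (T * real i / 2 ^ n))"
  then obtain n i where i: "i \<le> 2 ^ n" "R < norm (f (T * real i / 2 ^ n))" by auto
  then show "\<exists>s\<in>{0..T}. R < norm (f s)" using dyadic_time_in_interval[OF i(1) T] by blast
qed

context stable_process
begin

lemma expectation_cos:
  assumes "0 \<le> t"
  shows "expectation (\<lambda>\<omega>. cos (\<xi> \<bullet> X t \<omega>)) = exp (- t * norm \<xi> powr \<alpha>)"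
proof -
  have [measurable]: "X t \<in> borel_measurable M" using rv assms by simp
  have int: "integrable M (\<lambda>\<omega>. exp (\<i> * complex_of_real (\<xi> \<bullet> X t \<omega>)))"
    by (rule integrable_const_bound[where B = 1]) auto
  have "Re (CLINT \<omega>|M. exp (\<i> * complex_of_real (\<xi> \<bullet> X t \<omega>)))
      = expectation (\<lambda>\<omega>. Re (exp (\<i> * complex_of_real (\<xi> \<bullet> X t \<omega>))))"
    by (rule integral_Re[OF int, symmetric])
  then show ?thesis using char_exponent[OF assms, of \<xi>] by (simp add: Re_exp)
qed

lemma nn_integral_one_minus_cos_le:
  assumes t: "0 \<le> t"
  shows "(\<integral>\<^sup>+ \<omega>. ennreal (1 - cos (\<xi> \<bullet> X t \<omega>)) \<partial>M) \<le> ennreal (t * norm \<xi> powr \<alpha>)"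
proof -
  have [measurable]: "X t \<in> borel_measurable M" using rv t by simp
  have int: "integrable M (\<lambda>\<omega>. cos (\<xi> \<bullet> X t \<omega>))"
    by (rule integrable_const_bound[where B = 1]) auto
  then have "(\<integral>\<^sup>+ \<omega>. ennreal (1 - cos (\<xi> \<bullet> X t \<omega>)) \<partial>M)
      = ennreal (expectation (\<lambda>\<omega>. 1 - cos (\<xi> \<bullet> X t \<omega>)))"
    by (intro nn_integral_eq_integral) auto
  also have "expectation (\<lambda>\<omega>. 1 - cos (\<xi> \<bullet> X t \<omega>)) = 1 - exp (- (t * norm \<xi> powr \<alpha>))"
    using int expectation_cos[OF t, of \<xi>] by (simp add: prob_space)
  also have "\<dots> \<le> t * norm \<xi> powr \<alpha>"
    using exp_ge_add_one_self[of "- (t * norm \<xi> powr \<alpha>)"] by linarith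
  finally show ?thesis by (auto intro: ennreal_leI)
qed

text \<open>
  By Fubini the average of \<open>1 - cos (s * u * (b \<bullet> X t))\<close> over \<open>s \<in> {0..1}\<close> has an expectation that the
  characteristic function bounds by \<open>t * u powr \<alpha>\<close>, while the average is at least \<open>1/2\<close> wherever
  \<open>u * \<bar>b \<bullet> X t\<bar> \<ge> 2\<close>.
\<close>
lemma prob_coordinate_ge:
  assumes t: "0 \<le> t" and u: "0 < u" and b: "b \<in> Basis"
  shows "prob {\<omega> \<in> space M. 2 / u \<le> \<bar>b \<bullet> X t \<omega>\<bar>} \<le> 2 * t * u powr \<alpha>"
proof -
  have [measurable]: "X t \<in> borel_measurable M" using rv t by simp
  let ?A = "{\<omega> \<in> space M. 2 / u \<le> \<bar>b \<bullet> X t \<omega>\<bar>}"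
  have "ennreal (1/2) * emeasure M ?A = (\<integral>\<^sup>+ \<omega>. ennreal (1/2) * indicator ?A \<omega> \<partial>M)"
    by (subst nn_integral_cmult_indicator) auto
  also have "\<dots> \<le> (\<integral>\<^sup>+ \<omega>. \<integral>\<^sup>+ s. ennreal (1 - cos (s * (u * (b \<bullet> X t \<omega>)))) * indicator {0..1} s \<partial>lborel \<partial>M)"
  proof (intro nn_integral_mono)
    fix \<omega> assume "\<omega> \<in> space M"
    show "ennreal (1/2) * indicator ?A \<omega>
      \<le> (\<integral>\<^sup>+ s. ennreal (1 - cos (s * (u * (b \<bullet> X t \<omega>)))) * indicator {0..1} s \<partial>lborel)"
    proof (cases "\<omega> \<in> ?A")
      case True
      then have "2 \<le> \<bar>u * (b \<bullet> X t \<omega>)\<bar>" using u by (auto simp: abs_mult field_simps)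
      then show ?thesis using nn_integral_one_minus_cos_ge True by simp
    qed simp
  qed
  also have "\<dots> = (\<integral>\<^sup>+ s. \<integral>\<^sup>+ \<omega>. ennreal (1 - cos (s * (u * (b \<bullet> X t \<omega>)))) * indicator {0..1} s \<partial>M \<partial>lborel)"
  proof -
    interpret pair_sigma_finite lborel M ..
    show ?thesis by (rule Fubini') measurable
  qed
  also have "\<dots> \<le> (\<integral>\<^sup>+ s. ennreal (t * u powr \<alpha>) * indicator {0..1::real} s \<partial>lborel)"
  proof (intro nn_integral_mono)
    fix s :: real
    show "(\<integral>\<^sup>+ \<omega>. ennreal (1 - cos (s * (u * (b \<bullet> X t \<omega>)))) * indicator {0..1} s \<partial>M)
        \<le> ennreal (t * u powr \<alpha>) * indicator {0..1} s"
    proof (cases "s \<in> {0..1}")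
      case True
      have "(\<integral>\<^sup>+ \<omega>. ennreal (1 - cos (s * (u * (b \<bullet> X t \<omega>)))) \<partial>M)
          = (\<integral>\<^sup>+ \<omega>. ennreal (1 - cos (((s * u) *\<^sub>R b) \<bullet> X t \<omega>)) \<partial>M)"
        by (simp add: mult.assoc)
      also have "\<dots> \<le> ennreal (t * norm ((s * u) *\<^sub>R b) powr \<alpha>)"
        by (rule nn_integral_one_minus_cos_le[OF t])
      also have "norm ((s * u) *\<^sub>R b) = s * u" using True u b by simp
      also have "ennreal (t * (s * u) powr \<alpha>) \<le> ennreal (t * u powr \<alpha>)"
        using True u t index by (intro ennreal_leI mult_left_mono powr_mono2) (auto simp: mult_le_cancel_right1)
      finally show ?thesis using True by simp
    qed simp
  qed
  also have "\<dots> = ennreal (t * u powr \<alpha>)" by (subst nn_integral_cmult_indicator) auto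
  finally have "ennreal (1/2 * prob ?A) \<le> ennreal (t * u powr \<alpha>)"
    by (simp only: emeasure_eq_measure ennreal_mult'[symmetric] measure_nonneg)
  then show ?thesis using t by (simp add: ennreal_le_iff)
qed

end

context pinned_stable_process
begin

definition tail_const :: real where
  "tail_const = 2 * real DIM('a) * (2 * real DIM('a)) powr \<alpha>"

lemma tail_const_pos: "0 < tail_const"
  unfolding tail_const_def by simp

lemma prob_norm_ge:
  assumes t: "0 \<le> t" and r: "0 < r"
  shows "prob {\<omega> \<in> space M. r \<le> norm (X t \<omega>)} \<le> tail_const * t * r powr - \<alpha>"
proof -
  have [measurable]: "X t \<in> borel_measurable M" using rv t by simp
  let ?d = "real DIM('a)"
  (* If the norm is at least r, then some coordinate is at least r / DIM('a) = 2 / u. *)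
  define u where "u = 2 * ?d / r"
  have d: "0 < ?d" by simp
  have u: "0 < u" using d r unfolding u_def by (intro divide_pos_pos mult_pos_pos) auto
  have ru: "2 / u = r / ?d" using r by (simp add: u_def)
  let ?A = "\<lambda>b. {\<omega> \<in> space M. 2 / u \<le> \<bar>b \<bullet> X t \<omega>\<bar>}"
  have sub: "{\<omega> \<in> space M. r \<le> norm (X t \<omega>)} \<subseteq> (\<Union>b\<in>Basis. ?A b)"
  proof (rule ccontr)
    assume "\<not> ?thesis"
    then obtain \<omega> where \<omega>: "r \<le> norm (X t \<omega>)" "\<And>b. b \<in> Basis \<Longrightarrow> \<bar>b \<bullet> X t \<omega>\<bar> < r / ?d"
      unfolding ru subset_iff by (auto simp: not_le)
    have "norm (X t \<omega>) \<le> (\<Sum>b\<in>Basis. \<bar>X t \<omega> \<bullet> b\<bar>)" by (rule norm_le_l1)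
    also have "\<dots> < (\<Sum>b\<in>(Basis::'a set). r / ?d)"
      using \<omega>(2) by (intro sum_strict_mono) (auto simp: inner_commute)
    also have "\<dots> = r" by simp
    finally show False using \<omega>(1) by simp
  qed
  have "prob {\<omega> \<in> space M. r \<le> norm (X t \<omega>)} \<le> prob (\<Union>b\<in>Basis. ?A b)"
    using sub by (intro finite_measure_mono) auto
  also have "\<dots> \<le> (\<Sum>b\<in>Basis. prob (?A b))"
    by (intro finite_measure_subadditive_finite) auto
  also have "\<dots> \<le> (\<Sum>b\<in>(Basis::'a set). 2 * t * u powr \<alpha>)"
    using prob_coordinate_ge[OF t u] by (intro sum_mono) auto
  also have "\<dots> = tail_const * t * r powr - \<alpha>"
    using r d by (simp add: tail_const_def u_def powr_divide powr_minus field_simps)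
  finally show ?thesis .
qed

lemma prob_past_and_future:
  assumes s: "0 \<le> s" and A: "A \<in> sets (path_space s)" and B: "B \<in> sets (path_space t)"
  shows "prob {\<omega> \<in> space M. traj s \<omega> \<in> A \<and> future s t \<omega> \<in> B}
       = prob {\<omega> \<in> space M. traj s \<omega> \<in> A} * prob {\<omega> \<in> space M. traj t \<omega> \<in> B}"
proof -
  have "prob ((\<lambda>\<omega>. (traj s \<omega>, future s t \<omega>)) -` (A \<times> B) \<inter> space M)
      = prob (traj s -` A \<inter> space M) * prob (future s t -` B \<inter> space M)"
    by (rule indep_varD[OF indep_past_future[OF s] A B])
  also have "prob (future s t -` B \<inter> space M) = measure (distr M (path_space t) (future s t)) B"
    using s B by (subst measure_distr) auto
  also have "\<dots> = prob (traj t -` B \<inter> space M)"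
    using s B by (subst law_of_future[OF s], subst measure_distr) auto
  finally show ?thesis
    by (simp add: vimage_def Int_def conj_commute conj_assoc cong: conj_cong)
qed

text \<open>
  Ottaviani's inequality. At the first grid time at which the norm exceeds \<open>2 * r\<close>, the remaining
  increment up to \<open>T\<close> is independent of the past and has norm at most \<open>r\<close> with probability at least \<open>1/2\<close>;
  if it has, then the norm at time \<open>T\<close> exceeds \<open>r\<close>.
\<close>
lemma ottaviani_grid:
  fixes N :: nat
  assumes T: "0 \<le> T" and N: "0 < N"
    and half: "\<And>s. s \<in> {0..T} \<Longrightarrow> prob {\<omega> \<in> space M. r < norm (X s \<omega>)} \<le> 1/2"
  shows "prob {\<omega> \<in> space M. \<exists>i\<le>N. 2 * r < norm (X (T * i / N) \<omega>)}
       \<le> 2 * prob {\<omega> \<in> space M. r < norm (X T \<omega>)}"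
proof -
  define \<tau> where "\<tau> i = T * real i / real N" for i
  have \<tau>: "0 \<le> \<tau> i" "i \<le> N \<Longrightarrow> \<tau> i \<le> T" "i \<le> j \<Longrightarrow> \<tau> i \<le> \<tau> j" for i j
    using T N by (auto simp: \<tau>_def field_simps intro: mult_left_mono mult_mono)
  have [measurable]: "X (\<tau> i) \<in> borel_measurable M" "X T \<in> borel_measurable M" for i
    using rv \<tau> T by auto
  define E where "E k = {\<omega> \<in> space M. (\<forall>i<k. norm (X (\<tau> i) \<omega>) \<le> 2 * r) \<and> 2 * r < norm (X (\<tau> k) \<omega>)}" for k
  define F where "F k = {\<omega> \<in> space M. norm (X T \<omega> - X (\<tau> k) \<omega>) \<le> r}" for k
  have meas [measurable]: "E k \<in> sets M" "F k \<in> sets M" for k unfolding E_def F_def by measurable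
  have disj: "disjoint_family_on E {..N}"
    unfolding disjoint_family_on_def E_def by (auto simp: not_less[symmetric]) (metis linorder_neqE_nat)
  have first: "\<exists>k\<le>N. \<omega> \<in> E k" if "\<omega> \<in> space M" "\<exists>i\<le>N. 2 * r < norm (X (\<tau> i) \<omega>)" for \<omega>
  proof -
    define k where "k = (LEAST i. i \<le> N \<and> 2 * r < norm (X (\<tau> i) \<omega>))"
    have "k \<le> N \<and> 2 * r < norm (X (\<tau> k) \<omega>)" unfolding k_def using that(2) by (rule LeastI_ex)
    moreover have "\<not> (i \<le> N \<and> 2 * r < norm (X (\<tau> i) \<omega>))" if "i < k" for i
      using not_less_Least[of i "\<lambda>i. i \<le> N \<and> 2 * r < norm (X (\<tau> i) \<omega>)"] that by (simp add: k_def)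
    ultimately show ?thesis using that(1) by (auto simp: E_def not_less)
  qed
  have un: "{\<omega> \<in> space M. \<exists>i\<le>N. 2 * r < norm (X (T * i / N) \<omega>)} = (\<Union>k\<le>N. E k)"
    using first by (auto simp: E_def \<tau>_def[symmetric])
  have half_E: "prob (E k) \<le> 2 * prob (E k \<inter> F k)" if k: "k \<le> N" for k
  proof -
    let ?A = "{p \<in> space (path_space (\<tau> k)). (\<forall>i<k. norm (p (\<tau> i) :: 'a) \<le> 2 * r) \<and> 2 * r < norm (p (\<tau> k))}"
    let ?B = "{p \<in> space (path_space (T - \<tau> k)). norm (p (T - \<tau> k) :: 'a) \<le> r}"
    have mp: "(\<lambda>p. p q :: 'a) \<in> borel_measurable (path_space S)" if "q \<in> {0..S}" for q S
      using that by (rule measurable_component_singleton)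
    note [measurable] = mp
    have A: "?A \<in> sets (path_space (\<tau> k))"
    proof -
      have [measurable]: "(\<lambda>p. p (\<tau> i) :: 'a) \<in> borel_measurable (path_space (\<tau> k))" if "i \<le> k" for i
        using \<tau> that by (intro mp) auto
      have "?A = {p \<in> space (path_space (\<tau> k)). (\<forall>i\<in>{..<k}. norm (p (\<tau> i) :: 'a) \<le> 2 * r)} \<inter>
          {p \<in> space (path_space (\<tau> k)). 2 * r < norm (p (\<tau> k))}" by auto
      also have "\<dots> \<in> sets (path_space (\<tau> k))"
        by (intro sets.Int sets.sets_Collect_finite_All) (auto intro!: borel_measurable_le borel_measurable_less)
      finally show ?thesis .
    qed
    have B: "?B \<in> sets (path_space (T - \<tau> k))"
      using \<tau>(2)[OF k] mp[of "T - \<tau> k" "T - \<tau> k"] by (intro borel_measurable_le) auto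
    have "prob {\<omega> \<in> space M. traj (\<tau> k) \<omega> \<in> ?A \<and> future (\<tau> k) (T - \<tau> k) \<omega> \<in> ?B}
       = prob {\<omega> \<in> space M. traj (\<tau> k) \<omega> \<in> ?A} * prob {\<omega> \<in> space M. traj (T - \<tau> k) \<omega> \<in> ?B}"
      by (rule prob_past_and_future[OF \<tau>(1) A B])
    moreover have "{\<omega> \<in> space M. traj (\<tau> k) \<omega> \<in> ?A} = E k"
      using \<tau> by (auto simp: E_def traj_def space_PiM)
    moreover have "{\<omega> \<in> space M. traj (\<tau> k) \<omega> \<in> ?A \<and> future (\<tau> k) (T - \<tau> k) \<omega> \<in> ?B} = E k \<inter> F k"
      using \<tau> \<tau>(2)[OF k] by (auto simp: E_def F_def traj_def future_def space_PiM)
    moreover have "{\<omega> \<in> space M. traj (T - \<tau> k) \<omega> \<in> ?B} = {\<omega> \<in> space M. norm (X (T - \<tau> k) \<omega>) \<le> r}"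
      using \<tau>(2)[OF k] by (auto simp: traj_def space_PiM)
    moreover have "1/2 \<le> prob {\<omega> \<in> space M. norm (X (T - \<tau> k) \<omega>) \<le> r}"
    proof -
      have [measurable]: "X (T - \<tau> k) \<in> borel_measurable M" using rv \<tau>(2)[OF k] by simp
      have "prob (space M - {\<omega> \<in> space M. r < norm (X (T - \<tau> k) \<omega>)})
          = 1 - prob {\<omega> \<in> space M. r < norm (X (T - \<tau> k) \<omega>)}" by (rule prob_compl) measurable
      moreover have "space M - {\<omega> \<in> space M. r < norm (X (T - \<tau> k) \<omega>)} = {\<omega> \<in> space M. norm (X (T - \<tau> k) \<omega>) \<le> r}"
        by auto
      ultimately show ?thesis using half[of "T - \<tau> k"] \<tau>(1)[of k] \<tau>(2)[OF k] by simp
    qed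
    ultimately have "prob (E k) * (1/2) \<le> prob (E k \<inter> F k)"
      by (simp only: mult_left_mono measure_nonneg)
    then show ?thesis by simp
  qed
  have "prob (\<Union>k\<le>N. E k) = (\<Sum>k\<le>N. prob (E k))"
    using disj by (intro finite_measure_finite_Union) auto
  also have "\<dots> \<le> (\<Sum>k\<le>N. 2 * prob (E k \<inter> F k))"
    by (intro sum_mono half_E) auto
  also have "\<dots> = 2 * prob (\<Union>k\<le>N. E k \<inter> F k)"
    using disj by (subst finite_measure_finite_Union) (auto simp: disjoint_family_on_def sum_distrib_left)
  also have "\<dots> \<le> 2 * prob {\<omega> \<in> space M. r < norm (X T \<omega>)}"
  proof -
    have "r < norm (X T \<omega>)" if "\<omega> \<in> E k \<inter> F k" for k \<omega>
    proof -
      have "norm (X (\<tau> k) \<omega>) \<le> norm (X T \<omega>) + norm (X T \<omega> - X (\<tau> k) \<omega>)"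
        by (metis norm_minus_commute norm_triangle_sub)
      then show ?thesis using that by (auto simp: E_def F_def)
    qed
    then have "(\<Union>k\<le>N. E k \<inter> F k) \<subseteq> {\<omega> \<in> space M. r < norm (X T \<omega>)}" by (auto simp: E_def)
    then show ?thesis by (intro mult_left_mono finite_measure_mono) auto
  qed
  finally show ?thesis unfolding un .
qed

lemma exceedance_eq_dyadic:
  assumes "\<omega> \<in> space M" and "0 \<le> T"
  shows "(\<exists>s\<in>{0..T}. R < norm (X s \<omega>)) \<longleftrightarrow> (\<exists>n. \<exists>i\<le>2 ^ n. R < norm (X (T * real i / 2 ^ n) \<omega>))"
  using assms right_continuous by (intro right_continuous_exceeds_iff_dyadic) auto

lemma measurable_exceedance [measurable]:
  assumes "0 \<le> T"
  shows "{\<omega> \<in> space M. \<exists>s\<in>{0..T}. R < norm (X s \<omega>)} \<in> sets M"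
proof -
  have [measurable]: "X (T * real i / 2 ^ n) \<in> borel_measurable M" for i n using rv assms by auto
  have "{\<omega> \<in> space M. \<exists>s\<in>{0..T}. R < norm (X s \<omega>)}
      = {\<omega> \<in> space M. \<exists>n. \<exists>i\<in>{..2 ^ n}. R < norm (X (T * real i / 2 ^ n) \<omega>)}"
    by (rule set_eqI) (use exceedance_eq_dyadic[OF _ assms, of _ R] in \<open>simp add: atMost_def, blast\<close>)
  also have "\<dots> \<in> sets M" by measurable
  finally show ?thesis .
qed

text \<open>
  If the right-hand side is below \<open>1\<close>, the tail bound gives the hypothesis of Ottaviani's inequality
  at every time, and the dyadic grids increase to the event in question. Otherwise there is nothing to prove.
\<close>
theorem prob_exceedance_le:
  assumes T: "0 \<le> T" and R: "0 < R"
  shows "prob {\<omega> \<in> space M. \<exists>s\<in>{0..T}. R < norm (X s \<omega>)} \<le> 2 * tail_const * T * (R / 2) powr - \<alpha>"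
    (is "_ \<le> ?b")
proof (cases "1/2 \<le> tail_const * T * (R / 2) powr - \<alpha>")
  case True
  then have "1 \<le> ?b" by simp
  then show ?thesis using prob_le_1 order_trans by blast
next
  case False
  have [measurable]: "X (T * real i / 2 ^ n) \<in> borel_measurable M" for i n using rv T by auto
  have gt_le: "prob {\<omega> \<in> space M. R / 2 < norm (X s \<omega>)} \<le> tail_const * T * (R / 2) powr - \<alpha>" if "s \<in> {0..T}" for s
  proof -
    have [measurable]: "X s \<in> borel_measurable M" using rv that by auto
    have "prob {\<omega> \<in> space M. R / 2 < norm (X s \<omega>)} \<le> prob {\<omega> \<in> space M. R / 2 \<le> norm (X s \<omega>)}"
      by (intro finite_measure_mono) auto
    also have "\<dots> \<le> tail_const * s * (R / 2) powr - \<alpha>" using that R by (intro prob_norm_ge) auto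
    also have "\<dots> \<le> tail_const * T * (R / 2) powr - \<alpha>"
      using that tail_const_pos by (intro mult_right_mono mult_left_mono) auto
    finally show ?thesis .
  qed
  define B where "B n = {\<omega> \<in> space M. \<exists>i\<le>2 ^ n. 2 * (R / 2) < norm (X (T * real i / real (2 ^ n)) \<omega>)}" for n :: nat
  have B_meas: "B n \<in> sets M" for n
  proof -
    have "B n = {\<omega> \<in> space M. \<exists>i\<in>{..2 ^ n}. R < norm (X (T * real i / 2 ^ n) \<omega>)}" by (auto simp: B_def)
    also have "\<dots> \<in> sets M" by measurable
    finally show ?thesis .
  qed
  have bound: "prob (B n) \<le> ?b" for n
  proof -
    have "prob (B n) \<le> 2 * prob {\<omega> \<in> space M. R / 2 < norm (X T \<omega>)}"
      unfolding B_def using False gt_le by (intro ottaviani_grid[OF T]) (auto, smt (verit))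
    also have "\<dots> \<le> 2 * (tail_const * T * (R / 2) powr - \<alpha>)" using gt_le[of T] T by simp
    finally show ?thesis by simp
  qed
  have "incseq B"
  proof (rule incseq_SucI)
    fix n
    show "B n \<subseteq> B (Suc n)"
    proof
      fix \<omega> assume "\<omega> \<in> B n"
      then obtain i where i: "\<omega> \<in> space M" "i \<le> 2 ^ n" "2 * (R / 2) < norm (X (T * real i / real (2 ^ n)) \<omega>)"
        by (auto simp: B_def)
      have "T * real (2 * i) / real (2 ^ Suc n) = T * real i / real (2 ^ n)" by simp
      moreover have "2 * i \<le> 2 ^ Suc n" using i by simp
      ultimately show "\<omega> \<in> B (Suc n)" using i unfolding B_def by (metis (mono_tags, lifting) mem_Collect_eq)
    qed
  qed
  then have "(\<lambda>n. prob (B n)) \<longlonglongrightarrow> prob (\<Union>n. B n)"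
    using B_meas by (intro finite_Lim_measure_incseq) auto
  moreover have "(\<Union>n. B n) = {\<omega> \<in> space M. \<exists>s\<in>{0..T}. R < norm (X s \<omega>)}"
    by (rule set_eqI) (use exceedance_eq_dyadic[OF _ T, of _ R] in \<open>simp add: B_def, blast\<close>)
  ultimately show ?thesis using bound by (intro LIMSEQ_le_const2[of "\<lambda>n. prob (B n)"]) auto
qed

end

section \<open>Small ball probabilities\<close>

text \<open>
  The characteristic function of \<open>z \<bullet> X t\<close> is real, so this real random variable is symmetric.
\<close>
lemma (in stable_process) prob_inner_nonpos:
  assumes t: "0 \<le> t"
  shows "1/2 \<le> prob {\<omega> \<in> space M. z \<bullet> X t \<omega> \<le> 0}"
proof -
  have [measurable]: "X t \<in> borel_measurable M" using rv t by simp
  let ?Y = "\<lambda>\<omega>. z \<bullet> X t \<omega>"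
  let ?P = "distr M borel ?Y" and ?N = "distr M borel (\<lambda>\<omega>. - ?Y \<omega>)"
  have ch: "char (distr M borel (\<lambda>\<omega>. c * ?Y \<omega>)) s = complex_of_real (exp (- t * norm ((c * s) *\<^sub>R z) powr \<alpha>))" for s c
  proof -
    have "char (distr M borel (\<lambda>\<omega>. c * ?Y \<omega>)) s = (CLINT \<omega>|M. exp (\<i> * complex_of_real (((c * s) *\<^sub>R z) \<bullet> X t \<omega>)))"
      unfolding char_def by (subst integral_distr) (auto simp: ac_simps)
    then show ?thesis using char_exponent[OF t, of "(c * s) *\<^sub>R z"] by (rule trans)
  qed
  have "char ?P = char ?N"
    using ch[of 1] ch[of "-1"] by (intro ext) simp
  moreover have "real_distribution ?P" "real_distribution ?N"
    by (auto intro!: real_distribution_distr)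
  ultimately have eq: "?P = ?N" by (intro Levy_uniqueness)
  have "prob {\<omega> \<in> space M. ?Y \<omega> \<le> 0} = measure ?P {..0}"
    by (subst measure_distr) (auto intro!: arg_cong[where f = prob])
  also have "\<dots> = measure ?N {..0}" by (simp only: eq)
  also have "\<dots> = prob {\<omega> \<in> space M. 0 \<le> ?Y \<omega>}"
    by (subst measure_distr) (auto intro!: arg_cong[where f = prob])
  finally have sym: "prob {\<omega> \<in> space M. ?Y \<omega> \<le> 0} = prob {\<omega> \<in> space M. 0 \<le> ?Y \<omega>}" .
  have "1 = prob ({\<omega> \<in> space M. ?Y \<omega> \<le> 0} \<union> {\<omega> \<in> space M. 0 \<le> ?Y \<omega>})"
    by (subst prob_space[symmetric]) (auto intro!: arg_cong[where f = prob])
  also have "\<dots> \<le> prob {\<omega> \<in> space M. ?Y \<omega> \<le> 0} + prob {\<omega> \<in> space M. 0 \<le> ?Y \<omega>}"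
    by (intro measure_Un_le) auto
  finally show ?thesis using sym by simp
qed

definition dyadically_bounded :: "real \<Rightarrow> real \<Rightarrow> (real \<Rightarrow> 'a::real_normed_vector) \<Rightarrow> bool" where
  "dyadically_bounded T R p \<longleftrightarrow> (\<forall>n. \<forall>i\<le>2 ^ n. norm (p (T * real i / 2 ^ n)) \<le> R)"

lemma measurable_dyadically_bounded [measurable]:
  assumes "0 \<le> T"
  shows "Measurable.pred (path_space T) (dyadically_bounded T R :: (real \<Rightarrow> 'a::euclidean_space) \<Rightarrow> bool)"
proof -
  have [measurable]: "(\<lambda>p. p q :: 'a) \<in> borel_measurable (path_space T)" if "q \<in> {0..T}" for q
    using that by (rule measurable_component_singleton)
  have [measurable]: "(\<lambda>p. p (T * real i / 2 ^ n) :: 'a) \<in> borel_measurable (path_space T)"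
    if "i \<in> {..2 ^ n}" for i n
    using dyadic_time_in_interval[OF _ assms] that by (intro measurable_component_singleton) auto
  have "Measurable.pred (path_space T) (\<lambda>p :: real \<Rightarrow> 'a. \<forall>n. \<forall>i\<in>{..2 ^ n}. norm (p (T * real i / 2 ^ n)) \<le> R)"
    by (intro pred_intros_countable pred_intros_countable_bounded) auto
  then show ?thesis by (simp add: dyadically_bounded_def[abs_def] Ball_def)
qed

context pinned_stable_process
begin

lemma dyadically_bounded_traj:
  assumes "\<omega> \<in> space M" "0 \<le> T"
  shows "dyadically_bounded T R (traj T \<omega>) \<longleftrightarrow> (\<forall>s\<in>{0..T}. norm (X s \<omega>) \<le> R)"
proof -
  have "dyadically_bounded T R (traj T \<omega>) \<longleftrightarrow> (\<forall>n. \<forall>i\<le>2 ^ n. norm (X (T * real i / 2 ^ n) \<omega>) \<le> R)"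
    using dyadic_time_in_interval[OF _ assms(2)] by (auto simp: dyadically_bounded_def traj_def)
  also have "\<dots> \<longleftrightarrow> \<not> (\<exists>s\<in>{0..T}. R < norm (X s \<omega>))"
    unfolding exceedance_eq_dyadic[OF assms] by (simp add: not_less)
  finally show ?thesis by (simp add: not_less)
qed

lemma dyadically_bounded_future:
  assumes "\<omega> \<in> space M" "0 \<le> s" "0 \<le> T"
  shows "dyadically_bounded T R (future s T \<omega>) \<longleftrightarrow> (\<forall>r\<in>{0..T}. norm (X (s + r) \<omega> - X s \<omega>) \<le> R)"
proof -
  let ?f = "\<lambda>r. X (s + r) \<omega> - X s \<omega>"
  have "dyadically_bounded T R (future s T \<omega>) \<longleftrightarrow> (\<forall>n. \<forall>i\<le>2 ^ n. norm (?f (T * real i / 2 ^ n)) \<le> R)"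
    using dyadic_time_in_interval[OF _ assms(3)] by (auto simp: dyadically_bounded_def future_def)
  also have "\<dots> \<longleftrightarrow> \<not> (\<exists>r\<in>{0..T}. R < norm (?f r))"
    using right_continuous_exceeds_iff_dyadic[of T ?f R] future_right_continuous assms by (auto simp: not_less)
  finally show ?thesis by (simp add: not_less)
qed

lemma measurable_stay [measurable]:
  assumes "0 \<le> T"
  shows "{\<omega> \<in> space M. \<forall>s\<in>{0..T}. norm (X s \<omega>) \<le> R} \<in> sets M"
proof -
  have "{\<omega> \<in> space M. \<forall>s\<in>{0..T}. norm (X s \<omega>) \<le> R}
      = space M - {\<omega> \<in> space M. \<exists>s\<in>{0..T}. R < norm (X s \<omega>)}" by (auto simp: not_less)
  then show ?thesis using measurable_exceedance[OF assms, of R] by simp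
qed

lemma prob_short_step_towards:
  assumes h: "0 \<le> h" and \<eta>: "prob {\<omega> \<in> space M. \<exists>s\<in>{0..h}. \<eta> < norm (X s \<omega>)} \<le> 1/4"
  shows "1/4 \<le> prob {\<omega> \<in> space M. (\<forall>s\<in>{0..h}. norm (X s \<omega>) \<le> \<eta>) \<and> z \<bullet> X h \<omega> \<le> 0}"
proof -
  have [measurable]: "X h \<in> borel_measurable M" using rv h by simp
  let ?E = "{\<omega> \<in> space M. \<exists>s\<in>{0..h}. \<eta> < norm (X s \<omega>)}"
  let ?S = "{\<omega> \<in> space M. (\<forall>s\<in>{0..h}. norm (X s \<omega>) \<le> \<eta>) \<and> z \<bullet> X h \<omega> \<le> 0}"
  have S: "?S = {\<omega> \<in> space M. \<forall>s\<in>{0..h}. norm (X s \<omega>) \<le> \<eta>} \<inter> {\<omega> \<in> space M. z \<bullet> X h \<omega> \<le> 0}" by auto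
  have [measurable]: "?S \<in> sets M" unfolding S using h by (intro sets.Int measurable_stay) auto
  have [measurable]: "?E \<in> sets M" by (rule measurable_exceedance[OF h])
  have "prob {\<omega> \<in> space M. z \<bullet> X h \<omega> \<le> 0} \<le> prob (?S \<union> ?E)"
    by (intro finite_measure_mono sets.Un) (auto simp: not_less)
  also have "\<dots> \<le> prob ?S + prob ?E" by (intro measure_Un_le) auto
  finally show ?thesis using prob_inner_nonpos[OF h, of z] \<eta> by linarith
qed

text \<open>
  An increment \<open>d\<close> with \<open>x \<bullet> d \<le> 0\<close> and \<open>norm d \<le> \<eta>\<close> raises the squared norm of \<open>x\<close> by at most \<open>\<eta>\<^sup>2\<close>. After
  \<open>k \<le> n\<close> such blocks the norm is at most \<open>sqrt n * \<eta>\<close>, and within a block it is larger by at most \<open>\<eta>\<close>. By the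
  Markov property each block costs a factor \<open>1/4\<close>.
\<close>
lemma prob_stay_pos_grid:
  assumes h: "0 \<le> h" and \<eta>: "0 < \<eta>" "prob {\<omega> \<in> space M. \<exists>s\<in>{0..h}. \<eta> < norm (X s \<omega>)} \<le> 1/4"
    and \<epsilon>: "2 * sqrt (real n) * \<eta> \<le> \<epsilon>" and k: "k \<le> n" and n: "0 < n"
  shows "(1/4) ^ k \<le> prob {\<omega> \<in> space M. (\<forall>s\<in>{0..real k * h}. norm (X s \<omega>) \<le> \<epsilon>)
            \<and> (norm (X (real k * h) \<omega>))\<^sup>2 \<le> real k * \<eta>\<^sup>2}"
  using k
proof (induction k)
  case 0
  have "0 \<le> 2 * sqrt (real n) * \<eta>" using \<eta> by simp
  then have "0 \<le> \<epsilon>" using \<epsilon> by linarith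
  then show ?case using pinned by (simp add: prob_space cong: conj_cong)
next
  case (Suc k)
  define s where "s = real k * h"
  have s: "0 \<le> s" "real (Suc k) * h = s + h" using h by (auto simp: s_def algebra_simps)
  let ?A = "\<lambda>p. dyadically_bounded s \<epsilon> p \<and> (norm (p s :: 'a))\<^sup>2 \<le> real k * \<eta>\<^sup>2"
  let ?B = "\<lambda>p q. dyadically_bounded h \<eta> q \<and> p s \<bullet> (q h :: 'a) \<le> 0"
  define E where "E = {\<omega> \<in> space M. (\<forall>r\<in>{0..s}. norm (X r \<omega>) \<le> \<epsilon>) \<and> (norm (X s \<omega>))\<^sup>2 \<le> real k * \<eta>\<^sup>2}"
  define E' where "E' = {\<omega> \<in> space M. (\<forall>r\<in>{0..s+h}. norm (X r \<omega>) \<le> \<epsilon>) \<and> (norm (X (s+h) \<omega>))\<^sup>2 \<le> real (Suc k) * \<eta>\<^sup>2}"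
  have [measurable]: "X s \<in> borel_measurable M" "X (s + h) \<in> borel_measurable M" "X h \<in> borel_measurable M"
    using rv s(1) h by auto
  have Esets [measurable]: "E \<in> sets M" "E' \<in> sets M"
  proof -
    have "E = {\<omega> \<in> space M. \<forall>r\<in>{0..s}. norm (X r \<omega>) \<le> \<epsilon>} \<inter> {\<omega> \<in> space M. (norm (X s \<omega>))\<^sup>2 \<le> real k * \<eta>\<^sup>2}"
      by (auto simp: E_def)
    then show "E \<in> sets M" using s by (auto intro!: sets.Int measurable_stay)
    have "E' = {\<omega> \<in> space M. \<forall>r\<in>{0..s+h}. norm (X r \<omega>) \<le> \<epsilon>} \<inter> {\<omega> \<in> space M. (norm (X (s+h) \<omega>))\<^sup>2 \<le> real (Suc k) * \<eta>\<^sup>2}"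
      by (auto simp: E'_def)
    then show "E' \<in> sets M" using s h by (auto intro!: sets.Int measurable_stay)
  qed
  define \<Phi> :: "(real \<Rightarrow> 'a) \<times> (real \<Rightarrow> 'a) \<Rightarrow> ennreal"
    where "\<Phi> z = (if ?A (fst z) \<and> ?B (fst z) (snd z) then 1 else 0)" for z
  have \<Phi>: "\<Phi> \<in> borel_measurable (path_space s \<Otimes>\<^sub>M path_space h)"
  proof -
    let ?N = "path_space s \<Otimes>\<^sub>M path_space h :: ((real \<Rightarrow> 'a) \<times> (real \<Rightarrow> 'a)) measure"
    have "(\<lambda>p. p s :: 'a) \<in> borel_measurable (path_space s)" "(\<lambda>p. p h :: 'a) \<in> borel_measurable (path_space h)"
      using s h by (auto intro!: measurable_component_singleton)
    note [measurable] = measurable_compose[OF measurable_fst this(1)] measurable_compose[OF measurable_snd this(2)]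
      measurable_compose[OF measurable_fst measurable_dyadically_bounded[OF s(1)]]
      measurable_compose[OF measurable_snd measurable_dyadically_bounded[OF h]]
    have "Measurable.pred ?N (\<lambda>z. dyadically_bounded s \<epsilon> (fst z))"
      "Measurable.pred ?N (\<lambda>z. dyadically_bounded h \<eta> (snd z))"
      "Measurable.pred ?N (\<lambda>z. (norm (fst z s))\<^sup>2 \<le> real k * \<eta>\<^sup>2)"
      "Measurable.pred ?N (\<lambda>z. fst z s \<bullet> snd z h \<le> 0)"
      by measurable
    then show ?thesis
      unfolding \<Phi>_def by (intro measurable_If measurable_const pred_intros_logic) auto
  qed
  have mono: "\<Phi> (traj s \<omega>, future s h \<omega>) \<le> indicator E' \<omega>" if \<omega>: "\<omega> \<in> space M" for \<omega>
  proof (cases "?A (traj s \<omega>) \<and> ?B (traj s \<omega>) (future s h \<omega>)")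
    case True
    let ?x = "X s \<omega>" and ?d = "X (s + h) \<omega> - X s \<omega>"
    have *: "\<forall>r\<in>{0..s}. norm (X r \<omega>) \<le> \<epsilon>" "(norm ?x)\<^sup>2 \<le> real k * \<eta>\<^sup>2"
      "\<forall>r\<in>{0..h}. norm (X (s + r) \<omega> - X s \<omega>) \<le> \<eta>" "?x \<bullet> ?d \<le> 0"
      using True dyadically_bounded_traj[OF \<omega> s(1)] dyadically_bounded_future[OF \<omega> s(1) h] s h
      by (auto simp: traj_def future_def)
    have "norm ?d \<le> \<eta>" using *(3) h by auto
    then have d2: "(norm ?d)\<^sup>2 \<le> \<eta>\<^sup>2" by (intro power_mono) auto
    have "(norm (X (s + h) \<omega>))\<^sup>2 = (norm ?x)\<^sup>2 + 2 * (?x \<bullet> ?d) + (norm ?d)\<^sup>2"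
    proof -
      have "(norm (x + d))\<^sup>2 = (norm x)\<^sup>2 + 2 * (x \<bullet> d) + (norm d)\<^sup>2" for x d :: 'a
        by (simp add: power2_norm_eq_inner inner_add_left inner_add_right inner_commute[of d x])
      from this[of ?x ?d] show ?thesis by simp
    qed
    moreover have "real (Suc k) * \<eta>\<^sup>2 = real k * \<eta>\<^sup>2 + \<eta>\<^sup>2" by (simp add: distrib_right)
    ultimately have 1: "(norm (X (s + h) \<omega>))\<^sup>2 \<le> real (Suc k) * \<eta>\<^sup>2"
      using *(2,4) d2 by linarith
    have xn: "norm ?x \<le> sqrt (real k) * \<eta>"
    proof -
      have "norm ?x \<le> sqrt (real k * \<eta>\<^sup>2)" using *(2) by (rule real_le_rsqrt)
      also have "\<dots> = sqrt (real k) * \<eta>" using \<eta>(1) by (simp add: real_sqrt_mult)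
      finally show ?thesis .
    qed
    have 2: "norm (X r \<omega>) \<le> \<epsilon>" if r: "r \<in> {0..s+h}" for r
    proof (cases "r \<le> s")
      case False
      then have "norm (X r \<omega> - ?x) \<le> \<eta>" using *(3)[rule_format, of "r - s"] r by auto
      then have "norm (X r \<omega>) \<le> sqrt (real k) * \<eta> + \<eta>"
        using xn norm_triangle_sub[of "X r \<omega>" ?x] by linarith
      also have "\<dots> \<le> sqrt (real n) * \<eta> + sqrt (real n) * \<eta>"
        using Suc.prems \<eta>(1) n by (intro add_mono mult_right_mono) auto
      finally show ?thesis using \<epsilon> by (simp add: mult.assoc mult.commute[of \<eta>])
    qed (use *(1) r in auto)
    show ?thesis using 1 2 \<omega> by (auto simp: E'_def indicator_def \<Phi>_def)
  qed (auto simp: \<Phi>_def)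
  have "ennreal (1/4 * prob E) = ennreal (1/4) * emeasure M E"
    by (simp add: emeasure_eq_measure ennreal_mult'[symmetric])
  also have "\<dots> = (\<integral>\<^sup>+ \<omega>. ennreal (1/4) * indicator E \<omega> \<partial>M)" by (simp add: nn_integral_cmult_indicator)
  also have "\<dots> \<le> (\<integral>\<^sup>+ \<omega>. \<integral>\<^sup>+ \<omega>'. \<Phi> (traj s \<omega>, traj h \<omega>') \<partial>M \<partial>M)"
  proof (intro nn_integral_mono)
    fix \<omega> assume \<omega>: "\<omega> \<in> space M"
    show "ennreal (1/4) * indicator E \<omega> \<le> (\<integral>\<^sup>+ \<omega>'. \<Phi> (traj s \<omega>, traj h \<omega>') \<partial>M)"
    proof (cases "\<omega> \<in> E")
      case True
      have A: "?A (traj s \<omega>)"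
        using True dyadically_bounded_traj[OF \<omega> s(1)] s(1) by (auto simp: E_def traj_def)
      let ?S = "{\<omega>' \<in> space M. (\<forall>r\<in>{0..h}. norm (X r \<omega>') \<le> \<eta>) \<and> X s \<omega> \<bullet> X h \<omega>' \<le> 0}"
      have S: "?S \<in> sets M"
      proof -
        have "?S = {\<omega>' \<in> space M. \<forall>r\<in>{0..h}. norm (X r \<omega>') \<le> \<eta>} \<inter> {\<omega>' \<in> space M. X s \<omega> \<bullet> X h \<omega>' \<le> 0}" by auto
        then show ?thesis using h by (auto intro!: sets.Int measurable_stay)
      qed
      have "ennreal (1/4) \<le> emeasure M ?S"
        unfolding emeasure_eq_measure using prob_short_step_towards[OF h \<eta>(2)] by (intro ennreal_leI)
      also have "\<dots> = (\<integral>\<^sup>+ \<omega>'. indicator ?S \<omega>' \<partial>M)" using S by simp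
      also have "\<dots> \<le> (\<integral>\<^sup>+ \<omega>'. \<Phi> (traj s \<omega>, traj h \<omega>') \<partial>M)"
      proof (intro nn_integral_mono)
        fix \<omega>' assume \<omega>': "\<omega>' \<in> space M"
        show "indicator ?S \<omega>' \<le> \<Phi> (traj s \<omega>, traj h \<omega>')"
          using A dyadically_bounded_traj[OF \<omega>' h] s h \<omega>' by (auto simp: indicator_def \<Phi>_def traj_def)
      qed
      finally show ?thesis using True by simp
    qed simp
  qed
  also have "\<dots> = (\<integral>\<^sup>+ \<omega>. \<Phi> (traj s \<omega>, future s h \<omega>) \<partial>M)"
    using nn_integral_markov[OF s(1) \<Phi>] by simp
  also have "\<dots> \<le> (\<integral>\<^sup>+ \<omega>. indicator E' \<omega> \<partial>M)" by (intro nn_integral_mono mono)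
  also have "\<dots> = ennreal (prob E')" by (simp add: emeasure_eq_measure)
  finally have "1/4 * prob E \<le> prob E'" by (subst (asm) ennreal_le_iff) auto
  moreover have "(1/4) ^ k \<le> prob E"
    using Suc unfolding E_def s_def by simp
  ultimately show ?case unfolding s(2) E'_def[symmetric] by simp
qed

text \<open>
  With \<open>n\<close> blocks of length \<open>t / n\<close> and \<open>\<eta> = \<epsilon> / (2 * sqrt n)\<close>, the exit probability from the ball of radius \<open>\<eta>\<close>
  during one block is of order \<open>n powr (\<alpha> / 2 - 1)\<close>. This tends to \<open>0\<close> because \<open>\<alpha> < 2\<close>.
\<close>
theorem prob_stay_pos:
  assumes t: "0 < t" and \<epsilon>: "0 < \<epsilon>"
  shows "0 < prob {\<omega> \<in> space M. \<forall>s\<in>{0..t}. norm (X s \<omega>) \<le> \<epsilon>}"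
proof -
  define c where "c = 2 * tail_const * t * (\<epsilon> / 4) powr - \<alpha>"
  have "(\<lambda>n. c * real n powr (\<alpha> / 2 - 1)) \<longlonglongrightarrow> c * 0"
    using index by (intro tendsto_mult tendsto_const tendsto_neg_powr filterlim_real_sequentially) auto
  then have "eventually (\<lambda>n. c * real n powr (\<alpha> / 2 - 1) < 1/4) sequentially"
    by (rule order_tendstoD) simp
  with eventually_gt_at_top[of 0] have "eventually (\<lambda>n. 0 < n \<and> c * real n powr (\<alpha> / 2 - 1) < 1/4) sequentially"
    by eventually_elim simp
  then obtain n where n: "0 < n" "c * real n powr (\<alpha> / 2 - 1) < 1/4"
    by (auto dest!: eventually_happens)
  define h where "h = t / real n"
  define \<eta> where "\<eta> = \<epsilon> / (2 * sqrt (real n))"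
  have h: "0 \<le> h" and \<eta>: "0 < \<eta>" using t \<epsilon> n by (auto simp: h_def \<eta>_def)
  have "(\<eta> / 2) powr - \<alpha> = (\<epsilon> / 4 / real n powr (1/2)) powr - \<alpha>"
    by (simp add: \<eta>_def powr_half_sqrt)
  also have "\<dots> = (\<epsilon> / 4) powr - \<alpha> * real n powr (\<alpha> / 2)"
    using \<epsilon> by (simp add: powr_divide powr_mult powr_powr powr_minus divide_simps)
  finally have "2 * tail_const * h * (\<eta> / 2) powr - \<alpha> = c * (real n powr (\<alpha> / 2) / real n)"
    by (simp add: c_def h_def)
  also have "real n powr (\<alpha> / 2) / real n = real n powr (\<alpha> / 2 - 1)"
    using n by (simp add: powr_diff)
  finally have "prob {\<omega> \<in> space M. \<exists>s\<in>{0..h}. \<eta> < norm (X s \<omega>)} \<le> 1/4"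
    using prob_exceedance_le[OF h \<eta>] n(2) by linarith
  then have "(1/4) ^ n \<le> prob {\<omega> \<in> space M. (\<forall>s\<in>{0..real n * h}. norm (X s \<omega>) \<le> \<epsilon>)
            \<and> (norm (X (real n * h) \<omega>))\<^sup>2 \<le> real n * \<eta>\<^sup>2}"
    using n by (intro prob_stay_pos_grid h \<eta>) (auto simp: \<eta>_def)
  also have "\<dots> \<le> prob {\<omega> \<in> space M. \<forall>s\<in>{0..t}. norm (X s \<omega>) \<le> \<epsilon>}"
    using n t by (intro finite_measure_mono measurable_stay) (auto simp: h_def)
  finally show ?thesis by (rule less_le_trans[rotated]) simp
qed

end

section \<open>Occupation times and integrability along paths\<close>

lemma nn_integral_interval_split:
  fixes g :: "real \<Rightarrow> ennreal"
  assumes [measurable]: "g \<in> borel_measurable borel" and a: "0 \<le> a" and b: "0 \<le> b"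
  shows "(\<integral>\<^sup>+ r\<in>{0..a + b}. g r \<partial>lborel) = (\<integral>\<^sup>+ r\<in>{0..a}. g r \<partial>lborel) + (\<integral>\<^sup>+ r\<in>{0..b}. g (a + r) \<partial>lborel)"
proof -
  have "(\<integral>\<^sup>+ r\<in>{0..a + b}. g r \<partial>lborel)
      = (\<integral>\<^sup>+ r. g r * indicator {0..a} r + g r * indicator {a..a + b} r \<partial>lborel)"
  proof (intro nn_integral_cong_AE)
    show "AE r in lborel. g r * indicator {0..a + b} r = g r * indicator {0..a} r + g r * indicator {a..a + b} r"
      using AE_lborel_singleton[of a] by eventually_elim (use a b in \<open>auto simp: indicator_def\<close>)
  qed
  also have "\<dots> = (\<integral>\<^sup>+ r\<in>{0..a}. g r \<partial>lborel) + (\<integral>\<^sup>+ r\<in>{a..a + b}. g r \<partial>lborel)"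
    by (rule nn_integral_add) auto
  also have "(\<integral>\<^sup>+ r\<in>{a..a + b}. g r \<partial>lborel) = (\<integral>\<^sup>+ r. g (a + 1 * r) * indicator {a..a + b} (a + 1 * r) \<partial>lborel)"
    by (subst nn_integral_real_affine[where t = a and c = 1]) auto
  also have "\<dots> = (\<integral>\<^sup>+ r\<in>{0..b}. g (a + r) \<partial>lborel)"
    by (intro nn_integral_cong) (auto simp: indicator_def)
  finally show ?thesis .
qed

lemma set_integral_interval_split:
  fixes g :: "real \<Rightarrow> real"
  assumes g [measurable]: "g \<in> borel_measurable borel" and a: "0 \<le> a" and b: "0 \<le> b"
    and int: "set_integrable lborel {0..a + b} g"
  shows "(LINT r:{0..a + b}|lborel. g r) = (LINT r:{0..a}|lborel. g r) + (LINT r:{0..b}|lborel. g (a + r))"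
proof -
  have int1: "set_integrable lborel {0..a} g" "set_integrable lborel {a..a+b} g"
    using a b by (auto intro: set_integrable_subset[OF int])
  have "(LINT r:{0..a + b}|lborel. g r)
      = (LINT r|lborel. indicator {0..a} r *\<^sub>R g r + indicator {a..a + b} r *\<^sub>R g r)"
    unfolding set_lebesgue_integral_def
  proof (intro integral_cong_AE)
    show "AE r in lborel. indicator {0..a + b} r *\<^sub>R g r = indicator {0..a} r *\<^sub>R g r + indicator {a..a + b} r *\<^sub>R g r"
      using AE_lborel_singleton[of a] by eventually_elim (use a b in \<open>auto simp: indicator_def\<close>)
  qed auto
  also have "\<dots> = (LINT r:{0..a}|lborel. g r) + (LINT r:{a..a + b}|lborel. g r)"
    using int1 unfolding set_integrable_def set_lebesgue_integral_def by (rule Bochner_Integration.integral_add)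
  also have "(LINT r:{a..a + b}|lborel. g r) = (LINT r|lborel. indicator {a..a + b} (a + 1 * r) *\<^sub>R g (a + 1 * r))"
    unfolding set_lebesgue_integral_def
    by (subst lborel_integral_real_affine[where t = a and c = 1]) auto
  also have "\<dots> = (LINT r:{0..b}|lborel. g (a + r))"
    unfolding set_lebesgue_integral_def by (intro Bochner_Integration.integral_cong) (auto simp: indicator_def)
  finally show ?thesis .
qed

definition nn_path_integral :: "('a::euclidean_space \<Rightarrow> ennreal) \<Rightarrow> real \<Rightarrow> 'a \<Rightarrow> (real \<Rightarrow> 'a) \<Rightarrow> ennreal" where
  "nn_path_integral g T z p = (\<integral>\<^sup>+ r\<in>{0..T}. g (z + right_val T p r) \<partial>lborel)"

lemma measurable_right_val' [measurable (raw)]: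
  assumes "0 \<le> T" "f \<in> borel_measurable N" "g \<in> N \<rightarrow>\<^sub>M path_space T"
  shows "(\<lambda>x. right_val T (g x) (f x) :: 'a::euclidean_space) \<in> borel_measurable N"
  using measurable_compose[OF measurable_Pair[OF assms(2,3)] measurable_right_val[OF assms(1)]] by simp

lemma measurable_nn_path_integral:
  assumes [measurable]: "g \<in> borel_measurable borel" and T: "0 \<le> T"
  shows "(\<lambda>z. nn_path_integral g T (fst z) (snd z)) \<in> borel_measurable (borel \<Otimes>\<^sub>M path_space T)"
proof -
  have [measurable]: "(\<lambda>x. right_val T (snd (fst x)) (snd x) :: 'a)
     \<in> (borel \<Otimes>\<^sub>M path_space T) \<Otimes>\<^sub>M lborel \<rightarrow>\<^sub>M borel"
    using T by (intro measurable_right_val') measurable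
  show ?thesis
    unfolding nn_path_integral_def by (rule lborel.borel_measurable_nn_integral) measurable
qed

lemma measurable_nn_path_integral' [measurable (raw)]:
  assumes "g \<in> borel_measurable borel" "0 \<le> T" "f \<in> borel_measurable N" "p \<in> N \<rightarrow>\<^sub>M path_space T"
  shows "(\<lambda>x. nn_path_integral g T (f x) (p x)) \<in> borel_measurable N"
  using measurable_compose[OF measurable_Pair[OF assms(3,4)] measurable_nn_path_integral[OF assms(1,2)]] by simp

context pinned_stable_process
begin

lemma measurable_X [measurable]: "0 \<le> t \<Longrightarrow> X t \<in> borel_measurable M"
  using rv by simp

lemma borel_sample_path:
  assumes "\<omega> \<in> space M" "0 \<le> T"
  obtains Y where "Y \<in> borel_measurable borel" "\<And>r. r \<in> {0..T} \<Longrightarrow> X r \<omega> = Y r"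
proof
  have "traj T \<omega> \<in> space (path_space T)" using measurable_space[OF measurable_traj assms(1)] .
  then show "right_val T (traj T \<omega>) \<in> borel_measurable borel"
    using measurable_right_val'[OF assms(2), where f = "\<lambda>x. x" and g = "\<lambda>_. traj T \<omega>" and N = borel]
    by simp
  show "X r \<omega> = right_val T (traj T \<omega>) r" if "r \<in> {0..T}" for r
    using right_val_path[OF assms(1) that] by simp
qed

lemma nn_path_integral_traj:
  "\<omega> \<in> space M \<Longrightarrow> nn_path_integral g T z (traj T \<omega>) = (\<integral>\<^sup>+ r\<in>{0..T}. g (z + X r \<omega>) \<partial>lborel)"
  unfolding nn_path_integral_def by (intro nn_integral_cong) (auto simp: right_val_path indicator_def)

lemma nn_path_integral_future:
  "\<omega> \<in> space M \<Longrightarrow> 0 \<le> s \<Longrightarrow>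
    nn_path_integral g T (x + X s \<omega>) (future s T \<omega>) = (\<integral>\<^sup>+ r\<in>{0..T}. g (x + X (s + r) \<omega>) \<partial>lborel)"
  unfolding nn_path_integral_def by (intro nn_integral_cong) (auto simp: right_val_future indicator_def)

lemma path_integral_future':
  "\<omega> \<in> space M \<Longrightarrow> 0 \<le> s \<Longrightarrow>
     path_integral W T (x + X s \<omega>) (future s T \<omega>) = (LINT r:{0..T}|lborel. W (x + X (s + r) \<omega>))"
  by (subst path_integral_future) (simp_all add: add.assoc)

text \<open>
  The form of the Markov property used throughout: a weight that depends on the past, times a functional of the
  path that starts afresh from the present position.
\<close>
theorem nn_integral_markov_started:
  assumes s: "0 \<le> s" and F: "F \<in> borel_measurable (path_space s)"
    and H: "H \<in> borel_measurable (borel \<Otimes>\<^sub>M path_space t)"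
  shows "(\<integral>\<^sup>+ \<omega>. F (traj s \<omega>) * H (x + X s \<omega>, future s t \<omega>) \<partial>M)
       = (\<integral>\<^sup>+ \<omega>. F (traj s \<omega>) * (\<integral>\<^sup>+ \<omega>'. H (x + X s \<omega>, traj t \<omega>') \<partial>M) \<partial>M)"
proof -
  define \<Phi> where "\<Phi> z = F (fst z) * H (x + fst z s, snd z)" for z
  have ps: "(\<lambda>p. p s :: 'a) \<in> borel_measurable (path_space s)"
    using s by (auto intro!: measurable_component_singleton)
  have 1: "(\<lambda>z. (x + fst z s, snd z)) \<in> path_space s \<Otimes>\<^sub>M path_space t \<rightarrow>\<^sub>M borel \<Otimes>\<^sub>M path_space t"
    using measurable_compose[OF measurable_fst ps] by measurable
  have "\<Phi> \<in> borel_measurable (path_space s \<Otimes>\<^sub>M path_space t)"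
    unfolding \<Phi>_def
    by (intro borel_measurable_times_ennreal measurable_compose[OF measurable_fst F] measurable_compose[OF 1 H])
  from nn_integral_markov[OF s this]
  have "(\<integral>\<^sup>+ \<omega>. F (traj s \<omega>) * H (x + X s \<omega>, future s t \<omega>) \<partial>M)
      = (\<integral>\<^sup>+ \<omega>. \<integral>\<^sup>+ \<omega>'. F (traj s \<omega>) * H (x + X s \<omega>, traj t \<omega>') \<partial>M \<partial>M)"
    using s by (simp add: \<Phi>_def traj_def)
  also have "\<dots> = (\<integral>\<^sup>+ \<omega>. F (traj s \<omega>) * (\<integral>\<^sup>+ \<omega>'. H (x + X s \<omega>, traj t \<omega>') \<partial>M) \<partial>M)"
  proof (intro nn_integral_cong nn_integral_cmult)
    fix \<omega>
    show "(\<lambda>\<omega>'. H (x + X s \<omega>, traj t \<omega>')) \<in> borel_measurable M"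
      by (rule measurable_compose[OF _ H]) measurable
  qed
  finally show ?thesis .
qed

definition occupation :: "('a \<Rightarrow> ennreal) \<Rightarrow> real \<Rightarrow> 'a \<Rightarrow> ennreal" where
  "occupation g t x = (\<integral>\<^sup>+ \<omega>. (\<integral>\<^sup>+ r\<in>{0..t}. g (x + X r \<omega>) \<partial>lborel) \<partial>M)"

lemma occupation_eq_traj: "occupation g t x = (\<integral>\<^sup>+ \<omega>. nn_path_integral g t x (traj t \<omega>) \<partial>M)"
  unfolding occupation_def by (intro nn_integral_cong) (simp add: nn_path_integral_traj)

lemma occupation_fubini:
  assumes [measurable]: "g \<in> borel_measurable borel" and t: "0 \<le> t"
  shows "(\<integral>\<^sup>+ s\<in>{0..t}. (\<integral>\<^sup>+ \<omega>. g (x + X s \<omega>) \<partial>M) \<partial>lborel) = occupation g t x"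
proof -
  interpret pair_sigma_finite lborel M ..
  have [measurable]: "(\<lambda>z. right_val t (traj t (snd z)) (fst z)) \<in> borel_measurable (lborel \<Otimes>\<^sub>M M)"
    using t by (intro measurable_right_val') measurable
  have "(\<integral>\<^sup>+ s\<in>{0..t}. (\<integral>\<^sup>+ \<omega>. g (x + X s \<omega>) \<partial>M) \<partial>lborel)
      = (\<integral>\<^sup>+ s. \<integral>\<^sup>+ \<omega>. g (x + right_val t (traj t \<omega>) s) * indicator {0..t} s \<partial>M \<partial>lborel)"
  proof (intro nn_integral_cong)
    fix s :: real
    show "(\<integral>\<^sup>+ \<omega>. g (x + X s \<omega>) \<partial>M) * indicator {0..t} s
      = (\<integral>\<^sup>+ \<omega>. g (x + right_val t (traj t \<omega>) s) * indicator {0..t} s \<partial>M)"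
      by (cases "s \<in> {0..t}") (auto intro!: nn_integral_cong simp: right_val_path)
  qed
  also have "\<dots> = (\<integral>\<^sup>+ \<omega>. \<integral>\<^sup>+ s. g (x + right_val t (traj t \<omega>) s) * indicator {0..t} s \<partial>lborel \<partial>M)"
    by (rule Fubini'[symmetric]) measurable
  also have "\<dots> = occupation g t x"
    by (simp add: occupation_eq_traj nn_path_integral_def)
  finally show ?thesis .
qed

lemma occupation_add:
  assumes g [measurable]: "g \<in> borel_measurable borel" and a: "0 \<le> a" and b: "0 \<le> b"
  shows "occupation g (a + b) x = occupation g a x + (\<integral>\<^sup>+ \<omega>. occupation g b (x + X a \<omega>) \<partial>M)"
proof -
  have "occupation g (a + b) x = (\<integral>\<^sup>+ \<omega>. nn_path_integral g a x (traj a \<omega>) +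
      nn_path_integral g b (x + X a \<omega>) (future a b \<omega>) \<partial>M)"
    unfolding occupation_def
  proof (intro nn_integral_cong)
    fix \<omega> assume \<omega>: "\<omega> \<in> space M"
    obtain Y where Y [measurable]: "Y \<in> borel_measurable borel" and XY: "\<And>r. r \<in> {0..a + b} \<Longrightarrow> X r \<omega> = Y r"
      using borel_sample_path[OF \<omega>, of "a + b"] a b by auto
    have "(\<integral>\<^sup>+ r\<in>{0..a + b}. g (x + X r \<omega>) \<partial>lborel) = (\<integral>\<^sup>+ r\<in>{0..a + b}. g (x + Y r) \<partial>lborel)"
      by (intro nn_integral_cong) (auto simp: indicator_def XY)
    also have "\<dots> = (\<integral>\<^sup>+ r\<in>{0..a}. g (x + Y r) \<partial>lborel) + (\<integral>\<^sup>+ r\<in>{0..b}. g (x + Y (a + r)) \<partial>lborel)"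
      by (rule nn_integral_interval_split[OF _ a b]) measurable
    also have "(\<integral>\<^sup>+ r\<in>{0..a}. g (x + Y r) \<partial>lborel) = nn_path_integral g a x (traj a \<omega>)"
      unfolding nn_path_integral_traj[OF \<omega>] using b
      by (intro nn_integral_cong) (auto simp: indicator_def XY)
    also have "(\<integral>\<^sup>+ r\<in>{0..b}. g (x + Y (a + r)) \<partial>lborel) = nn_path_integral g b (x + X a \<omega>) (future a b \<omega>)"
      unfolding nn_path_integral_future[OF \<omega> a] using a
      by (intro nn_integral_cong) (auto simp: indicator_def XY)
    finally show "(\<integral>\<^sup>+ r\<in>{0..a + b}. g (x + X r \<omega>) \<partial>lborel) = nn_path_integral g a x (traj a \<omega>) +
      nn_path_integral g b (x + X a \<omega>) (future a b \<omega>)" .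
  qed
  also have "\<dots> = (\<integral>\<^sup>+ \<omega>. nn_path_integral g a x (traj a \<omega>) \<partial>M) +
      (\<integral>\<^sup>+ \<omega>. nn_path_integral g b (x + X a \<omega>) (future a b \<omega>) \<partial>M)"
    using a b by (intro nn_integral_add) measurable
  also have "(\<integral>\<^sup>+ \<omega>. nn_path_integral g b (x + X a \<omega>) (future a b \<omega>) \<partial>M)
      = (\<integral>\<^sup>+ \<omega>. occupation g b (x + X a \<omega>) \<partial>M)"
    using nn_integral_markov_started[OF a, of "\<lambda>_. 1" "\<lambda>z. nn_path_integral g b (fst z) (snd z)" b x]
      measurable_nn_path_integral[OF g b] by (simp add: occupation_eq_traj)
  finally show ?thesis by (simp add: occupation_eq_traj)
qed

lemma occupation_multiple_le:
  assumes [measurable]: "g \<in> borel_measurable borel" and t: "0 \<le> t" and C: "\<And>x. occupation g t x \<le> C"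
  shows "occupation g (real n * t) x \<le> of_nat n * C"
proof (induction n arbitrary: x)
  case 0
  have "(\<integral>\<^sup>+ r\<in>{0..0::real}. g (x + X r \<omega>) \<partial>lborel) = 0" for \<omega>
  proof -
    have "AE r in lborel. g (x + X r \<omega>) * indicator {0..0::real} r = 0"
      using AE_lborel_singleton[of 0] by eventually_elim (simp add: indicator_def)
    then show ?thesis by (subst nn_integral_cong_AE[where v = "\<lambda>_. 0"]) auto
  qed
  then show ?case by (simp add: occupation_def)
next
  case (Suc n)
  have "occupation g (real (Suc n) * t) x = occupation g (t + real n * t) x" by (simp add: algebra_simps)
  also have "\<dots> = occupation g t x + (\<integral>\<^sup>+ \<omega>. occupation g (real n * t) (x + X t \<omega>) \<partial>M)"
    using t by (intro occupation_add) auto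
  also have "\<dots> \<le> C + (\<integral>\<^sup>+ \<omega>. of_nat n * C \<partial>M)"
    using Suc by (intro add_mono C nn_integral_mono)
  also have "\<dots> = of_nat (Suc n) * C" by (simp add: emeasure_space_1 algebra_simps)
  finally show ?case .
qed

lemma occupation_mono:
  "s \<le> t \<Longrightarrow> occupation g s x \<le> occupation g t x"
  unfolding occupation_def by (intro nn_integral_mono) (auto simp: indicator_def)

lemma kato_classD:
  assumes W: "W \<in> kato_class M X" and \<eta>: "0 < \<eta>"
  obtains t where "0 < t" "\<And>x. occupation (\<lambda>y. ennreal \<bar>W y\<bar>) t x \<le> ennreal \<eta>"
proof -
  let ?k = "\<lambda>t x. \<integral>\<^sup>+ s \<in> {0..t}. (\<integral>\<^sup>+ \<omega>. ennreal \<bar>W (x + X s \<omega>)\<bar> \<partial>M) \<partial>lborel"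
  let ?K = "\<lambda>t. SUP x. ?k t x"
  have [measurable]: "W \<in> borel_measurable borel" using W by (simp add: kato_class_def)
  have "(?K \<longlongrightarrow> 0) (at_right 0)"
    using W by (simp add: kato_class_def)
  then have "eventually (\<lambda>t. ?K t < ennreal \<eta>) (at_right 0)"
    by (rule order_tendstoD) (use \<eta> in simp)
  moreover have "eventually (\<lambda>t::real. 0 < t) (at_right 0)" by (simp add: eventually_at_right_less)
  ultimately have "eventually (\<lambda>t. 0 < t \<and> ?K t < ennreal \<eta>) (at_right 0)"
    by eventually_elim simp
  then obtain t where t: "0 < t"
    "?K t < ennreal \<eta>"
    by (auto dest!: eventually_happens simp: trivial_limit_at_right_real)
  have "occupation (\<lambda>y. ennreal \<bar>W y\<bar>) t x \<le> ennreal \<eta>" for x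
  proof -
    have "occupation (\<lambda>y. ennreal \<bar>W y\<bar>) t x = ?k t x"
      using t(1) occupation_fubini[of "\<lambda>y. ennreal \<bar>W y\<bar>" t x] by simp
    also have "\<dots> \<le> ?K t"
      by (rule SUP_upper) simp
    finally show ?thesis using t(2) by simp
  qed
  then show ?thesis using that t(1) by blast
qed

lemma AE_integrable_of_occupation:
  assumes W [measurable]: "W \<in> borel_measurable borel" and t: "0 \<le> t"
    and fin: "occupation (\<lambda>y. ennreal \<bar>W y\<bar>) t x < \<infinity>"
  shows "AE \<omega> in M. set_integrable lborel {0..t} (\<lambda>r. W (x + X r \<omega>))"
proof -
  have "AE \<omega> in M. nn_path_integral (\<lambda>y. ennreal \<bar>W y\<bar>) t x (traj t \<omega>) \<noteq> \<infinity>"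
    using fin t unfolding occupation_eq_traj by (intro nn_integral_PInf_AE) (auto, measurable)
  with AE_space show ?thesis
  proof eventually_elim
    case (elim \<omega>)
    then have \<omega>: "\<omega> \<in> space M" and f: "nn_path_integral (\<lambda>y. ennreal \<bar>W y\<bar>) t x (traj t \<omega>) \<noteq> \<infinity>"
      by auto
    obtain Y where Y [measurable]: "Y \<in> borel_measurable borel" and XY: "\<And>r. r \<in> {0..t} \<Longrightarrow> X r \<omega> = Y r"
      using borel_sample_path[OF \<omega> t] by auto
    have "set_integrable lborel {0..t} (\<lambda>r. W (x + Y r))"
      unfolding set_integrable_def integrable_iff_bounded
    proof
      have "(\<integral>\<^sup>+ r. ennreal (norm (indicator {0..t} r *\<^sub>R W (x + Y r))) \<partial>lborel)
          = nn_path_integral (\<lambda>y. ennreal \<bar>W y\<bar>) t x (traj t \<omega>)"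
        unfolding nn_path_integral_traj[OF \<omega>]
        by (intro nn_integral_cong) (auto simp: indicator_def XY)
      then show "(\<integral>\<^sup>+ r. ennreal (norm (indicator {0..t} r *\<^sub>R W (x + Y r))) \<partial>lborel) < \<infinity>"
        using f by (simp add: top.not_eq_extremum)
    qed measurable
    then show "set_integrable lborel {0..t} (\<lambda>r. W (x + X r \<omega>))"
      by (rule set_integrable_cong[THEN iffD1, rotated -1]) (auto simp: XY)
  qed
qed

text \<open>
  A function of Kato class has bounded expected integral over some short interval, uniformly in the starting
  point. The Markov property adds up such intervals to any length.
\<close>
lemma kato_class_AE_integrable:
  assumes W: "W \<in> kato_class M X" and t: "0 \<le> t"
  shows "AE \<omega> in M. set_integrable lborel {0..t} (\<lambda>r. W (x + X r \<omega>))"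
proof -
  have [measurable]: "W \<in> borel_measurable borel" using W by (simp add: kato_class_def)
  obtain s where s: "0 < s" "\<And>x. occupation (\<lambda>y. ennreal \<bar>W y\<bar>) s x \<le> ennreal 1"
    using kato_classD[OF W, of 1] by auto
  obtain n :: nat where n: "t \<le> real n * s"
    using reals_Archimedean3[OF s(1)] less_imp_le by blast
  have "occupation (\<lambda>y. ennreal \<bar>W y\<bar>) t x \<le> occupation (\<lambda>y. ennreal \<bar>W y\<bar>) (real n * s) x"
    by (rule occupation_mono[OF n])
  also have "\<dots> \<le> of_nat n * ennreal 1"
    using s by (intro occupation_multiple_le) auto
  also have "\<dots> < \<infinity>" by (simp add: ennreal_mult_less_top of_nat_less_top)
  finally show ?thesis using t by (intro AE_integrable_of_occupation) auto
qed

lemma path_integral_split: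
  assumes W [measurable]: "W \<in> borel_measurable borel" and \<omega>: "\<omega> \<in> space M" and a: "0 \<le> a" and b: "0 \<le> b"
    and int: "set_integrable lborel {0..a + b} (\<lambda>r. W (x + X r \<omega>))"
  shows "path_integral W (a + b) x (traj (a + b) \<omega>)
       = path_integral W a x (traj a \<omega>) + path_integral W b (x + X a \<omega>) (future a b \<omega>)"
proof -
  obtain Y where Y [measurable]: "Y \<in> borel_measurable borel" and XY: "\<And>r. r \<in> {0..a + b} \<Longrightarrow> X r \<omega> = Y r"
    using borel_sample_path[OF \<omega>, of "a + b"] a b by auto
  have "set_integrable lborel {0..a + b} (\<lambda>r. W (x + Y r))"
    using int by (rule set_integrable_cong[THEN iffD1, rotated -1]) (auto simp: XY)
  then have "(LINT r:{0..a + b}|lborel. W (x + Y r))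
      = (LINT r:{0..a}|lborel. W (x + Y r)) + (LINT r:{0..b}|lborel. W (x + Y (a + r)))"
    by (intro set_integral_interval_split a b) measurable
  moreover have "path_integral W (a + b) x (traj (a + b) \<omega>) = (LINT r:{0..a + b}|lborel. W (x + Y r))"
    unfolding path_integral_path[OF \<omega>] by (intro set_lebesgue_integral_cong) (auto simp: XY)
  moreover have "path_integral W a x (traj a \<omega>) = (LINT r:{0..a}|lborel. W (x + Y r))"
    unfolding path_integral_path[OF \<omega>] using b by (intro set_lebesgue_integral_cong) (auto simp: XY)
  moreover have "path_integral W b (x + X a \<omega>) (future a b \<omega>) = (LINT r:{0..b}|lborel. W (x + Y (a + r)))"
    unfolding path_integral_future'[OF \<omega> a] using a by (intro set_lebesgue_integral_cong) (auto simp: XY)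
  ultimately show ?thesis by simp
qed

end

section \<open>Khasminskii's exponential bound\<close>

context pinned_stable_process
begin

lemma bounded_set_integrable_path:
  fixes W :: "'a \<Rightarrow> real"
  assumes W [measurable]: "W \<in> borel_measurable borel" and N: "\<And>y. \<bar>W y\<bar> \<le> N"
    and \<omega>: "\<omega> \<in> space M" and t: "0 \<le> t"
  shows "set_integrable lborel {0..t} (\<lambda>r. W (x + X r \<omega>))"
proof -
  obtain Y where Y [measurable]: "Y \<in> borel_measurable borel" and XY: "\<And>r. r \<in> {0..t} \<Longrightarrow> X r \<omega> = Y r"
    using borel_sample_path[OF \<omega> t] by auto
  have "set_integrable lborel {0..t} (\<lambda>r. W (x + Y r))"
    unfolding set_integrable_def
    by (rule integrableI_bounded_set_indicator[where B = N]) (use N in \<open>auto simp: emeasure_lborel_Icc_eq\<close>)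
  then show ?thesis by (rule set_integrable_cong[THEN iffD1, rotated -1]) (auto simp: XY)
qed

lemma ennreal_path_integral:
  assumes W [measurable]: "W \<in> borel_measurable borel" and pos: "\<And>y. 0 \<le> W y"
    and \<omega>: "\<omega> \<in> space M" and int: "set_integrable lborel {0..t} (\<lambda>r. W (x + X r \<omega>))"
  shows "ennreal (path_integral W t x (traj t \<omega>)) = nn_path_integral (\<lambda>y. ennreal (W y)) t x (traj t \<omega>)"
proof -
  have "ennreal (path_integral W t x (traj t \<omega>)) = (\<integral>\<^sup>+ r. ennreal (indicator {0..t} r *\<^sub>R W (x + X r \<omega>)) \<partial>lborel)"
    unfolding path_integral_path[OF \<omega>] set_lebesgue_integral_def
    using int pos unfolding set_integrable_def by (intro nn_integral_eq_integral[symmetric]) auto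
  also have "\<dots> = nn_path_integral (\<lambda>y. ennreal (W y)) t x (traj t \<omega>)"
    unfolding nn_path_integral_traj[OF \<omega>] by (intro nn_integral_cong) (auto simp: indicator_def)
  finally show ?thesis .
qed

lemma path_integral_nonneg: "(\<And>y. 0 \<le> W y) \<Longrightarrow> 0 \<le> path_integral W t x p"
  unfolding path_integral_def set_lebesgue_integral_def by (intro integral_nonneg_AE) auto

lemma path_integral_le_bound:
  assumes W: "W \<in> borel_measurable borel" and N: "\<And>y. 0 \<le> W y" "\<And>y. W y \<le> N"
    and \<omega>: "\<omega> \<in> space M" and t: "0 \<le> t"
  shows "path_integral W t x (traj t \<omega>) \<le> N * t"
proof -
  have "(LINT r:{0..t}|lborel. W (x + X r \<omega>)) \<le> (LINT r:{0..t}|lborel. N)"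
    using N by (intro set_integral_mono bounded_set_integrable_path[OF W _ \<omega> t, of N]) (auto simp: set_integrable_def integrable_indicator_iff emeasure_lborel_Icc_eq)
  also have "\<dots> = N * t" using t by (simp add: set_lebesgue_integral_def)
  finally show ?thesis by (simp add: path_integral_path[OF \<omega>])
qed

lemma expectation_path_integral:
  assumes W [measurable]: "W \<in> borel_measurable borel" and N: "\<And>y. 0 \<le> W y" "\<And>y. W y \<le> N" and t: "0 \<le> t"
  shows "(\<integral>\<^sup>+ \<omega>. ennreal (path_integral W t x (traj t \<omega>)) \<partial>M) = occupation (\<lambda>y. ennreal (W y)) t x"
  unfolding occupation_eq_traj using N
  by (intro nn_integral_cong ennreal_path_integral bounded_set_integrable_path[where N = N] t W) auto

definition exp_moment :: "('a \<Rightarrow> real) \<Rightarrow> real \<Rightarrow> 'a \<Rightarrow> ennreal" where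
  "exp_moment W t x = (\<integral>\<^sup>+ \<omega>. ennreal (exp (path_integral W t x (traj t \<omega>))) \<partial>M)"

text \<open>
  Write \<open>exp (A + B) = (exp A - 1) * exp B + exp B\<close>, with \<open>A\<close> from the first interval and \<open>B\<close> from the second.
  Here \<open>exp A - 1 \<le> A * exp A \<le> A * exp (N * h)\<close>, and given the past the expectation of \<open>exp B\<close> is at most \<open>K\<close>.
\<close>
lemma exp_moment_step:
  assumes W [measurable]: "W \<in> borel_measurable borel" and N: "\<And>y. 0 \<le> W y" "\<And>y. W y \<le> N"
    and h: "0 \<le> h" and s: "0 \<le> s" and K: "\<And>y. exp_moment W s y \<le> K"
  shows "exp_moment W (h + s) x
      \<le> K * ennreal (exp (N * h)) * occupation (\<lambda>y. ennreal (W y)) h x + (\<integral>\<^sup>+ \<omega>. exp_moment W s (x + X h \<omega>) \<partial>M)"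
proof -
  let ?A = "\<lambda>\<omega>. path_integral W h x (traj h \<omega>)" and ?B = "\<lambda>\<omega>. path_integral W s (x + X h \<omega>) (future h s \<omega>)"
  let ?a = "\<lambda>\<omega>. ennreal (exp (?A \<omega>) - 1)" and ?b = "\<lambda>\<omega>. ennreal (exp (?B \<omega>))"
  have A: "0 \<le> ?A \<omega>" "?A \<omega> \<le> N * h" if "\<omega> \<in> space M" for \<omega>
    using path_integral_nonneg path_integral_le_bound[OF W N that h] N by auto
  have H: "(\<lambda>z. ennreal (exp (path_integral W s (fst z) (snd z)))) \<in> borel_measurable (borel \<Otimes>\<^sub>M path_space s)"
    using s by measurable
  have "exp_moment W (h + s) x
      = (\<integral>\<^sup>+ \<omega>. ?a \<omega> * ?b \<omega> + 1 * ?b \<omega> \<partial>M)"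
    unfolding exp_moment_def
  proof (intro nn_integral_cong)
    fix \<omega> assume \<omega>: "\<omega> \<in> space M"
    have "path_integral W (h + s) x (traj (h + s) \<omega>) = ?A \<omega> + ?B \<omega>"
      using N h s by (intro path_integral_split W \<omega> bounded_set_integrable_path[where N = N]) auto
    then have "ennreal (exp (path_integral W (h + s) x (traj (h + s) \<omega>)))
        = ennreal ((exp (?A \<omega>) - 1) * exp (?B \<omega>) + exp (?B \<omega>))"
      by (simp add: exp_add algebra_simps)
    also have "\<dots> = ?a \<omega> * ?b \<omega> + 1 * ?b \<omega>"
      using A[OF \<omega>] by (simp add: ennreal_mult)
    finally show "ennreal (exp (path_integral W (h + s) x (traj (h + s) \<omega>))) = \<dots>" .
  qed
  also have "\<dots> = (\<integral>\<^sup>+ \<omega>. ?a \<omega> * ?b \<omega> \<partial>M) + (\<integral>\<^sup>+ \<omega>. 1 * ?b \<omega> \<partial>M)"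
    using h s by (intro nn_integral_add) measurable
  also have "(\<integral>\<^sup>+ \<omega>. ?a \<omega> * ?b \<omega> \<partial>M)
      = (\<integral>\<^sup>+ \<omega>. ?a \<omega> * exp_moment W s (x + X h \<omega>) \<partial>M)"
  proof -
    have "(\<lambda>p. ennreal (exp (path_integral W h x p) - 1)) \<in> borel_measurable (path_space h)"
      using h by measurable
    from nn_integral_markov_started[OF h this H, of x] show ?thesis by (simp add: exp_moment_def)
  qed
  also have "(\<integral>\<^sup>+ \<omega>. 1 * ?b \<omega> \<partial>M) = (\<integral>\<^sup>+ \<omega>. exp_moment W s (x + X h \<omega>) \<partial>M)"
    using nn_integral_markov_started[OF h _ H, of "\<lambda>_. 1" x] by (simp add: exp_moment_def)
  also have "(\<integral>\<^sup>+ \<omega>. ?a \<omega> * exp_moment W s (x + X h \<omega>) \<partial>M)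
      \<le> (\<integral>\<^sup>+ \<omega>. K * ennreal (exp (N * h)) * ennreal (?A \<omega>) \<partial>M)"
  proof (intro nn_integral_mono)
    fix \<omega> assume \<omega>: "\<omega> \<in> space M"
    (* Equivalent to exp A - 1 \<le> A * exp A. *)
    have "exp (?A \<omega>) * (1 - ?A \<omega>) \<le> exp (?A \<omega>) * exp (- ?A \<omega>)"
      using exp_ge_add_one_self[of "- ?A \<omega>"] by (intro mult_left_mono) auto
    then have "exp (?A \<omega>) - 1 \<le> exp (?A \<omega>) * ?A \<omega>" by (simp add: exp_minus algebra_simps)
    also have "\<dots> \<le> exp (N * h) * ?A \<omega>" using A[OF \<omega>] by (intro mult_right_mono) auto
    finally have "?a \<omega> \<le> ennreal (exp (N * h)) * ennreal (?A \<omega>)"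
      using A[OF \<omega>] by (simp add: ennreal_mult[symmetric] ennreal_leI)
    then have "?a \<omega> * exp_moment W s (x + X h \<omega>) \<le> (ennreal (exp (N * h)) * ennreal (?A \<omega>)) * K"
      by (intro mult_mono K) auto
    then show "?a \<omega> * exp_moment W s (x + X h \<omega>) \<le> K * ennreal (exp (N * h)) * ennreal (?A \<omega>)"
      by (simp add: ac_simps)
  qed
  also have "\<dots> = K * ennreal (exp (N * h)) * occupation (\<lambda>y. ennreal (W y)) h x"
    using h by (subst nn_integral_cmult) (auto simp: expectation_path_integral[OF W N h])
  finally show ?thesis by (simp add: add_mono)
qed

lemma exp_moment_mono:
  assumes W: "W \<in> borel_measurable borel" and N: "\<And>y. 0 \<le> W y" "\<And>y. W y \<le> N" and s: "0 \<le> s" "s \<le> t"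
  shows "exp_moment W s x \<le> exp_moment W t x"
  unfolding exp_moment_def
proof (intro nn_integral_mono ennreal_leI)
  fix \<omega> assume \<omega>: "\<omega> \<in> space M"
  have "path_integral W (s + (t - s)) x (traj (s + (t - s)) \<omega>)
      = path_integral W s x (traj s \<omega>) + path_integral W (t - s) (x + X s \<omega>) (future s (t - s) \<omega>)"
    using N s by (intro path_integral_split W \<omega> bounded_set_integrable_path[where N = N]) auto
  then show "exp (path_integral W s x (traj s \<omega>)) \<le> exp (path_integral W t x (traj t \<omega>))"
    using path_integral_nonneg[of W "t - s" "x + X s \<omega>" "future s (t - s) \<omega>"] N by simp
qed

lemma exp_moment_grid:
  assumes W [measurable]: "W \<in> borel_measurable borel" and N: "\<And>y. 0 \<le> W y" "\<And>y. W y \<le> N"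
    and h: "0 \<le> h" and K: "\<And>i y. i < n \<Longrightarrow> exp_moment W (real i * h) y \<le> K" and i: "i \<le> n"
  shows "exp_moment W (real i * h) x
      \<le> 1 + K * ennreal (exp (N * h)) * occupation (\<lambda>y. ennreal (W y)) (real i * h) x"
  using i
proof (induction i arbitrary: x)
  case 0
  have "path_integral W 0 x (traj 0 \<omega>) = 0" if "\<omega> \<in> space M" for \<omega>
    using path_integral_le_bound[OF W N that, of 0 x] path_integral_nonneg[of W 0 x "traj 0 \<omega>"] N(1) by auto
  then have "exp_moment W 0 x = (\<integral>\<^sup>+ \<omega>. 1 \<partial>M)"
    unfolding exp_moment_def by (intro nn_integral_cong) simp
  then have "exp_moment W 0 x = 1" by (simp add: emeasure_space_1)
  then show ?case by simp
next
  case (Suc i)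
  let ?c = "K * ennreal (exp (N * h))" and ?o = "occupation (\<lambda>y. ennreal (W y))"
  have i: "0 \<le> real i * h" using h by simp
  have [measurable]: "(\<lambda>\<omega>. ?o (real i * h) (x + X h \<omega>)) \<in> borel_measurable M"
    using h i unfolding occupation_eq_traj by measurable
  have "exp_moment W (real (Suc i) * h) x = exp_moment W (h + real i * h) x" by (simp add: algebra_simps)
  also have "\<dots> \<le> ?c * ?o h x + (\<integral>\<^sup>+ \<omega>. exp_moment W (real i * h) (x + X h \<omega>) \<partial>M)"
    using Suc.prems by (intro exp_moment_step W N h i K) auto
  also have "\<dots> \<le> ?c * ?o h x + (\<integral>\<^sup>+ \<omega>. 1 + ?c * ?o (real i * h) (x + X h \<omega>) \<partial>M)"
    using Suc by (intro add_mono nn_integral_mono) auto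
  also have "(\<integral>\<^sup>+ \<omega>. 1 + ?c * ?o (real i * h) (x + X h \<omega>) \<partial>M)
      = 1 + ?c * (\<integral>\<^sup>+ \<omega>. ?o (real i * h) (x + X h \<omega>) \<partial>M)"
    by (simp add: nn_integral_add nn_integral_cmult emeasure_space_1)
  also have "?c * ?o h x + (1 + ?c * (\<integral>\<^sup>+ \<omega>. ?o (real i * h) (x + X h \<omega>) \<partial>M))
      = 1 + ?c * (?o h x + (\<integral>\<^sup>+ \<omega>. ?o (real i * h) (x + X h \<omega>) \<partial>M))"
    by (simp add: algebra_simps)
  also have "?o h x + (\<integral>\<^sup>+ \<omega>. ?o (real i * h) (x + X h \<omega>) \<partial>M) = ?o (h + real i * h) x"
    by (rule occupation_add[OF _ h i, symmetric]) measurable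
  finally show ?case by (simp add: algebra_simps)
qed

text \<open>
  If \<open>\<kappa>\<close> is the supremum of the exponential moments, summing \<open>exp_moment_step\<close> over a grid of width \<open>h\<close> gives
  \<open>\<kappa> \<le> 1 + \<kappa> * exp (N * h) * \<eta>\<close>. As \<open>h\<close> tends to \<open>0\<close> this becomes \<open>\<kappa> \<le> 1 + \<kappa> * \<eta>\<close>. Boundedness of \<open>W\<close>
  ensures that \<open>\<kappa>\<close> is finite.
\<close>
lemma khasminskii_bounded:
  assumes W [measurable]: "W \<in> borel_measurable borel" and N: "\<And>y. 0 \<le> W y" "\<And>y. W y \<le> N"
    and t: "0 \<le> t" and \<eta>: "0 \<le> \<eta>" "\<eta> < 1"
    and occ: "\<And>y. occupation (\<lambda>y. ennreal (W y)) t y \<le> ennreal \<eta>"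
  shows "exp_moment W t x \<le> ennreal (1 / (1 - \<eta>))"
proof -
  define K where "K = (SUP y. exp_moment W t y)"
  have "exp_moment W t y \<le> ennreal (exp (N * t))" for y
  proof -
    have "exp_moment W t y \<le> (\<integral>\<^sup>+ \<omega>. ennreal (exp (N * t)) \<partial>M)"
      unfolding exp_moment_def using path_integral_le_bound[OF W N _ t]
      by (intro nn_integral_mono ennreal_leI) auto
    then show ?thesis by (simp add: emeasure_space_1)
  qed
  then have "K \<le> ennreal (exp (N * t))" unfolding K_def by (rule SUP_least)
  then obtain \<kappa> where \<kappa>: "0 \<le> \<kappa>" "K = ennreal \<kappa>"
    by (cases K) (auto simp: top_unique)
  have le_K: "exp_moment W s y \<le> K" if "0 \<le> s" "s \<le> t" for s y
    using exp_moment_mono[OF W N that, of y] SUP_upper[of y UNIV "exp_moment W t"] unfolding K_def by simp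
  have bound: "\<kappa> \<le> 1 + \<kappa> * exp (N * (t / real (Suc n))) * \<eta>" for n
  proof -
    let ?h = "t / real (Suc n)"
    have "exp_moment W t y \<le> 1 + K * ennreal (exp (N * ?h)) * ennreal \<eta>" for y
    proof -
      have "exp_moment W (real (Suc n) * ?h) y
          \<le> 1 + K * ennreal (exp (N * ?h)) * occupation (\<lambda>y. ennreal (W y)) (real (Suc n) * ?h) y"
      proof (rule exp_moment_grid[OF W N, of ?h "Suc n"])
        fix i y assume "i < Suc n"
        then have "real i * ?h \<le> real (Suc n) * ?h" using t by (intro mult_right_mono) auto
        then show "exp_moment W (real i * ?h) y \<le> K" using t by (intro le_K) auto
      qed (use t in auto)
      also have "real (Suc n) * ?h = t" by simp
      also have "1 + K * ennreal (exp (N * ?h)) * occupation (\<lambda>y. ennreal (W y)) t y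
          \<le> 1 + K * ennreal (exp (N * ?h)) * ennreal \<eta>"
        by (intro add_mono mult_left_mono occ) auto
      finally show ?thesis .
    qed
    then have "K \<le> 1 + K * ennreal (exp (N * ?h)) * ennreal \<eta>" unfolding K_def by (rule SUP_least)
    also have "\<dots> = ennreal (1 + \<kappa> * exp (N * ?h) * \<eta>)"
      using \<kappa>(1) \<eta>(1) unfolding \<kappa>(2) by (simp add: ennreal_mult ennreal_plus)
    finally have "ennreal \<kappa> \<le> ennreal (1 + \<kappa> * exp (N * ?h) * \<eta>)" unfolding \<kappa>(2) .
    then show ?thesis using \<kappa>(1) \<eta>(1) by (subst (asm) ennreal_le_iff) (auto intro!: add_nonneg_nonneg mult_nonneg_nonneg)
  qed
  have "(\<lambda>n. 1 + \<kappa> * exp (N * (t / real (Suc n))) * \<eta>) \<longlonglongrightarrow> 1 + \<kappa> * exp (N * 0) * \<eta>"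
    by (intro tendsto_intros LIMSEQ_Suc[OF lim_const_over_n])
  then have "\<kappa> \<le> 1 + \<kappa> * exp (N * 0) * \<eta>"
    using bound by (intro LIMSEQ_le_const) auto
  then have "\<kappa> \<le> 1 / (1 - \<eta>)" using \<eta> by (simp add: field_simps)
  then have "K \<le> ennreal (1 / (1 - \<eta>))" unfolding \<kappa>(2) by (rule ennreal_leI)
  then show ?thesis using le_K[OF t order_refl, of x] by simp
qed

text \<open>
  The bound for the truncations \<open>min W n\<close> does not involve \<open>n\<close>, and Fatou's lemma removes the truncation.
\<close>
theorem khasminskii:
  assumes W [measurable]: "W \<in> borel_measurable borel" and pos: "\<And>y. 0 \<le> W y"
    and t: "0 \<le> t" and \<eta>: "0 \<le> \<eta>" "\<eta> < 1"
    and occ: "\<And>y. occupation (\<lambda>y. ennreal (W y)) t y \<le> ennreal \<eta>"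
  shows "exp_moment W t x \<le> ennreal (1 / (1 - \<eta>))"
proof -
  define WN where "WN n y = min (W y) (real n)" for n y
  have WN [measurable]: "WN n \<in> borel_measurable borel" for n unfolding WN_def by measurable
  let ?e = "\<lambda>n \<omega>. ennreal (exp (path_integral (WN n) t x (traj t \<omega>)))"
  have "AE \<omega> in M. set_integrable lborel {0..t} (\<lambda>r. W (x + X r \<omega>))"
  proof (rule AE_integrable_of_occupation[OF W t])
    have "(\<lambda>y. ennreal \<bar>W y\<bar>) = (\<lambda>y. ennreal (W y))" using pos by auto
    then show "occupation (\<lambda>y. ennreal \<bar>W y\<bar>) t x < \<infinity>" using occ[of x] le_less_trans by fastforce
  qed
  then have lim: "AE \<omega> in M. ennreal (exp (path_integral W t x (traj t \<omega>))) = liminf (\<lambda>n. ?e n \<omega>)"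
    using AE_space
  proof eventually_elim
    case (elim \<omega>)
    obtain Y where Y [measurable]: "Y \<in> borel_measurable borel" and XY: "\<And>r. r \<in> {0..t} \<Longrightarrow> X r \<omega> = Y r"
      using borel_sample_path[OF elim(2) t] by auto
    have eq: "path_integral U t x (traj t \<omega>) = (LINT r|lborel. indicator {0..t} r *\<^sub>R U (x + Y r))" for U
      unfolding path_integral_path[OF elim(2)] set_lebesgue_integral_def
      by (intro Bochner_Integration.integral_cong) (auto simp: indicator_def XY)
    let ?f = "\<lambda>n r. indicator {0..t} r *\<^sub>R WN n (x + Y r)" and ?g = "\<lambda>r. indicator {0..t} r *\<^sub>R W (x + Y r)"
    have int: "set_integrable lborel {0..t} (\<lambda>r. W (x + Y r))"
      using elim(1) by (rule set_integrable_cong[THEN iffD1, rotated -1]) (auto simp: XY)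
    have "(\<lambda>n. LINT r|lborel. ?f n r) \<longlonglongrightarrow> (LINT r|lborel. ?g r)"
    proof (rule integral_dominated_convergence)
      show "integrable lborel (\<lambda>r. ?g r)"
        using int by (simp add: set_integrable_def)
      have "(\<lambda>n. WN n y) \<longlonglongrightarrow> W y" for y
      proof (rule tendsto_eventually)
        obtain m :: nat where "W y \<le> real m" using real_arch_simple by auto
        then have "W y \<le> real n" if "m \<le> n" for n using that by (meson le_trans of_nat_le_iff order_trans)
        then show "eventually (\<lambda>n. WN n y = W y) sequentially"
          unfolding WN_def eventually_sequentially by (auto simp: min_def)
      qed
      then show "AE r in lborel. (\<lambda>n. ?f n r) \<longlonglongrightarrow> ?g r"
        by (intro AE_I2 tendsto_intros)
      show "AE r in lborel. norm (?f n r) \<le> ?g r" for n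
        using pos by (intro AE_I2) (auto simp: WN_def indicator_def)
    qed measurable
    then have "(\<lambda>n. ?e n \<omega>) \<longlonglongrightarrow> ennreal (exp (path_integral W t x (traj t \<omega>)))"
      unfolding eq by (intro tendsto_ennrealI tendsto_exp)
    then show ?case by (rule lim_imp_Liminf[symmetric, rotated]) simp
  qed
  have "exp_moment W t x = (\<integral>\<^sup>+ \<omega>. liminf (\<lambda>n. ?e n \<omega>) \<partial>M)"
    unfolding exp_moment_def by (rule nn_integral_cong_AE[OF lim])
  also have "\<dots> \<le> liminf (\<lambda>n. \<integral>\<^sup>+ \<omega>. ?e n \<omega> \<partial>M)"
    using t by (intro nn_integral_liminf) measurable
  also have "\<dots> \<le> liminf (\<lambda>n::nat. ennreal (1 / (1 - \<eta>)))"
  proof (intro Liminf_mono always_eventually allI)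
    fix n
    have "occupation (\<lambda>y. ennreal (WN n y)) t y \<le> ennreal \<eta>" for y
    proof -
      have "occupation (\<lambda>y. ennreal (WN n y)) t y \<le> occupation (\<lambda>y. ennreal (W y)) t y"
        unfolding occupation_def WN_def by (intro nn_integral_mono mult_right_mono ennreal_leI) auto
      then show ?thesis using occ[of y] by simp
    qed
    then have "exp_moment (WN n) t x \<le> ennreal (1 / (1 - \<eta>))"
      using pos by (intro khasminskii_bounded[where N = "real n"] WN t \<eta>) (auto simp: WN_def)
    then show "(\<integral>\<^sup>+ \<omega>. ?e n \<omega> \<partial>M) \<le> ennreal (1 / (1 - \<eta>))" by (simp add: exp_moment_def)
  qed
  also have "\<dots> = ennreal (1 / (1 - \<eta>))" by (simp add: Liminf_const)
  finally show ?thesis .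
qed

lemma AE_bounded_sample_path:
  assumes t: "0 \<le> t"
  shows "AE \<omega> in M. \<exists>n::nat. \<forall>s\<in>{0..t}. norm (X s \<omega>) \<le> real n"
proof -
  let ?E = "\<lambda>n::nat. {\<omega> \<in> space M. \<exists>s\<in>{0..t}. real n < norm (X s \<omega>)}"
  have E: "?E n \<in> sets M" for n by (rule measurable_exceedance[OF t])
  then have sets: "(\<Inter>n. ?E n) \<in> sets M" by (intro sets.countable_INT') auto
  have "(\<lambda>n. 2 * tail_const * t * real (Suc n) powr - \<alpha>) \<longlonglongrightarrow> 2 * tail_const * t * 0"
    using index
    by (intro tendsto_mult tendsto_const tendsto_neg_powr filterlim_compose[OF filterlim_real_sequentially filterlim_Suc]) auto
  moreover have "prob (\<Inter>n. ?E n) \<le> 2 * tail_const * t * real (Suc n) powr - \<alpha>" for n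
  proof -
    have "prob (\<Inter>n. ?E n) \<le> prob (?E (2 * Suc n))" using E by (intro finite_measure_mono INF_lower) blast+
    also have "\<dots> \<le> 2 * tail_const * t * real (Suc n) powr - \<alpha>"
    proof -
      have "real (2 * Suc n) / 2 = real (Suc n)" by simp
      moreover have "0 < real (2 * Suc n)" by simp
      ultimately show ?thesis using prob_exceedance_le[OF t, of "real (2 * Suc n)"] by metis
    qed
    finally show ?thesis .
  qed
  ultimately have "prob (\<Inter>n. ?E n) \<le> 2 * tail_const * t * 0" by (intro LIMSEQ_le_const) auto
  then have "prob (\<Inter>n. ?E n) = 0" using measure_nonneg[of M "\<Inter>n. ?E n"] by linarith
  then have "(\<Inter>n. ?E n) \<in> null_sets M" using sets by (simp add: null_sets_def emeasure_eq_measure)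
  then show ?thesis by (rule AE_I') (auto simp: not_le)
qed

end

section \<open>The Feynman-Kac semigroup\<close>

locale schrodinger_potential = pinned_stable_process M \<alpha> X
  for M :: "'w measure" and \<alpha> and X :: "real \<Rightarrow> 'w \<Rightarrow> 'a::euclidean_space" +
  fixes V :: "'a \<Rightarrow> real"
  assumes kato: "kato_decomposable M X V"
begin

lemma V_measurable [measurable]: "V \<in> borel_measurable borel"
  using kato by (simp add: kato_decomposable_def)

lemma negative_part_AE_integrable:
  "0 \<le> t \<Longrightarrow> AE \<omega> in M. set_integrable lborel {0..t} (\<lambda>r. max (- V (x + X r \<omega>)) 0)"
  using kato kato_class_AE_integrable[of "\<lambda>y. max (- V y) 0" t x] by (simp add: kato_decomposable_def)

text \<open>
  The positive part of \<open>V\<close> is only locally of Kato class, but almost every path stays in some ball up to time \<open>t\<close>.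
\<close>
lemma potential_AE_integrable:
  assumes t: "0 \<le> t"
  shows "AE \<omega> in M. set_integrable lborel {0..t} (\<lambda>r. V (x + X r \<omega>))"
proof -
  define U where "U n y = max (V y) 0 * indicator (ball 0 (real (Suc n))) y" for n y
  have "U n \<in> kato_class M X" for n
    using kato unfolding kato_decomposable_def kato_class_loc_def U_def by (auto intro: of_nat_0_less_iff)
  then have "AE \<omega> in M. set_integrable lborel {0..t} (\<lambda>r. U n (x + X r \<omega>))" for n
    by (intro kato_class_AE_integrable t)
  then have "AE \<omega> in M. \<forall>n. set_integrable lborel {0..t} (\<lambda>r. U n (x + X r \<omega>))"
    by (simp add: AE_all_countable)
  then show ?thesis
    using AE_bounded_sample_path[OF t] negative_part_AE_integrable[OF t, of x]
  proof eventually_elim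
    case (elim \<omega>)
    then obtain n :: nat where n: "\<And>s. s \<in> {0..t} \<Longrightarrow> norm (X s \<omega>) \<le> real n" by blast
    obtain m :: nat where m: "norm x + real n \<le> real m" using real_arch_simple by auto
    have "norm (x + X s \<omega>) < real (Suc m)" if "s \<in> {0..t}" for s
      using norm_triangle_ineq[of x "X s \<omega>"] n[OF that] m by simp
    then have "x + X s \<omega> \<in> ball 0 (real (Suc m))" if "s \<in> {0..t}" for s
      using that by (simp only: mem_ball_0)
    then have "U m (x + X s \<omega>) - max (- V (x + X s \<omega>)) 0 = V (x + X s \<omega>)" if "s \<in> {0..t}" for s
      using that by (simp add: U_def max_def)
    moreover have "set_integrable lborel {0..t} (\<lambda>r. U m (x + X r \<omega>) - max (- V (x + X r \<omega>)) 0)"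
      using elim by (intro set_integral_diff) auto
    ultimately show ?case
      by (subst (asm) set_integrable_cong[OF refl refl, of _ _ "\<lambda>r. V (x + X r \<omega>)"]) auto
  qed
qed

abbreviation action :: "real \<Rightarrow> 'a \<Rightarrow> 'w \<Rightarrow> real" where
  "action t x \<omega> \<equiv> path_integral V t x (traj t \<omega>)"

text \<open>
  Square integrability of the Feynman-Kac weight is what Cauchy-Schwarz needs for \<open>L\<^sup>2\<close> bounds and for
  estimates on rare events.
\<close>
definition short_time :: "real \<Rightarrow> bool" where
  "short_time T \<longleftrightarrow> 0 < T \<and>
     (\<forall>t\<in>{0..T}. \<forall>x. (\<integral>\<^sup>+ \<omega>. (ennreal (exp (- action t x \<omega>)))\<^sup>2 \<partial>M) \<le> 2)"

theorem short_time_exists: "\<exists>T. short_time T"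
proof -
  let ?W = "\<lambda>y. max (- V y) 0" and ?W2 = "\<lambda>y. 2 * max (- V y) 0"
  let ?U = "\<lambda>y. ennreal \<bar>?W y\<bar>"
  have "?W \<in> kato_class M X" using kato by (simp add: kato_decomposable_def)
  then obtain T where T: "0 < T" "\<And>x. occupation ?U T x \<le> ennreal (1/4)"
    using kato_classD[of ?W "1/4"] by auto
  have "(\<integral>\<^sup>+ \<omega>. (ennreal (exp (- action t x \<omega>)))\<^sup>2 \<partial>M) \<le> 2" if t: "t \<in> {0..T}" for t x
  proof -
    have t0: "0 \<le> t" using t by simp
    have occ: "occupation (\<lambda>y. ennreal (?W2 y)) t y \<le> ennreal (1/2)" for y
    proof -
      have "occupation (\<lambda>y. ennreal (?W2 y)) t y = occupation (\<lambda>y. ennreal 2 * ennreal \<bar>?W y\<bar>) t y"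
      proof -
        have "ennreal (?W2 z) = ennreal 2 * ennreal \<bar>?W z\<bar>" for z
          by (subst ennreal_mult[symmetric]) auto
        then show ?thesis by (simp only:)
      qed
      also have "\<dots> = ennreal 2 * occupation ?U t y"
      proof -
        have m: "(\<lambda>y. ennreal \<bar>?W y\<bar>) \<in> borel_measurable borel" by measurable
        have "nn_path_integral (\<lambda>y. ennreal 2 * ennreal \<bar>?W y\<bar>) t y (traj t \<omega>)
            = ennreal 2 * nn_path_integral ?U t y (traj t \<omega>)" if \<omega>: "\<omega> \<in> space M" for \<omega>
        proof -
          obtain Y where Y [measurable]: "Y \<in> borel_measurable borel" and XY: "\<And>r. r \<in> {0..t} \<Longrightarrow> X r \<omega> = Y r"
            using borel_sample_path[OF \<omega>, of t] t by auto
          have "nn_path_integral g t y (traj t \<omega>) = (\<integral>\<^sup>+ r. g (y + Y r) * indicator {0..t} r \<partial>lborel)" for g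
            unfolding nn_path_integral_traj[OF \<omega>] by (intro nn_integral_cong) (auto simp: indicator_def XY)
          then show ?thesis by (simp add: nn_integral_cmult[symmetric] mult.assoc)
        qed
        then show ?thesis
          unfolding occupation_eq_traj using t m
          by (subst nn_integral_cmult[symmetric]) (auto intro!: nn_integral_cong measurable_nn_path_integral')
      qed
      also have "\<dots> \<le> ennreal 2 * ennreal (1/4)"
        using occupation_mono[of t T] t T(2) by (intro mult_left_mono) (auto intro: order_trans)
      also have "\<dots> = ennreal (1/2)" by (subst ennreal_mult[symmetric]) auto
      finally show ?thesis .
    qed
    have "(\<integral>\<^sup>+ \<omega>. (ennreal (exp (- action t x \<omega>)))\<^sup>2 \<partial>M) \<le> exp_moment ?W2 t x"
      unfolding exp_moment_def
    proof (rule nn_integral_mono_AE)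
      show "AE \<omega> in M. (ennreal (exp (- action t x \<omega>)))\<^sup>2 \<le> ennreal (exp (path_integral ?W2 t x (traj t \<omega>)))"
        using potential_AE_integrable[OF t0, of x] negative_part_AE_integrable[OF t0, of x] AE_space
      proof eventually_elim
        case (elim \<omega>)
        let ?m = "LINT r:{0..t}|lborel. max (- V (x + X r \<omega>)) 0"
        have "(LINT r:{0..t}|lborel. (-1) * V (x + X r \<omega>)) \<le> ?m"
          using elim by (intro set_integral_mono set_integrable_mult_right) auto
        then have "(-1) * (LINT r:{0..t}|lborel. V (x + X r \<omega>)) \<le> ?m"
          by (simp only: set_integral_mult_right)
        moreover have "path_integral ?W2 t x (traj t \<omega>) = 2 * ?m"
          by (simp only: path_integral_path[OF elim(3)] set_integral_mult_right)
        ultimately have "2 * (- action t x \<omega>) \<le> path_integral ?W2 t x (traj t \<omega>)"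
          by (simp add: path_integral_path[OF elim(3)])
        then show ?case by (simp add: power2_eq_square ennreal_mult[symmetric] exp_add[symmetric] ennreal_leI)
      qed
    qed
    also have "\<dots> \<le> ennreal (1 / (1 - 1/2))"
      using t by (intro khasminskii occ) auto
    finally show ?thesis by simp
  qed
  then show ?thesis using T(1) unfolding short_time_def by blast
qed

text \<open>
  The Feynman-Kac operator with values in \<open>[0, \<infinity>]\<close>. Restricting to nonnegative functions makes Fubini and the
  Markov property available without integrability conditions.
\<close>
definition fk :: "real \<Rightarrow> ('a \<Rightarrow> ennreal) \<Rightarrow> 'a \<Rightarrow> ennreal" where
  "fk t f x = (\<integral>\<^sup>+ \<omega>. ennreal (exp (- action t x \<omega>)) * f (x + X t \<omega>) \<partial>M)"

lemma fk_measurable [measurable]: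
  assumes [measurable]: "f \<in> borel_measurable borel" and t: "0 \<le> t"
  shows "fk t f \<in> borel_measurable borel"
proof -
  note [measurable] = measurable_X[OF t]
  show ?thesis unfolding fk_def using t by measurable
qed

lemma fk_mono: "(\<And>y. f y \<le> g y) \<Longrightarrow> fk t f x \<le> fk t g x"
  unfolding fk_def by (intro nn_integral_mono mult_left_mono) auto

lemma fk_add:
  assumes [measurable]: "f \<in> borel_measurable borel" "g \<in> borel_measurable borel" and t: "0 \<le> t"
  shows "fk t (\<lambda>y. f y + g y) x = fk t f x + fk t g x"
proof -
  note [measurable] = measurable_X[OF t]
  show ?thesis unfolding fk_def distrib_left using t by (intro nn_integral_add) measurable
qed

lemma fk_cmult:
  assumes [measurable]: "f \<in> borel_measurable borel" and t: "0 \<le> t"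
  shows "fk t (\<lambda>y. c * f y) x = c * fk t f x"
proof -
  note [measurable] = measurable_X[OF t]
  show ?thesis unfolding fk_def
    using t by (subst nn_integral_cmult[symmetric]) (auto simp: ac_simps)
qed

lemma fk_0: "fk 0 f x = f x"
proof -
  have "action 0 x \<omega> = 0" for \<omega>
  proof -
    have "path_integral V 0 x (traj 0 \<omega>) = (LINT (r::real)|lborel. (0::real))"
      unfolding path_integral_def set_lebesgue_integral_def
    proof (rule Bochner_Integration.integral_cong_AE)
      have "(\<lambda>r. indicator {0..0} r *\<^sub>R V (x + right_val 0 (traj 0 \<omega>) r)) = (\<lambda>r. V (x + right_val 0 (traj 0 \<omega>) 0) * indicator {0} r)"
        by (auto simp: indicator_def)
      then show "(\<lambda>r. indicator {0..0} r *\<^sub>R V (x + right_val 0 (traj 0 \<omega>) r)) \<in> borel_measurable lborel" by simp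
      show "AE r in lborel. indicator {0..0} r *\<^sub>R V (x + right_val 0 (traj 0 \<omega>) r) = 0"
        using AE_lborel_singleton[of 0] by eventually_elim (simp add: indicator_def)
    qed simp
    then show ?thesis by simp
  qed
  then have "fk 0 f x = (\<integral>\<^sup>+ \<omega>. f x \<partial>M)"
    unfolding fk_def by (intro nn_integral_cong) (simp add: pinned)
  then show ?thesis by (simp add: emeasure_space_1)
qed

theorem fk_semigroup:
  assumes f [measurable]: "f \<in> borel_measurable borel" and a: "0 \<le> a" and b: "0 \<le> b"
  shows "fk (a + b) f x = fk a (fk b f) x"
proof -
  let ?H = "\<lambda>z. ennreal (exp (- path_integral V b (fst z) (snd z))) * f (fst z + snd z b)"
  have ps: "(\<lambda>p. p b :: 'a) \<in> borel_measurable (path_space b)"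
    using b by (auto intro!: measurable_component_singleton)
  note [measurable] = measurable_compose[OF measurable_snd ps]
  have H: "?H \<in> borel_measurable (borel \<Otimes>\<^sub>M path_space b)"
    using b by measurable
  have F: "(\<lambda>p. ennreal (exp (- path_integral V a x p))) \<in> borel_measurable (path_space a)"
    using a by measurable
  have "fk (a + b) f x = (\<integral>\<^sup>+ \<omega>. ennreal (exp (- action a x \<omega>)) * ?H (x + X a \<omega>, future a b \<omega>) \<partial>M)"
    unfolding fk_def
  proof (rule nn_integral_cong_AE)
    have "AE \<omega> in M. set_integrable lborel {0..a + b} (\<lambda>r. V (x + X r \<omega>))"
      using a b by (intro potential_AE_integrable) simp
    then show "AE \<omega> in M. ennreal (exp (- action (a + b) x \<omega>)) * f (x + X (a + b) \<omega>)
        = ennreal (exp (- action a x \<omega>)) * ?H (x + X a \<omega>, future a b \<omega>)"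
      using AE_space
    proof eventually_elim
      case (elim \<omega>)
      have "action (a + b) x \<omega> = action a x \<omega> + path_integral V b (x + X a \<omega>) (future a b \<omega>)"
        by (rule path_integral_split[OF V_measurable elim(2) a b elim(1)])
      moreover have "x + X a \<omega> + future a b \<omega> b = x + X (a + b) \<omega>"
        using b by (simp add: future_def)
      moreover have "ennreal (exp (- (A + B))) = ennreal (exp (- A)) * ennreal (exp (- B))" for A B :: real
        by (simp add: ennreal_mult[symmetric] exp_add[symmetric])
      ultimately show ?case by (simp only: mult.assoc fst_conv snd_conv)
    qed
  qed
  also have "\<dots> = (\<integral>\<^sup>+ \<omega>. ennreal (exp (- action a x \<omega>)) * (\<integral>\<^sup>+ \<omega>'. ?H (x + X a \<omega>, traj b \<omega>') \<partial>M) \<partial>M)"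
    by (rule nn_integral_markov_started[OF a F H])
  also have "\<dots> = fk a (fk b f) x"
    unfolding fk_def using b by (simp add: traj_def)
  finally show ?thesis .
qed

lemma fk_square_le:
  assumes T: "short_time T" "t \<in> {0..T}" and f [measurable]: "f \<in> borel_measurable borel"
  shows "(fk t f x)\<^sup>2 \<le> 2 * (\<integral>\<^sup>+ \<omega>. (f (x + X t \<omega>))\<^sup>2 \<partial>M)"
proof -
  have t: "0 \<le> t" using T by simp
  note [measurable] = measurable_X[OF t]
  have "(fk t f x)\<^sup>2 \<le> (\<integral>\<^sup>+ \<omega>. (ennreal (exp (- action t x \<omega>)))\<^sup>2 \<partial>M) * (\<integral>\<^sup>+ \<omega>. (f (x + X t \<omega>))\<^sup>2 \<partial>M)"
    unfolding fk_def using t by (intro Cauchy_Schwarz_nn_integral) measurable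
  also have "\<dots> \<le> 2 * (\<integral>\<^sup>+ \<omega>. (f (x + X t \<omega>))\<^sup>2 \<partial>M)"
    using T by (intro mult_right_mono) (auto simp: short_time_def)
  finally show ?thesis .
qed

text \<open>
  Cauchy-Schwarz reduces the claim to the free process, whose transition operators preserve Lebesgue integrals
  because they are averages of translations.
\<close>
lemma fk_L2_bound:
  assumes T: "short_time T" "t \<in> {0..T}" and f [measurable]: "f \<in> borel_measurable borel"
  shows "(\<integral>\<^sup>+ x. (fk t f x)\<^sup>2 \<partial>lborel) \<le> 2 * (\<integral>\<^sup>+ x. (f x)\<^sup>2 \<partial>lborel)"
proof -
  have t: "0 \<le> t" using T by simp
  note [measurable] = measurable_X[OF t]
  interpret pair_sigma_finite "lborel :: 'a measure" M ..
  have "(\<integral>\<^sup>+ x. (fk t f x)\<^sup>2 \<partial>lborel) \<le> (\<integral>\<^sup>+ x. 2 * (\<integral>\<^sup>+ \<omega>. (f (x + X t \<omega>))\<^sup>2 \<partial>M) \<partial>lborel)"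
    by (intro nn_integral_mono fk_square_le[OF T f])
  also have "\<dots> = 2 * (\<integral>\<^sup>+ x. \<integral>\<^sup>+ \<omega>. (f (x + X t \<omega>))\<^sup>2 \<partial>M \<partial>lborel)"
    by (intro nn_integral_cmult) measurable
  also have "(\<integral>\<^sup>+ x. \<integral>\<^sup>+ \<omega>. (f (x + X t \<omega>))\<^sup>2 \<partial>M \<partial>lborel) = (\<integral>\<^sup>+ \<omega>. \<integral>\<^sup>+ x. (f (x + X t \<omega>))\<^sup>2 \<partial>lborel \<partial>M)"
    by (rule Fubini'[symmetric]) measurable
  also have "\<dots> = (\<integral>\<^sup>+ \<omega>. \<integral>\<^sup>+ x. (f x)\<^sup>2 \<partial>lborel \<partial>M)"
  proof (rule nn_integral_cong)
    fix \<omega>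
    have "(\<integral>\<^sup>+ x. (f x)\<^sup>2 \<partial>lborel) = (\<integral>\<^sup>+ x. (f x)\<^sup>2 \<partial>distr lborel borel ((+) (X t \<omega>)))"
      by (simp add: lborel_distr_plus)
    also have "\<dots> = (\<integral>\<^sup>+ x. (f (X t \<omega> + x))\<^sup>2 \<partial>lborel)"
      by (subst nn_integral_distr) auto
    finally show "(\<integral>\<^sup>+ x. (f (x + X t \<omega>))\<^sup>2 \<partial>lborel) = (\<integral>\<^sup>+ x. (f x)\<^sup>2 \<partial>lborel)"
      by (simp add: add.commute)
  qed
  also have "\<dots> = (\<integral>\<^sup>+ x. (f x)\<^sup>2 \<partial>lborel)" by (simp add: emeasure_space_1)
  finally show ?thesis .
qed

lemma fk_finite:
  assumes T: "short_time T" "t \<in> {0..T}" and f [measurable]: "f \<in> borel_measurable borel"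
    and B: "\<And>y. f y \<le> ennreal B"
  shows "fk t f x < \<infinity>"
proof -
  have "(fk t f x)\<^sup>2 \<le> 2 * (\<integral>\<^sup>+ \<omega>. (f (x + X t \<omega>))\<^sup>2 \<partial>M)" by (rule fk_square_le[OF T f])
  also have "\<dots> \<le> 2 * (\<integral>\<^sup>+ \<omega>. (ennreal B)\<^sup>2 \<partial>M)"
    by (intro mult_left_mono nn_integral_mono power_mono B) auto
  also have "\<dots> < \<infinity>" by (simp add: emeasure_space_1 ennreal_mult_less_top power2_eq_square)
  finally show ?thesis by (cases "fk t f x") (auto simp: power2_eq_square ennreal_mult_less_top top.not_eq_extremum)
qed

lemma feynman_kac_eq_fk:
  assumes g [measurable]: "g \<in> borel_measurable borel" and pos: "\<And>y. 0 \<le> g y" and t: "0 \<le> t"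
  shows "feynman_kac M X V t (\<lambda>y. complex_of_real (g y)) x = complex_of_real (enn2real (fk t (\<lambda>y. ennreal (g y)) x))"
proof -
  note [measurable] = measurable_X[OF t]
  have "feynman_kac M X V t (\<lambda>y. complex_of_real (g y)) x
      = (CLINT \<omega>|M. complex_of_real (exp (- action t x \<omega>) * g (x + X t \<omega>)))"
    unfolding feynman_kac_def by (intro Bochner_Integration.integral_cong) (simp_all add: path_integral_path)
  also have "\<dots> = complex_of_real (LINT \<omega>|M. exp (- action t x \<omega>) * g (x + X t \<omega>))"
    by (rule integral_complex_of_real)
  also have "(LINT \<omega>|M. exp (- action t x \<omega>) * g (x + X t \<omega>)) = enn2real (fk t (\<lambda>y. ennreal (g y)) x)"
    unfolding fk_def using t pos
    by (subst integral_eq_nn_integral) (auto simp: ennreal_mult)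
  finally show ?thesis .
qed

end

section \<open>Eigenfunctions of the generator\<close>

lemma sum_power2_ennreal_le:
  fixes z :: "nat \<Rightarrow> ennreal"
  shows "(\<Sum>k<n. z k)\<^sup>2 \<le> of_nat n * (\<Sum>k<n. (z k)\<^sup>2)"
  using Cauchy_Schwarz_nn_integral[of "\<lambda>_. 1" "count_space {..<n}" z]
  by (simp add: nn_integral_count_space_finite)

lemma ennreal_abs_diff_le:
  fixes u v :: real
  assumes "0 \<le> u" "0 \<le> v" "ennreal u \<le> ennreal v + z" "ennreal v \<le> ennreal u + z"
  shows "ennreal \<bar>u - v\<bar> \<le> z"
  using assms by (cases z) (auto simp: abs_le_iff simp flip: ennreal_plus)

lemma ennreal_le_plusI: "a \<le> b + c \<Longrightarrow> 0 \<le> b \<Longrightarrow> 0 \<le> c \<Longrightarrow> ennreal a \<le> ennreal b + ennreal c"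
  by (metis ennreal_leI ennreal_plus)

lemma eigen_expansion_limit:
  fixes l :: real
  shows "((\<lambda>h. ((exp (l * h) * (1 - h * l) - 1) / h)\<^sup>2) \<longlongrightarrow> 0) (at_right 0)"
proof -
  have "((\<lambda>h. exp (l * h) * (1 - h * l)) has_real_derivative 0) (at 0)"
    by (rule derivative_eq_intros refl | simp)+
  then have "((\<lambda>h. (exp (l * h) * (1 - h * l) - 1) / h) \<longlongrightarrow> 0) (at 0)"
    by (simp add: DERIV_def)
  then have "((\<lambda>h. (exp (l * h) * (1 - h * l) - 1) / h) \<longlongrightarrow> 0) (at_right 0)"
    by (rule tendsto_mono[OF at_le, rotated]) simp
  from tendsto_power[OF this, of 2] show ?thesis by simp
qed

context schrodinger_potential
begin

definition fkr :: "real \<Rightarrow> ('a \<Rightarrow> real) \<Rightarrow> 'a \<Rightarrow> real" where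
  "fkr t f x = enn2real (fk t (\<lambda>y. ennreal (f y)) x)"

context
  fixes T :: real and \<phi> :: "'a \<Rightarrow> real" and B l :: real
  assumes T: "short_time T" and \<phi>_meas [measurable]: "\<phi> \<in> borel_measurable borel"
    and \<phi>: "\<And>y. 0 \<le> \<phi> y" "\<And>y. \<phi> y \<le> B"
begin

lemma ennreal_fkr: "t \<in> {0..T} \<Longrightarrow> ennreal (fkr t \<phi> x) = fk t (\<lambda>y. ennreal (\<phi> y)) x"
  unfolding fkr_def using fk_finite[OF T, of t "\<lambda>y. ennreal (\<phi> y)" B x] \<phi>
  by (simp add: ennreal_leI)

lemma fkr_measurable [measurable]: "0 \<le> t \<Longrightarrow> fkr t \<phi> \<in> borel_measurable borel"
  unfolding fkr_def by measurable

lemma fkr_nonneg: "0 \<le> fkr t \<phi> x" by (simp add: fkr_def)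

definition defect :: "real \<Rightarrow> 'a \<Rightarrow> ennreal" where
  "defect t x = ennreal \<bar>exp (l * t) * fkr t \<phi> x - \<phi> x\<bar>"

lemma defect_measurable [measurable]: "0 \<le> t \<Longrightarrow> defect t \<in> borel_measurable borel"
  unfolding defect_def by measurable

text \<open>
  By the semigroup property the two terms differ, up to the factor \<open>exp (l * a)\<close>, by the operator at time \<open>a\<close>
  applied to \<open>exp (l * h) * fkr h \<phi> - \<phi>\<close>, and the operator is positive.
\<close>
lemma defect_step:
  assumes a: "0 \<le> a" and h: "0 \<le> h" and ah: "a + h \<le> T"
  shows "ennreal \<bar>exp (l * (a + h)) * fkr (a + h) \<phi> x - exp (l * a) * fkr a \<phi> x\<bar>
      \<le> ennreal (exp (l * a)) * fk a (defect h) x"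
proof -
  let ?\<phi> = "\<lambda>y. ennreal (\<phi> y)" and ?q = "\<lambda>y. ennreal (exp (l * h) * fkr h \<phi> y)"
  have [measurable]: "defect h \<in> borel_measurable borel" "fkr h \<phi> \<in> borel_measurable borel" using h by simp_all
  have "ennreal (exp (l * h) * fkr (a + h) \<phi> x) = ennreal (exp (l * h)) * fk a (fk h ?\<phi>) x"
    using a h ah ennreal_fkr[of "a + h" x] fk_semigroup[of ?\<phi> a h x] by (simp add: ennreal_mult fkr_nonneg)
  also have "fk h ?\<phi> = (\<lambda>y. ennreal (fkr h \<phi> y))" using a h ah by (auto simp: ennreal_fkr)
  also have "ennreal (exp (l * h)) * fk a (\<lambda>y. ennreal (fkr h \<phi> y)) x = fk a ?q x"
    using a h by (subst fk_cmult[symmetric]) (auto simp: ennreal_mult fkr_nonneg)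
  finally have q: "ennreal (exp (l * h) * fkr (a + h) \<phi> x) = fk a ?q x" .
  have p: "ennreal (fkr a \<phi> x) = fk a ?\<phi> x" using a h ah by (simp add: ennreal_fkr)
  have "?q y \<le> ?\<phi> y + defect h y" for y
    unfolding defect_def using \<phi> fkr_nonneg by (intro ennreal_le_plusI) auto
  then have 1: "fk a ?q x \<le> fk a ?\<phi> x + fk a (defect h) x"
    using fk_mono[of ?q "\<lambda>y. ?\<phi> y + defect h y" a x] a by (subst fk_add[symmetric]) auto
  have "?\<phi> y \<le> ?q y + defect h y" for y
    unfolding defect_def using \<phi> fkr_nonneg by (intro ennreal_le_plusI) auto
  then have 2: "fk a ?\<phi> x \<le> fk a ?q x + fk a (defect h) x"
    using fk_mono[of ?\<phi> "\<lambda>y. ?q y + defect h y" a x] a by (subst fk_add[symmetric]) auto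
  have "ennreal \<bar>exp (l * h) * fkr (a + h) \<phi> x - fkr a \<phi> x\<bar> \<le> fk a (defect h) x"
    using 1 2 unfolding q[symmetric] p[symmetric] by (intro ennreal_abs_diff_le) (auto simp: fkr_nonneg)
  then have "ennreal (exp (l * a)) * ennreal \<bar>exp (l * h) * fkr (a + h) \<phi> x - fkr a \<phi> x\<bar>
      \<le> ennreal (exp (l * a)) * fk a (defect h) x" by (rule mult_left_mono) simp
  moreover have "exp (l * (a + h)) * fkr (a + h) \<phi> x - exp (l * a) * fkr a \<phi> x
      = exp (l * a) * (exp (l * h) * fkr (a + h) \<phi> x - fkr a \<phi> x)"
    by (simp add: algebra_simps exp_add)
  ultimately show ?thesis by (simp add: abs_mult ennreal_mult)
qed

lemma defect_telescope:
  assumes h: "0 \<le> h" and nh: "real n * h \<le> T"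
  shows "defect (real n * h) x \<le> (\<Sum>k<n. ennreal (exp (\<bar>l\<bar> * T)) * fk (real k * h) (defect h) x)"
  using nh
proof (induction n)
  case 0
  have "fkr 0 \<phi> x = \<phi> x" using \<phi> by (simp add: fkr_def fk_0)
  then show ?case by (simp add: defect_def)
next
  case (Suc n)
  let ?a = "real n * h"
  have a: "0 \<le> ?a" "?a + h \<le> T" "?a \<le> T" using h Suc.prems by (auto simp: algebra_simps)
  have "l * ?a \<le> \<bar>l\<bar> * T"
    using a by (intro mult_mono) auto
  then have e: "ennreal (exp (l * ?a)) \<le> ennreal (exp (\<bar>l\<bar> * T))" by (intro ennreal_leI) simp
  have "defect (real (Suc n) * h) x = defect (?a + h) x" by (simp add: algebra_simps)
  also have "\<dots> \<le> defect ?a x + ennreal \<bar>exp (l * (?a + h)) * fkr (?a + h) \<phi> x - exp (l * ?a) * fkr ?a \<phi> x\<bar>"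
    unfolding defect_def by (intro ennreal_le_plusI) auto
  also have "\<dots> \<le> (\<Sum>k<n. ennreal (exp (\<bar>l\<bar> * T)) * fk (real k * h) (defect h) x)
      + ennreal (exp (l * ?a)) * fk ?a (defect h) x"
    by (intro add_mono Suc.IH defect_step a h)
  also have "\<dots> \<le> (\<Sum>k<Suc n. ennreal (exp (\<bar>l\<bar> * T)) * fk (real k * h) (defect h) x)"
    using e by (auto intro!: add_left_mono mult_right_mono)
  finally show ?case .
qed

lemma defect_L2_le:
  assumes h: "0 \<le> h" and nh: "real n * h \<le> T"
  shows "(\<integral>\<^sup>+ x. (defect (real n * h) x)\<^sup>2 \<partial>lborel)
      \<le> ennreal (2 * exp (\<bar>l\<bar> * T) ^ 2 * (real n)\<^sup>2) * (\<integral>\<^sup>+ x. (defect h x)\<^sup>2 \<partial>lborel)"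
proof -
  let ?c = "ennreal (exp (\<bar>l\<bar> * T))" and ?D = "\<integral>\<^sup>+ x. (defect h x)\<^sup>2 \<partial>lborel"
  have [measurable]: "defect h \<in> borel_measurable borel" using h by simp
  have [measurable]: "fk (real k * h) (defect h) \<in> borel_measurable borel" for k
    using h by (intro fk_measurable) auto
  have "(\<integral>\<^sup>+ x. (defect (real n * h) x)\<^sup>2 \<partial>lborel)
      \<le> (\<integral>\<^sup>+ x. of_nat n * (\<Sum>k<n. ?c\<^sup>2 * (fk (real k * h) (defect h) x)\<^sup>2) \<partial>lborel)"
  proof (rule nn_integral_mono)
    fix x
    have "(defect (real n * h) x)\<^sup>2 \<le> (\<Sum>k<n. ?c * fk (real k * h) (defect h) x)\<^sup>2"
      by (intro power_mono defect_telescope h nh) simp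
    also have "\<dots> \<le> of_nat n * (\<Sum>k<n. (?c * fk (real k * h) (defect h) x)\<^sup>2)"
      by (rule sum_power2_ennreal_le)
    finally show "(defect (real n * h) x)\<^sup>2 \<le> of_nat n * (\<Sum>k<n. ?c\<^sup>2 * (fk (real k * h) (defect h) x)\<^sup>2)"
      by (simp only: power_mult_distrib)
  qed
  also have "\<dots> = of_nat n * (\<Sum>k<n. ?c\<^sup>2 * (\<integral>\<^sup>+ x. (fk (real k * h) (defect h) x)\<^sup>2 \<partial>lborel))"
    by (simp add: nn_integral_cmult nn_integral_sum)
  also have "\<dots> \<le> of_nat n * (\<Sum>k<n. ?c\<^sup>2 * (2 * ?D))"
  proof (intro mult_left_mono sum_mono)
    fix k assume "k \<in> {..<n}"
    then have "real k * h \<le> real n * h" using h by (intro mult_right_mono) auto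
    then show "(\<integral>\<^sup>+ x. (fk (real k * h) (defect h) x)\<^sup>2 \<partial>lborel) \<le> 2 * ?D"
      using h nh by (intro fk_L2_bound[OF T]) auto
  qed auto
  also have "\<dots> = ennreal (2 * exp (\<bar>l\<bar> * T) ^ 2 * (real n)\<^sup>2) * ?D"
    by (simp add: ennreal_mult power2_eq_square ennreal_of_nat_eq_real_of_nat ac_simps)
  finally show ?thesis .
qed

text \<open>
  With \<open>r\<close> the error in the difference quotient, \<open>fkr h \<phi> = (1 - h * l) * \<phi> - h * r\<close>. If \<open>\<phi>\<close> is
  square integrable and \<open>r\<close> tends to \<open>0\<close> in \<open>L\<^sup>2\<close>, then both terms on the right are \<open>o(h\<^sup>2)\<close>.
\<close>
lemma defect_infinitesimal:
  assumes h: "0 < h" "h \<le> T"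
  shows "(\<integral>\<^sup>+ x. (defect h x)\<^sup>2 \<partial>lborel)
     \<le> ennreal (2 * (exp (l * h) * (1 - h * l) - 1)\<^sup>2) * (\<integral>\<^sup>+ x. ennreal ((\<phi> x)\<^sup>2) \<partial>lborel)
     + ennreal (2 * h\<^sup>2 * (exp (l * h))\<^sup>2) * (\<integral>\<^sup>+ x. ennreal (((\<phi> x - fkr h \<phi> x) / h - l * \<phi> x)\<^sup>2) \<partial>lborel)"
proof -
  have [measurable]: "fkr h \<phi> \<in> borel_measurable borel" using h by simp
  let ?e = "exp (l * h) * (1 - h * l) - 1" and ?r = "\<lambda>x. (\<phi> x - fkr h \<phi> x) / h - l * \<phi> x"
  have sq: "(a - b)\<^sup>2 \<le> 2 * a\<^sup>2 + 2 * b\<^sup>2" for a b :: real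
    using zero_le_power2[of "a + b"] by (simp add: power2_eq_square algebra_simps)
  have expand: "E * q - p = (E * (1 - h * l) - 1) * p - h * E * R" if "q = p - h * l * p - h * R" for q p R E :: real
    unfolding that by (simp add: algebra_simps)
  have "(\<integral>\<^sup>+ x. (defect h x)\<^sup>2 \<partial>lborel)
      \<le> (\<integral>\<^sup>+ x. ennreal (2 * ?e\<^sup>2) * ennreal ((\<phi> x)\<^sup>2) + ennreal (2 * h\<^sup>2 * (exp (l * h))\<^sup>2) * ennreal ((?r x)\<^sup>2) \<partial>lborel)"
  proof (rule nn_integral_mono)
    fix x
    have "fkr h \<phi> x = \<phi> x - h * l * \<phi> x - h * ?r x" using h by (simp add: field_simps)
    then have "exp (l * h) * fkr h \<phi> x - \<phi> x = ?e * \<phi> x - h * exp (l * h) * ?r x"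
      by (rule expand)
    then have "(exp (l * h) * fkr h \<phi> x - \<phi> x)\<^sup>2 \<le> 2 * (?e * \<phi> x)\<^sup>2 + 2 * (h * exp (l * h) * ?r x)\<^sup>2"
      using sq by simp
    also have "\<dots> = 2 * ?e\<^sup>2 * (\<phi> x)\<^sup>2 + 2 * h\<^sup>2 * (exp (l * h))\<^sup>2 * (?r x)\<^sup>2"
      by (simp add: power_mult_distrib)
    finally have "ennreal ((exp (l * h) * fkr h \<phi> x - \<phi> x)\<^sup>2) \<le> ennreal (2 * ?e\<^sup>2 * (\<phi> x)\<^sup>2 + 2 * h\<^sup>2 * (exp (l * h))\<^sup>2 * (?r x)\<^sup>2)"
      by (rule ennreal_leI)
    also have "\<dots> = ennreal (2 * ?e\<^sup>2) * ennreal ((\<phi> x)\<^sup>2) + ennreal (2 * h\<^sup>2 * (exp (l * h))\<^sup>2) * ennreal ((?r x)\<^sup>2)"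
      by (subst ennreal_plus) (auto simp: ennreal_mult')
    finally show "(defect h x)\<^sup>2 \<le> ennreal (2 * ?e\<^sup>2) * ennreal ((\<phi> x)\<^sup>2) + ennreal (2 * h\<^sup>2 * (exp (l * h))\<^sup>2) * ennreal ((?r x)\<^sup>2)"
      by (simp add: defect_def ennreal_power)
  qed
  also have "\<dots> = ennreal (2 * ?e\<^sup>2) * (\<integral>\<^sup>+ x. ennreal ((\<phi> x)\<^sup>2) \<partial>lborel)
      + ennreal (2 * h\<^sup>2 * (exp (l * h))\<^sup>2) * (\<integral>\<^sup>+ x. ennreal ((?r x)\<^sup>2) \<partial>lborel)"
    by (subst nn_integral_add) (auto simp: nn_integral_cmult)
  finally show ?thesis .
qed

text \<open>
  Split \<open>{0..t}\<close> into \<open>n\<close> intervals of length \<open>h\<close>. In \<open>L\<^sup>2\<close> the defect at time \<open>t\<close> is at most a constant times \<open>n\<close>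
  times the defect at time \<open>h\<close>. The latter is \<open>o(h)\<close> by hypothesis and \<open>n = t / h\<close>, so the defect at \<open>t\<close> vanishes.
\<close>
theorem eigenfunction_of_generator:
  assumes L2: "(\<integral>\<^sup>+ x. ennreal ((\<phi> x)\<^sup>2) \<partial>lborel) < \<infinity>"
    and gen: "((\<lambda>h. \<integral>\<^sup>+ x. ennreal (((\<phi> x - fkr h \<phi> x) / h - l * \<phi> x)\<^sup>2) \<partial>lborel) \<longlongrightarrow> 0) (at_right 0)"
    and t: "0 < t" "t \<le> T"
  shows "AE x in lborel. exp (l * t) * fkr t \<phi> x = \<phi> x"
proof -
  define I where "I = (\<integral>\<^sup>+ x. ennreal ((\<phi> x)\<^sup>2) \<partial>lborel)"
  define r where "r h = (\<integral>\<^sup>+ x. ennreal (((\<phi> x - fkr h \<phi> x) / h - l * \<phi> x)\<^sup>2) \<partial>lborel)" for h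
  define e where "e h = ((exp (l * h) * (1 - h * l) - 1) / h)\<^sup>2" for h
  define C where "C = 2 * (exp (\<bar>l\<bar> * T))\<^sup>2"
  have C: "0 \<le> C" by (simp add: C_def)
  have I_fin: "I < \<top>" using L2 by (simp add: I_def)
  let ?D = "\<integral>\<^sup>+ x. (defect t x)\<^sup>2 \<partial>lborel"
  let ?x = "\<lambda>n. ennreal (C * t\<^sup>2 * 2 * e (t / real (Suc n))) * I" and ?xl = "ennreal (C * t\<^sup>2 * 2 * 0) * I"
  let ?y = "\<lambda>n. ennreal (C * t\<^sup>2 * 2 * (exp (l * (t / real (Suc n))))\<^sup>2) * r (t / real (Suc n))"
    and ?yl = "ennreal (C * t\<^sup>2 * 2 * (exp (l * 0))\<^sup>2) * 0"
  have bound: "?D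
      \<le> ?x n + ?y n" for n
  proof -
    define h where "h = t / real (Suc n)"
    have h: "0 < h" "real (Suc n) * h = t" using t by (auto simp: h_def)
    have "1 * h \<le> real (Suc n) * h" using h(1) by (intro mult_right_mono) auto
    then have hT: "h \<le> T" using t(2) unfolding h(2) by simp
    have "?D \<le> ennreal (C * (real (Suc n))\<^sup>2) * (\<integral>\<^sup>+ x. (defect h x)\<^sup>2 \<partial>lborel)"
      using defect_L2_le[of h "Suc n"] h t unfolding C_def by simp
    also have "\<dots> \<le> ennreal (C * (real (Suc n))\<^sup>2) * (ennreal (2 * (exp (l * h) * (1 - h * l) - 1)\<^sup>2) * I
        + ennreal (2 * h\<^sup>2 * (exp (l * h))\<^sup>2) * r h)"
      unfolding I_def r_def by (intro mult_left_mono defect_infinitesimal h hT) simp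
    also have "\<dots> = ennreal (C * (real (Suc n))\<^sup>2 * (2 * (exp (l * h) * (1 - h * l) - 1)\<^sup>2)) * I
        + ennreal (C * (real (Suc n))\<^sup>2 * (2 * h\<^sup>2 * (exp (l * h))\<^sup>2)) * r h"
      using C by (simp add: distrib_left ennreal_mult mult.assoc)
    also have "C * (real (Suc n))\<^sup>2 * (2 * (exp (l * h) * (1 - h * l) - 1)\<^sup>2) = C * t\<^sup>2 * 2 * e h"
      using h(1) unfolding h(2)[symmetric] e_def by (simp add: power_mult_distrib power_divide)
    also have "C * (real (Suc n))\<^sup>2 * (2 * h\<^sup>2 * (exp (l * h))\<^sup>2) = C * t\<^sup>2 * 2 * (exp (l * h))\<^sup>2"
      unfolding h(2)[symmetric] by (simp add: power_mult_distrib)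
    finally show ?thesis unfolding h_def .
  qed
  have h0: "(\<lambda>n. t / real (Suc n)) \<longlonglongrightarrow> 0" by (intro LIMSEQ_Suc[OF lim_const_over_n])
  then have hr: "filterlim (\<lambda>n. t / real (Suc n)) (at_right 0) sequentially"
    using t by (auto simp: filterlim_at)
  have "(\<lambda>n. e (t / real (Suc n))) \<longlonglongrightarrow> 0"
    unfolding e_def by (rule filterlim_compose[OF eigen_expansion_limit hr])
  then have "(\<lambda>n. ?x n) \<longlonglongrightarrow> ?xl"
    using I_fin by (intro tendsto_mult_ennreal tendsto_const tendsto_ennrealI tendsto_mult) auto
  moreover have "(\<lambda>n. ?y n)
      \<longlonglongrightarrow> ?yl"
  proof (intro tendsto_mult_ennreal)
    show "(\<lambda>n. ennreal (C * t\<^sup>2 * 2 * (exp (l * (t / real (Suc n))))\<^sup>2)) \<longlonglongrightarrow> ennreal (C * t\<^sup>2 * 2 * (exp (l * 0))\<^sup>2)"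
      using h0 by (intro tendsto_intros)
    show "(\<lambda>n. r (t / real (Suc n))) \<longlonglongrightarrow> 0"
      unfolding r_def by (rule filterlim_compose[OF gen hr])
  qed auto
  ultimately have "(\<lambda>n. ?x n
      + ?y n)
      \<longlonglongrightarrow> ?xl + ?yl"
    by (rule tendsto_add)
  then have "?D
      \<le> ?xl + ?yl"
    using bound by (intro LIMSEQ_le_const) auto
  then have "?D = 0" by simp
  then have "AE x in lborel. (defect t x)\<^sup>2 = 0"
    using t by (subst (asm) nn_integral_0_iff_AE) auto
  then show ?thesis by eventually_elim (simp add: defect_def)
qed

end

end

section \<open>Polynomial decay of eigenfunctions\<close>

lemma AE_lborel_meets_open:
  fixes U :: "'a::euclidean_space set"
  assumes U: "open U" "U \<noteq> {}" and P: "AE x in lborel. P x"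
  shows "\<exists>x\<in>U. P x"
proof (rule ccontr)
  assume "\<not> ?thesis"
  then have "AE x in lborel. x \<notin> U" using P by (auto elim: eventually_mono)
  then have "U \<in> null_sets lborel" using U(1) by (subst AE_iff_null_sets) auto
  then have "negligible U" by (simp add: negligible_iff_null_sets null_sets_completionI)
  then show False using open_not_negligible U by blast
qed

lemma AE_le_imp_le_on_open:
  fixes f :: "'a::euclidean_space \<Rightarrow> real"
  assumes cont: "continuous_on UNIV f" and U: "open U" and le: "AE x in lborel. x \<in> U \<longrightarrow> f x \<le> b" and x: "x \<in> U"
  shows "f x \<le> b"
proof (rule ccontr)
  assume "\<not> f x \<le> b"
  define A where "A = U \<inter> f -` {b<..}"
  have "open A" unfolding A_def using cont U by (intro open_Int open_vimage) auto
  moreover have "x \<in> A" using \<open>\<not> f x \<le> b\<close> x by (simp add: A_def)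
  moreover have "AE x in lborel. x \<notin> A" using le by eventually_elim (auto simp: A_def)
  ultimately show False using AE_lborel_meets_open by blast
qed

lemma square_le_imp_le_sqrt: "y\<^sup>2 \<le> ennreal q \<Longrightarrow> 0 \<le> q \<Longrightarrow> y \<le> ennreal (sqrt q)"
  by (cases y) (auto simp: ennreal_power ennreal_le_iff real_le_rsqrt top_power_ennreal top_unique intro: ennreal_leI)

context schrodinger_potential
begin

text \<open>
  Paths that move by at most \<open>norm x / 2\<close> remain outside the ball of radius \<open>r\<close>; they contribute at most
  \<open>exp (- T * m) * c\<close>. The remaining paths are rare, and Cauchy-Schwarz trades half of the decay exponent of their
  probability against the second moment of the weight.
\<close>
lemma fk_far_le:
  assumes T: "short_time T" and f: "f \<in> borel_measurable borel" and B: "\<And>y. 0 \<le> f y" "\<And>y. f y \<le> B"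
    and far: "\<And>y. r < norm y \<Longrightarrow> f y \<le> c" "\<And>y. r < norm y \<Longrightarrow> m \<le> V y" and c: "0 \<le> c"
    and r: "0 < r" and x: "2 * r < norm x"
  shows "fk T (\<lambda>y. ennreal (f y)) x
      \<le> ennreal (exp (- T * m) * c + B * sqrt (4 * tail_const * T * (r / 2) powr - \<alpha>))"
proof -
  note [measurable] = f
  have T0: "0 < T" using T by (simp add: short_time_def)
  have Bpos: "0 \<le> B" using B order_trans by blast
  note [measurable] = measurable_X[OF less_imp_le[OF T0]]
  define E where "E = {\<omega> \<in> space M. \<exists>s\<in>{0..T}. norm x / 2 < norm (X s \<omega>)}"
  have E [measurable]: "E \<in> sets M" unfolding E_def using T0 by (intro measurable_exceedance) simp
  let ?w = "\<lambda>\<omega>. ennreal (exp (- action T x \<omega>)) * indicator E \<omega>"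
  let ?W = "\<integral>\<^sup>+ \<omega>. ?w \<omega> \<partial>M" and ?G = "\<integral>\<^sup>+ \<omega>. (ennreal (exp (- action T x \<omega>)))\<^sup>2 \<partial>M"
  let ?q = "4 * tail_const * T * (r / 2) powr - \<alpha>"
  have q: "0 \<le> ?q" using tail_const_pos T0 by simp
  have PE: "prob E \<le> 2 * tail_const * T * (r / 2) powr - \<alpha>"
  proof -
    have "prob E \<le> 2 * tail_const * T * (norm x / 2 / 2) powr - \<alpha>"
      unfolding E_def using r x T0 by (intro prob_exceedance_le) auto
    also have "\<dots> \<le> 2 * tail_const * T * (r / 2) powr - \<alpha>"
      using r x T0 tail_const_pos index by (intro mult_left_mono powr_mono2') auto
    finally show ?thesis .
  qed
  have far_E: "?W \<le> ennreal (sqrt ?q)"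
  proof (rule square_le_imp_le_sqrt[OF _ q])
    have "?W\<^sup>2
        \<le> ?G * (\<integral>\<^sup>+ \<omega>. (indicator E \<omega>)\<^sup>2 \<partial>M)"
      using T0 by (intro Cauchy_Schwarz_nn_integral) measurable
    also have "(\<integral>\<^sup>+ \<omega>. (indicator E \<omega>)\<^sup>2 \<partial>M) = (\<integral>\<^sup>+ \<omega>. indicator E \<omega> \<partial>M)"
      by (intro nn_integral_cong) (auto simp: indicator_def)
    also have "?G * (\<integral>\<^sup>+ \<omega>. indicator E \<omega> \<partial>M)
        \<le> 2 * ennreal (2 * tail_const * T * (r / 2) powr - \<alpha>)"
      using T T0 PE by (intro mult_mono) (auto simp: short_time_def emeasure_eq_measure intro!: ennreal_leI)
    also have "\<dots> = ennreal (2 * (2 * tail_const * T * (r / 2) powr - \<alpha>))"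
      using tail_const_pos T0 by (subst ennreal_mult) auto
    also have "2 * (2 * tail_const * T * (r / 2) powr - \<alpha>) = ?q" by simp
    finally show "?W\<^sup>2 \<le> ennreal ?q" .
  qed
  have "fk T (\<lambda>y. ennreal (f y)) x
      \<le> (\<integral>\<^sup>+ \<omega>. ennreal (exp (- T * m) * c) + ennreal B * (?w \<omega>) \<partial>M)"
    unfolding fk_def
  proof (rule nn_integral_mono_AE)
    have "AE \<omega> in M. set_integrable lborel {0..T} (\<lambda>r. V (x + X r \<omega>))"
      using T0 by (intro potential_AE_integrable) simp
    then show "AE \<omega> in M. ennreal (exp (- action T x \<omega>)) * ennreal (f (x + X T \<omega>))
      \<le> ennreal (exp (- T * m) * c) + ennreal B * (?w \<omega>)"
      using AE_space
    proof eventually_elim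
      case (elim \<omega>)
      show ?case
      proof (cases "\<omega> \<in> E")
        case True
        have "ennreal (exp (- action T x \<omega>)) * ennreal (f (x + X T \<omega>)) \<le> ennreal B * (ennreal (exp (- action T x \<omega>)))"
          using B(2) by (subst mult.commute) (intro mult_right_mono ennreal_leI, auto)
        then show ?thesis using True by (simp add: add_increasing)
      next
        case False
        have outside: "r < norm (x + X s \<omega>)" if "s \<in> {0..T}" for s
        proof -
          have "norm (X s \<omega>) \<le> norm x / 2" using False that elim(2) by (auto simp: E_def not_less)
          then show ?thesis using x norm_diff_ineq[of x "X s \<omega>"] by linarith
        qed
        have "(LINT s:{0..T}|lborel. m) \<le> (LINT s:{0..T}|lborel. V (x + X s \<omega>))"
          using elim(1) far(2) outside
          by (intro set_integral_mono) (auto simp: set_integrable_def integrable_indicator_iff emeasure_lborel_Icc_eq)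
        then have "T * m \<le> action T x \<omega>"
          using T0 by (simp add: path_integral_path[OF elim(2)] set_lebesgue_integral_def)
        then have "exp (- action T x \<omega>) * f (x + X T \<omega>) \<le> exp (- T * m) * c"
          using far(1)[OF outside[of T]] T0 B(1) by (intro mult_mono) auto
        then have "ennreal (exp (- action T x \<omega>) * f (x + X T \<omega>)) \<le> ennreal (exp (- T * m) * c)"
          by (rule ennreal_leI)
        then show ?thesis using False B(1) by (simp add: ennreal_mult)
      qed
    qed
  qed
  also have "\<dots> = ennreal (exp (- T * m) * c) + ennreal B * ?W"
    using T0 by (subst nn_integral_add) (auto simp: nn_integral_cmult emeasure_space_1)
  also have "\<dots> \<le> ennreal (exp (- T * m) * c) + ennreal B * ennreal (sqrt ?q)"
    by (intro add_left_mono mult_left_mono far_E) simp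
  also have "\<dots> = ennreal (exp (- T * m) * c + B * sqrt ?q)"
    using Bpos c q by (simp add: ennreal_mult ennreal_plus)
  finally show ?thesis .
qed

text \<open>
  Let \<open>\<delta> = \<alpha> / 2\<close>. Choosing \<open>m\<close> large turns \<open>fk_far_le\<close> into: a bound \<open>c\<close> for \<open>\<phi>\<close> outside radius \<open>r\<close> yields the bound
  \<open>(2 powr - \<delta>) / 2 * c + D * r powr - \<delta>\<close> outside radius \<open>2 * r\<close>. So if \<open>c\<close> is a large enough multiple of
  \<open>r powr - \<delta>\<close>, the same multiple of \<open>(2 * r) powr - \<delta>\<close> works for \<open>2 * r\<close>.
\<close>
theorem eigenfunction_decay:
  assumes T: "short_time T" and cont: "continuous_on UNIV \<phi>" and B: "\<And>y. 0 \<le> \<phi> y" "\<And>y. \<phi> y \<le> B"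
    and eig: "AE x in lborel. exp (l * T) * fkr T \<phi> x = \<phi> x"
    and V: "filterlim V at_top at_infinity"
  shows "\<exists>C>0. \<exists>R>0. \<forall>x. R < norm x \<longrightarrow> \<phi> x \<le> C * norm x powr - (\<alpha> / 2)"
proof -
  define \<delta> where "\<delta> = \<alpha> / 2"
  have \<delta>: "0 < \<delta>" using index by (simp add: \<delta>_def)
  have T0: "0 < T" using T by (simp add: short_time_def)
  have \<phi>_meas [measurable]: "\<phi> \<in> borel_measurable borel" using cont by (rule borel_measurable_continuous_onI)
  have Bpos: "0 \<le> B" using B order_trans by blast
  (* Chosen so that exp (l * T) * exp (- T * m) is half of 2 powr - \<delta>: the factor 2 powr - \<delta> absorbs the
     doubling of the radius, and the factor 1/2 leaves room for the exit term. *)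
  define m where "m = (l * T + (\<delta> + 1) * ln 2) / T"
  have \<theta>: "exp (l * T) * exp (- T * m) = 2 powr (- \<delta>) / 2"
  proof -
    have "l * T + - T * m = - (\<delta> + 1) * ln 2" using T0 by (simp add: m_def field_simps)
    then have "exp (l * T) * exp (- T * m) = 2 powr (- (\<delta> + 1))"
      by (simp only: exp_add[symmetric] powr_def) simp
    also have "\<dots> = 2 powr (- \<delta>) / 2" by (simp add: powr_diff powr_minus powr_add field_simps)
    finally show ?thesis .
  qed
  have "eventually (\<lambda>y. m \<le> V y) at_infinity" using V by (simp add: filterlim_at_top)
  then obtain b where b: "\<And>y. b \<le> norm y \<Longrightarrow> m \<le> V y" by (auto simp: eventually_at_infinity)
  define R where "R = max b 1"
  have R: "0 < R" "\<And>y. R < norm y \<Longrightarrow> m \<le> V y" using b by (auto simp: R_def)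
  define D where "D = exp (l * T) * (B * (2 * sqrt (tail_const * T) * 2 powr \<delta>))"
  have D: "0 \<le> D" using Bpos tail_const_pos T0 by (simp add: D_def)
  let ?s = "\<lambda>r. sqrt (4 * tail_const * T * (r / 2) powr - \<alpha>)"
  have sqrt_eq: "exp (l * T) * (B * ?s r) = D * r powr - \<delta>" if r: "0 < r" for r
  proof -
    have "sqrt ((r / 2) powr - \<alpha>) = (r / 2) powr - \<delta>"
      by (simp add: powr_half_sqrt[symmetric] powr_powr \<delta>_def)
    also have "\<dots> = 2 powr \<delta> * r powr - \<delta>" using r by (simp add: powr_divide powr_minus field_simps)
    finally show ?thesis by (simp add: D_def real_sqrt_mult)
  qed
  have step: "\<phi> x \<le> 2 powr (- \<delta>) / 2 * c + D * r powr - \<delta>"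
    if c: "0 \<le> c" "\<And>y. r < norm y \<Longrightarrow> \<phi> y \<le> c" and r: "R \<le> r" and x: "2 * r < norm x" for c r x
  proof (rule AE_le_imp_le_on_open[OF cont])
    show "open {x::'a. 2 * r < norm x}" by (intro open_Collect_less continuous_intros)
    show "x \<in> {x. 2 * r < norm x}" using x by simp
    show "AE x in lborel. x \<in> {x. 2 * r < norm x} \<longrightarrow> \<phi> x \<le> 2 powr (- \<delta>) / 2 * c + D * r powr - \<delta>"
      using eig
    proof eventually_elim
      case (elim x)
      show ?case
      proof
        assume "x \<in> {x. 2 * r < norm x}"
        then have "fk T (\<lambda>y. ennreal (\<phi> y)) x
            \<le> ennreal (exp (- T * m) * c + B * ?s r)"
          using c r R B by (intro fk_far_le[OF T]) auto
        then have "ennreal (fkr T \<phi> x) \<le> ennreal (exp (- T * m) * c + B * ?s r)"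
          using ennreal_fkr[OF T \<phi>_meas B, of T x] T0 by simp
        moreover have "0 \<le> exp (- T * m) * c + B * ?s r"
          using Bpos c T0 tail_const_pos by (intro add_nonneg_nonneg mult_nonneg_nonneg) auto
        ultimately have "fkr T \<phi> x \<le> exp (- T * m) * c + B * ?s r"
          by (subst (asm) ennreal_le_iff)
        then have "exp (l * T) * fkr T \<phi> x
            \<le> exp (l * T) * (exp (- T * m) * c + B * ?s r)"
          by (intro mult_left_mono) auto
        also have "\<dots> = (exp (l * T) * exp (- T * m)) * c + exp (l * T) * (B * ?s r)"
          by (simp add: distrib_left)
        also have "\<dots> = 2 powr (- \<delta>) / 2 * c + D * r powr - \<delta>"
          using r R by (subst \<theta>, subst sqrt_eq) auto
        finally show "\<phi> x \<le> 2 powr (- \<delta>) / 2 * c + D * r powr - \<delta>" using elim by simp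
      qed
    qed
  qed
  define C where "C = max (B + 1) (2 * 2 powr \<delta> * D * R powr - \<delta>)"
  have C: "0 < C" "B \<le> C" "2 * 2 powr \<delta> * D * R powr - \<delta> \<le> C" using Bpos by (auto simp: C_def)
  have dyadic: "\<forall>x. 2 ^ k * R < norm x \<longrightarrow> \<phi> x \<le> C * (2 ^ k) powr - \<delta>" for k :: nat
  proof (induction k)
    case 0
    then show ?case using B(2) C(2) order_trans by fastforce
  next
    case (Suc k)
    show ?case
    proof (intro allI impI)
      fix x :: 'a assume "2 ^ Suc k * R < norm x"
      then have x: "2 * (2 ^ k * R) < norm x" by simp
      let ?p = "(2 ^ k :: real) powr - \<delta>"
      have "1 * R \<le> 2 ^ k * R" using R by (intro mult_right_mono) auto
      then have "\<phi> x \<le> 2 powr (- \<delta>) / 2 * (C * ?p) + D * (2 ^ k * R) powr - \<delta>"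
        using Suc C(1) by (intro step x) auto
      also have "(2 ^ k * R) powr - \<delta> = ?p * R powr - \<delta>" using R by (simp add: powr_mult)
      also have "D * (?p * R powr - \<delta>) \<le> 2 powr (- \<delta>) / 2 * (C * ?p)"
      proof -
        have "2 powr (- \<delta>) / 2 * (2 * 2 powr \<delta> * D * R powr - \<delta>) * ?p \<le> 2 powr (- \<delta>) / 2 * C * ?p"
          using C(3) by (intro mult_right_mono mult_left_mono) auto
        then show ?thesis by (simp add: powr_minus field_simps)
      qed
      also have "2 powr (- \<delta>) / 2 * (C * ?p) + 2 powr (- \<delta>) / 2 * (C * ?p) = C * (2 powr - \<delta> * ?p)" by simp
      also have "2 powr - \<delta> * ?p = (2 ^ Suc k) powr - \<delta>" by (simp add: powr_mult)
      finally show "\<phi> x \<le> C * (2 ^ Suc k) powr - \<delta>" by simp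
    qed
  qed
  have "\<phi> x \<le> C * (2 * R) powr \<delta> * norm x powr - \<delta>" if x: "R < norm x" for x
  proof -
    define P where "P n \<longleftrightarrow> norm x \<le> 2 ^ n * R" for n :: nat
    obtain n where "norm x / R < 2 ^ n" using real_arch_pow[of 2 "norm x / R"] by auto
    then have "P n" using R by (simp add: P_def field_simps)
    moreover have "\<not> P 0" using x by (simp add: P_def)
    ultimately obtain k where k: "\<not> P k" "P (Suc k)"
      using ex_least_nat_less[of P n] by auto
    have "\<phi> x \<le> C * (2 ^ k) powr - \<delta>" using dyadic k(1) by (simp add: P_def not_le)
    also have "(2 ^ k) powr - \<delta> = (2 * R) powr \<delta> * (2 ^ Suc k * R) powr - \<delta>"
      using R by (simp add: powr_mult powr_minus field_simps)
    also have "(2 ^ Suc k * R) powr - \<delta> \<le> norm x powr - \<delta>"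
      using k(2) x R \<delta> by (intro powr_mono2') (auto simp: P_def)
    finally show ?thesis using C(1) by (simp add: mult_left_mono mult.assoc)
  qed
  moreover have "0 < C * (2 * R) powr \<delta>" using C R by simp
  ultimately show ?thesis using R(1) unfolding \<delta>_def by blast
qed

end

section \<open>Lower bounds for the potential\<close>

context schrodinger_potential
begin

lemma fk_ball_ge:
  assumes t: "0 \<le> t" and K: "\<And>y. y \<in> ball x\<^sub>0 \<epsilon> \<Longrightarrow> V y \<le> K" and x: "x \<in> ball x\<^sub>0 (\<epsilon> / 2)"
  shows "ennreal (exp (- t * K) * prob {\<omega> \<in> space M. \<forall>s\<in>{0..t}. norm (X s \<omega>) \<le> \<epsilon> / 2})
       \<le> fk t (\<lambda>y. ennreal (indicator (ball x\<^sub>0 \<epsilon>) y)) x"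
proof -
  define S where "S = {\<omega> \<in> space M. \<forall>s\<in>{0..t}. norm (X s \<omega>) \<le> \<epsilon> / 2}"
  have S: "S \<in> sets M" unfolding S_def by (rule measurable_stay[OF t])
  have "ennreal (exp (- t * K) * prob S) = (\<integral>\<^sup>+ \<omega>. ennreal (exp (- t * K)) * indicator S \<omega> \<partial>M)"
    using S by (simp add: nn_integral_cmult_indicator emeasure_eq_measure ennreal_mult)
  also have "\<dots> \<le> fk t (\<lambda>y. ennreal (indicator (ball x\<^sub>0 \<epsilon>) y)) x"
    unfolding fk_def
  proof (rule nn_integral_mono_AE)
    show "AE \<omega> in M. ennreal (exp (- t * K)) * indicator S \<omega>
        \<le> ennreal (exp (- action t x \<omega>)) * ennreal (indicator (ball x\<^sub>0 \<epsilon>) (x + X t \<omega>))"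
      using potential_AE_integrable[OF t, of x] AE_space
    proof eventually_elim
      case (elim \<omega>)
      show ?case
      proof (cases "\<omega> \<in> S")
        case True
        have near: "x + X s \<omega> \<in> ball x\<^sub>0 \<epsilon>" if "s \<in> {0..t}" for s
        proof -
          have "norm (X s \<omega>) \<le> \<epsilon> / 2" using True that by (auto simp: S_def)
          moreover have "dist x\<^sub>0 (x + X s \<omega>) \<le> dist x\<^sub>0 x + norm (X s \<omega>)"
            by (metis add_diff_cancel_left' dist_commute dist_norm dist_triangle)
          ultimately show ?thesis using x by simp
        qed
        have "(LINT s:{0..t}|lborel. V (x + X s \<omega>)) \<le> (LINT s:{0..t}|lborel. K)"
          using elim(1) K near
          by (intro set_integral_mono) (auto simp: set_integrable_def integrable_indicator_iff emeasure_lborel_Icc_eq)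
        then have "action t x \<omega> \<le> t * K"
          using t by (simp add: path_integral_path[OF elim(2)] set_lebesgue_integral_def)
        then have "exp (- t * K) \<le> exp (- action t x \<omega>)" by simp
        then show ?thesis using True near[of t] t by (simp add: ennreal_leI)
      qed simp
    qed
  qed
  finally show ?thesis unfolding S_def .
qed

text \<open>
  The bound is taken over the unit ball so that it does not depend on \<open>\<epsilon>\<close>.
\<close>
lemma kernel_ball_integral:
  fixes v :: "'a \<Rightarrow> real"
  assumes cont: "continuous_on UNIV v" and v: "\<And>y. 0 < v y" and \<epsilon>: "0 < \<epsilon>" "\<epsilon> \<le> 1"
    and le: "\<And>y. y \<in> ball x\<^sub>0 1 \<Longrightarrow> v y \<le> L"
  shows "(LINT y|lborel. v y * indicator (ball x\<^sub>0 \<epsilon>) y) \<noteq> 0"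
    and "(LINT y|lborel. v y * indicator (ball x\<^sub>0 \<epsilon>) y) \<le> L * unit_ball_vol (real DIM('a))"
proof -
  have [measurable]: "v \<in> borel_measurable borel" using cont by (rule borel_measurable_continuous_onI)
  have sub: "ball x\<^sub>0 \<epsilon> \<subseteq> ball x\<^sub>0 1" using \<epsilon> by auto
  have L: "0 \<le> L" using le[of x\<^sub>0] v[of x\<^sub>0] by simp
  have fin: "emeasure lborel (ball x\<^sub>0 1) < \<infinity>" by (simp add: emeasure_ball)
  have int1: "integrable lborel (\<lambda>y. L * indicator (ball x\<^sub>0 1) y :: real)"
    using fin by (intro integrable_mult_right integrable_real_indicator) auto
  have int: "integrable lborel (\<lambda>y. v y * indicator (ball x\<^sub>0 \<epsilon>) y)"
    by (rule Bochner_Integration.integrable_bound[OF int1])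
       (use le v sub L in \<open>auto simp: indicator_def less_imp_le intro!: AE_I2\<close>)
  show "(LINT y|lborel. v y * indicator (ball x\<^sub>0 \<epsilon>) y) \<noteq> 0"
  proof
    assume "(LINT y|lborel. v y * indicator (ball x\<^sub>0 \<epsilon>) y) = 0"
    then have "AE y in lborel. v y * indicator (ball x\<^sub>0 \<epsilon>) y = 0"
      using int v by (subst (asm) integral_nonneg_eq_0_iff_AE) (auto simp: less_imp_le)
    then obtain y where "y \<in> ball x\<^sub>0 \<epsilon>" "v y * indicator (ball x\<^sub>0 \<epsilon>) y = 0"
      using AE_lborel_meets_open[of "ball x\<^sub>0 \<epsilon>" "\<lambda>y. v y * indicator (ball x\<^sub>0 \<epsilon>) y = 0"] \<epsilon>(1) by auto
    then show False using v[of y] by simp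
  qed
  have "(LINT y|lborel. v y * indicator (ball x\<^sub>0 \<epsilon>) y) \<le> (LINT y|lborel. L * indicator (ball x\<^sub>0 1) y)"
    using le v sub L by (intro integral_mono int int1) (auto simp: indicator_def less_imp_le)
  also have "\<dots> = L * measure lborel (ball x\<^sub>0 1)" by simp
  also have "measure lborel (ball x\<^sub>0 1) = unit_ball_vol (real DIM('a))"
    by (simp add: measure_def emeasure_ball)
  finally show "(LINT y|lborel. v y * indicator (ball x\<^sub>0 \<epsilon>) y) \<le> L * unit_ball_vol (real DIM('a))" .
qed

text \<open>
  The kernel identity holds for almost every \<open>x\<close>, so it is used at some point within \<open>\<epsilon> / 2\<close> of the centre
  of the ball and not at the centre itself. The threshold \<open>R'\<close> depends on \<open>\<epsilon>\<close> through the small ball probability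
  \<open>p\<close>; the bound \<open>\<delta> / t\<close> does not.
\<close>
theorem sup_log_ratio_lower_bound:
  assumes ker: "feynman_kac_kernel M X V u"
    and \<phi>: "\<And>x. 0 < \<phi> x" and \<delta>: "0 < \<delta>" and C: "0 < C" and R: "0 < R"
    and decay: "\<And>x. R < norm x \<Longrightarrow> \<phi> x \<le> C * norm x powr - \<delta>"
    and t: "0 < t" and A: "0 < A" "\<And>x y. intrinsic_kernel E0 u \<phi> t x y \<le> A"
    and \<epsilon>: "\<epsilon> \<in> {0<..1}"
  shows "\<exists>R'>2. \<forall>x. R' < norm x \<longrightarrow> ereal (\<delta> / t) \<le> sup_log_ratio V \<epsilon> x"
proof -
  define p where "p = prob {\<omega> \<in> space M. \<forall>s\<in>{0..t}. norm (X s \<omega>) \<le> \<epsilon> / 2}"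
  have p: "0 < p" unfolding p_def using \<epsilon> t by (intro prob_stay_pos) auto
  define b where "b = A * exp (- (E0 * t)) * (C * 2 powr \<delta>)\<^sup>2 * unit_ball_vol (real DIM('a))"
  have b: "0 < b" using A C by (simp add: b_def unit_ball_vol_pos)
  (* The last bound makes the constant ln (b / p) at most \<delta> * ln (norm x). *)
  define R' where "R' = max (max 3 (R + 1)) (exp (ln (b / p) / \<delta>))"
  have u: "continuous_on UNIV (u t x)" "0 < u t x y" for x y
  proof -
    have "continuous_on UNIV (\<lambda>(x, y). u t x y)" using ker t by (simp add: feynman_kac_kernel_def)
    then have "continuous_on UNIV ((\<lambda>(x, y). u t x y) \<circ> (\<lambda>y. (x, y)))"
      by (intro continuous_on_compose) (auto intro!: continuous_intros elim: continuous_on_subset)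
    then show "continuous_on UNIV (u t x)" by (simp add: comp_def)
    show "0 < u t x y" using ker t by (simp add: feynman_kac_kernel_def)
  qed
  have main: "ereal (\<delta> / t) \<le> sup_log_ratio V \<epsilon> x\<^sub>0" if x0: "R' < norm x\<^sub>0" for x\<^sub>0
  proof -
    let ?B = "ball x\<^sub>0 \<epsilon>" and ?S = "SUP y\<in>ball x\<^sub>0 \<epsilon>. ereal (V y)"
    let ?i = "\<lambda>x y. complex_of_real (u t x y) * complex_of_real (indicator ?B y)"
    let ?T = "feynman_kac M X V t (\<lambda>y. complex_of_real (indicator ?B y))"
    have x0': "3 < norm x\<^sub>0" "R + 1 < norm x\<^sub>0" "exp (ln (b / p) / \<delta>) < norm x\<^sub>0"
      using x0 by (auto simp: R'_def)
    then have lnpos: "0 < ln (norm x\<^sub>0)" by (intro ln_gt_zero) linarith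
    have V_le_S: "ereal (V y) \<le> ?S" if "y \<in> ?B" for y using that by (intro SUP_upper)
    have x0B: "x\<^sub>0 \<in> ?B" using \<epsilon> by simp
    show ?thesis
    proof (cases ?S)
      case PInf
      then show ?thesis using lnpos by (simp add: sup_log_ratio_def)
    next
      case MInf
      then show ?thesis using V_le_S[OF x0B] by simp
    next
      case (real K)
      have V_le_K: "V y \<le> K" if "y \<in> ?B" for y using V_le_S[OF that] real by simp
      have g [measurable]: "(indicator ?B :: 'a \<Rightarrow> real) \<in> borel_measurable borel"
        by (intro borel_measurable_indicator) auto
      have "(\<lambda>y. complex_of_real (indicator ?B y)) \<in> L2"
      proof -
        have "(\<lambda>y. (norm (complex_of_real (indicator ?B y)))\<^sup>2) = (indicator ?B :: 'a \<Rightarrow> real)"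
          by (auto simp: indicator_def)
        moreover have "integrable lborel (indicator ?B :: 'a \<Rightarrow> real)"
          using \<epsilon> by (intro integrable_real_indicator) (auto simp: emeasure_ball)
        ultimately show ?thesis unfolding L2_def by simp
      qed
      then have "AE x in lborel. ?T x
          = (CLINT y|lborel. ?i x y)"
        using ker t unfolding feynman_kac_kernel_def by blast
      from AE_lborel_meets_open[OF open_ball _ this, of x\<^sub>0 "\<epsilon> / 2"] \<epsilon>
      obtain x where x: "x \<in> ball x\<^sub>0 (\<epsilon> / 2)"
        and fk_x: "?T x
          = (CLINT y|lborel. ?i x y)"
        by (auto simp del: mem_ball)
      let ?F = "fk t (\<lambda>y. ennreal (indicator ?B y)) x"
      define I where "I = (LINT y|lborel. u t x y * indicator ?B y)"
      have "(CLINT y|lborel. ?i x y) = complex_of_real I"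
        unfolding I_def by (subst integral_complex_of_real[symmetric]) simp
      then have fk_I: "enn2real (?F) = I"
        using fk_x feynman_kac_eq_fk[OF g _ less_imp_le[OF t], of x] by simp
      have far: "\<phi> y \<le> C * 2 powr \<delta> * norm x\<^sub>0 powr - \<delta>" if y: "y \<in> ball x\<^sub>0 1" for y
      proof -
        have "norm x\<^sub>0 \<le> norm y + dist x\<^sub>0 y" by (metis dist_norm norm_triangle_sub)
        then have ny: "norm x\<^sub>0 - 1 < norm y" using y by simp
        then have "\<phi> y \<le> C * norm y powr - \<delta>" using x0' by (intro decay) simp
        also have "norm y powr - \<delta> \<le> (norm x\<^sub>0 / 2) powr - \<delta>"
          using ny x0' \<delta> by (intro powr_mono2') auto
        also have "(norm x\<^sub>0 / 2) powr - \<delta> = 2 powr \<delta> * norm x\<^sub>0 powr - \<delta>"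
          by (simp add: powr_divide powr_minus field_simps)
        finally show ?thesis using C by (simp add: mult_left_mono mult.assoc)
      qed
      have u_le: "u t x y \<le> A * exp (- (E0 * t)) * (C * 2 powr \<delta>)\<^sup>2 * norm x\<^sub>0 powr - (2 * \<delta>)"
        if y: "y \<in> ball x\<^sub>0 1" for y
      proof -
        have "exp (E0 * t) * u t x y \<le> A * (\<phi> x * \<phi> y)"
          using A(2)[of x y] \<phi>[of x] \<phi>[of y] by (simp add: intrinsic_kernel_def pos_divide_le_eq)
        also have "\<dots> \<le> A * ((C * 2 powr \<delta> * norm x\<^sub>0 powr - \<delta>) * (C * 2 powr \<delta> * norm x\<^sub>0 powr - \<delta>))"
          using A(1) C \<phi> y x \<epsilon> by (intro mult_left_mono mult_mono far) (auto simp: less_imp_le)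
        also have "\<dots> = A * ((C * 2 powr \<delta>)\<^sup>2 * (norm x\<^sub>0 powr - \<delta> * norm x\<^sub>0 powr - \<delta>))"
          by (simp add: power2_eq_square ac_simps)
        also have "norm x\<^sub>0 powr - \<delta> * norm x\<^sub>0 powr - \<delta> = norm x\<^sub>0 powr - (2 * \<delta>)"
          by (simp add: powr_add[symmetric])
        finally show ?thesis by (simp add: exp_minus field_simps)
      qed
      have I_le: "I \<le> b * norm x\<^sub>0 powr - (2 * \<delta>)"
        using kernel_ball_integral(2)[OF u, of \<epsilon> x\<^sub>0 x, OF _ _ u_le] \<epsilon>
        by (simp add: I_def b_def ac_simps)
      (* The Bochner integral defining the semigroup is 0 on functions that are not integrable. Since the kernel is
         positive, the value here is not 0, and therefore the expectation is finite. *)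
      have "I \<noteq> 0"
        unfolding I_def using \<epsilon> by (intro kernel_ball_integral(1)[OF u _ _ u_le]) auto
      then have fin: "?F < \<top>"
        using fk_I by (cases "?F") auto
      have "ennreal (exp (- t * K) * p) \<le> ?F"
        unfolding p_def using t x V_le_K by (intro fk_ball_ge) auto
      also have "\<dots> = ennreal I" using fin fk_I by (metis ennreal_enn2real)
      finally have "exp (- t * K) * p \<le> I"
        using p fk_I by (subst (asm) ennreal_le_iff) auto
      also have "\<dots> \<le> b * norm x\<^sub>0 powr - (2 * \<delta>)" by (rule I_le)
      finally have "exp (- t * K) \<le> b / p * norm x\<^sub>0 powr - (2 * \<delta>)"
        using p by (simp add: field_simps)
      then have "ln (exp (- t * K)) \<le> ln (b / p * norm x\<^sub>0 powr - (2 * \<delta>))"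
      proof (subst ln_le_cancel_iff)
        have "x\<^sub>0 \<noteq> 0" using x0' by auto
        then show "0 < b / p * norm x\<^sub>0 powr - (2 * \<delta>)" using p b by simp
      qed auto
      also have "\<dots> = ln (b / p) + ln (norm x\<^sub>0 powr - (2 * \<delta>))"
        using p b x0' by (intro ln_mult_pos) auto
      also have "ln (norm x\<^sub>0 powr - (2 * \<delta>)) = - (2 * \<delta>) * ln (norm x\<^sub>0)"
        using x0' by (simp add: ln_powr)
      finally have 1: "2 * \<delta> * ln (norm x\<^sub>0) - ln (b / p) \<le> t * K" by simp
      have "ln (exp (ln (b / p) / \<delta>)) \<le> ln (norm x\<^sub>0)"
        using x0' by (subst ln_le_cancel_iff) auto
      then have "ln (b / p) \<le> \<delta> * ln (norm x\<^sub>0)" using \<delta> by (simp add: pos_divide_le_eq mult.commute)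
      with 1 have "\<delta> * ln (norm x\<^sub>0) \<le> t * K" by linarith
      then have "\<delta> / t \<le> K / ln (norm x\<^sub>0)" using t lnpos by (simp add: field_simps)
      then show ?thesis using lnpos real by (simp add: sup_log_ratio_def)
    qed
  qed
  have "2 < R'" by (simp add: R'_def)
  then show ?thesis using main by blast
qed

lemma ground_state_decay:
  assumes V: "filterlim V at_top at_infinity" and gs: "ground_state M X V \<phi>"
  shows "\<exists>C>0. \<exists>R>0. \<forall>x. R < norm x \<longrightarrow> \<phi> x \<le> C * norm x powr - (\<alpha> / 2)"
proof -
  let ?l = "ground_energy M X V"
  let ?q = "\<lambda>t x. (complex_of_real (\<phi> x) - feynman_kac M X V t (\<lambda>x. complex_of_real (\<phi> x)) x)
        / complex_of_real t - complex_of_real ?l * complex_of_real (\<phi> x)"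
  let ?r = "\<lambda>t x. (\<phi> x - fkr t \<phi> x) / t - ?l * \<phi> x"
  have gen: "((\<lambda>x. complex_of_real (\<phi> x)), (\<lambda>x. complex_of_real ?l * complex_of_real (\<phi> x))) \<in> hamiltonian M X V"
    and pos: "\<And>x. 0 < \<phi> x" and bdd: "bounded (range \<phi>)" and cont: "continuous_on UNIV \<phi>"
    using gs by (auto simp: ground_state_def)
  obtain B where B: "\<And>x. \<bar>\<phi> x\<bar> \<le> B" using bdd by (auto simp: bounded_iff)
  have \<phi>: "0 \<le> \<phi> y" "\<phi> y \<le> B" for y using pos[of y] B[of y] by auto
  have [measurable]: "\<phi> \<in> borel_measurable borel" using cont by (rule borel_measurable_continuous_onI)
  obtain T where T: "short_time T" using short_time_exists by blast
  then have T0: "0 < T" by (simp add: short_time_def)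
  have "integrable lborel (\<lambda>x. (\<phi> x)\<^sup>2)" using gen by (simp add: hamiltonian_def L2_def)
  then have L2: "(\<integral>\<^sup>+ x. ennreal ((\<phi> x)\<^sup>2) \<partial>lborel) < \<infinity>" by (simp add: integrable_iff_bounded)
  have "((\<lambda>t. \<integral>\<^sup>+ x. ennreal ((norm (?q t x))\<^sup>2) \<partial>lborel) \<longlongrightarrow> 0) (at_right 0)"
    using gen by (simp add: hamiltonian_def)
  moreover have "eventually (\<lambda>t. (\<integral>\<^sup>+ x. ennreal ((norm (?q t x))\<^sup>2) \<partial>lborel)
      = (\<integral>\<^sup>+ x. ennreal ((?r t x)\<^sup>2) \<partial>lborel)) (at_right 0)"
    using eventually_at_right_less[of "0::real"]
  proof eventually_elim
    case (elim t)
    have "norm (?q t x) = \<bar>?r t x\<bar>" for x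
    proof -
      have "?q t x
        = complex_of_real (?r t x)"
        using elim \<phi> by (simp add: feynman_kac_eq_fk fkr_def)
      then show ?thesis by (simp only: norm_of_real)
    qed
    then show ?case by simp
  qed
  ultimately have "((\<lambda>t. \<integral>\<^sup>+ x. ennreal ((?r t x)\<^sup>2) \<partial>lborel) \<longlongrightarrow> 0) (at_right 0)"
    by (rule Lim_transform_eventually)
  then have "AE x in lborel. exp (?l * T) * fkr T \<phi> x = \<phi> x"
    by (intro eigenfunction_of_generator[OF T _ \<phi> L2]) (use T0 in auto)
  then show ?thesis using eigenfunction_decay[OF T cont \<phi> _ V] by blast
qed

theorem ultracontractivity_lower_bounds:
  assumes V: "filterlim V at_top at_infinity" and ker: "feynman_kac_kernel M X V u" and gs: "ground_state M X V \<phi>"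
  shows "IUC (ground_energy M X V) u \<phi> \<Longrightarrow> \<epsilon> \<in> {0<..1} \<Longrightarrow> (sup_log_ratio V \<epsilon> \<longlongrightarrow> \<infinity>) at_infinity"
    and "AIUC (ground_energy M X V) u \<phi> \<Longrightarrow>
        \<exists>C>0. \<forall>\<epsilon>\<in>{0<..1}. \<exists>R>2. \<forall>x. norm x > R \<longrightarrow> sup_log_ratio V \<epsilon> x \<ge> ereal C"
proof -
  let ?E = "ground_energy M X V"
  let ?k = "intrinsic_kernel ?E u \<phi>"
  have pos: "\<And>x. 0 < \<phi> x" using gs by (simp add: ground_state_def)
  obtain C R where CR: "0 < C" "0 < R" "\<And>x. R < norm x \<Longrightarrow> \<phi> x \<le> C * norm x powr - (\<alpha> / 2)"
    using ground_state_decay[OF V gs] by blast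
  have \<delta>: "0 < \<alpha> / 2" using index by simp
  have bound: "\<exists>R'>2. \<forall>x. R' < norm x \<longrightarrow> ereal (\<alpha> / 2 / t) \<le> sup_log_ratio V \<epsilon> x"
    if "0 < t" "0 < A" "\<And>x y. ?k t x y \<le> A" "\<epsilon> \<in> {0<..1}" for t A \<epsilon>
    by (rule sup_log_ratio_lower_bound[OF ker pos \<delta> CR that])
  show "(sup_log_ratio V \<epsilon> \<longlongrightarrow> \<infinity>) at_infinity"
    if iuc: "IUC ?E u \<phi>" and \<epsilon>: "\<epsilon> \<in> {0<..1}"
    unfolding tendsto_PInfty
  proof
    fix r :: real
    define t where "t = \<alpha> / 2 / (\<bar>r\<bar> + 1)"
    have t: "0 < t" using \<delta> by (simp add: t_def)
    obtain A where "A > 0" "\<forall>x y. ?k t x y \<le> A"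
      using iuc t unfolding IUC_def by blast
    then obtain R' where R': "\<And>x. R' < norm x \<Longrightarrow> ereal (\<alpha> / 2 / t) \<le> sup_log_ratio V \<epsilon> x"
      using bound[OF t _ _ \<epsilon>] by metis
    have "\<alpha> / 2 / t = \<bar>r\<bar> + 1" using \<delta> by (simp add: t_def)
    then have "ereal r < ereal (\<alpha> / 2 / t)" by simp
    then have "ereal r < sup_log_ratio V \<epsilon> x" if "R' + 1 \<le> norm x" for x
      using R'[of x] that by (metis add_le_cancel_left less_add_one less_le_trans)
    then show "eventually (\<lambda>x. ereal r < sup_log_ratio V \<epsilon> x) at_infinity"
      unfolding eventually_at_infinity by blast
  qed
  show "\<exists>C>0. \<forall>\<epsilon>\<in>{0<..1}. \<exists>R>2. \<forall>x. norm x > R \<longrightarrow> sup_log_ratio V \<epsilon> x \<ge> ereal C"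
    if aiuc: "AIUC ?E u \<phi>"
  proof -
    obtain t where t: "0 < t" "\<exists>A>0. \<forall>x y. ?k t x y \<le> A"
      using aiuc unfolding AIUC_def by blast
    then obtain A where "A > 0" "\<forall>x y. ?k t x y \<le> A" by blast
    then show ?thesis using bound[OF t(1)] t(1) \<delta> by (intro exI[of _ "\<alpha> / 2 / t"]) auto
  qed
qed

end

section \<open>Removing the initial position\<close>

text \<open>
  Subtracting the initial position changes the process only on a null set, so potential class, semigroup,
  generator and kernel are unaffected, as the lemmas below show.
\<close>
definition pinned_process :: "(real \<Rightarrow> 'w \<Rightarrow> 'a::euclidean_space) \<Rightarrow> real \<Rightarrow> 'w \<Rightarrow> 'a" where
  "pinned_process X t \<omega> = X t \<omega> - X 0 \<omega>"

context stable_process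
begin

lemma distr_pinned_process:
  assumes "0 \<le> t"
  shows "distr M borel (pinned_process X t) = distr M borel (X t)"
  using stationary_increments[of 0 t] assms by (simp add: pinned_process_def[abs_def])

lemma measurable_pinned_process: "0 \<le> t \<Longrightarrow> pinned_process X t \<in> borel_measurable M"
  unfolding pinned_process_def[abs_def] by (rule measurable_increment) auto

lemma pinned_process_is_pinned: "pinned_stable_process M \<alpha> (pinned_process X)"
proof
  show "(CLINT \<omega>|M. exp (\<i> * complex_of_real (\<xi> \<bullet> pinned_process X t \<omega>))) = complex_of_real (exp (- t * norm \<xi> powr \<alpha>))"
    if t: "0 \<le> t" for t \<xi>
  proof -
    have "(CLINT \<omega>|M. exp (\<i> * complex_of_real (\<xi> \<bullet> pinned_process X t \<omega>)))
        = (CLINT y|distr M borel (pinned_process X t). exp (\<i> * complex_of_real (\<xi> \<bullet> y)))"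
      using measurable_pinned_process[OF t] by (subst integral_distr) auto
    also have "\<dots> = (CLINT \<omega>|M. exp (\<i> * complex_of_real (\<xi> \<bullet> X t \<omega>)))"
      unfolding distr_pinned_process[OF t] using rv[OF t] by (subst integral_distr) auto
    finally show ?thesis using char_exponent[OF t] by simp
  qed
  show "distr M borel (\<lambda>\<omega>. pinned_process X t \<omega> - pinned_process X s \<omega>) = distr M borel (pinned_process X (t - s))"
    if "0 \<le> s" "s \<le> t" for s t
    using stationary_increments[OF that] distr_pinned_process[of "t - s"] that by (simp add: pinned_process_def)
  show "\<exists>l. ((\<lambda>s. pinned_process X s \<omega>) \<longlongrightarrow> l) (at_left t)" if \<omega>: "\<omega> \<in> space M" and t: "0 < t" for \<omega> t
  proof -
    obtain l where "((\<lambda>s. X s \<omega>) \<longlongrightarrow> l) (at_left t)" using left_limits[OF \<omega> t] by blast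
    then have "((\<lambda>s. pinned_process X s \<omega>) \<longlongrightarrow> l - X 0 \<omega>) (at_left t)"
      unfolding pinned_process_def by (intro tendsto_intros)
    then show ?thesis by blast
  qed
  show "indep_vars (\<lambda>_. borel) (\<lambda>i \<omega>. pinned_process X (\<tau> (Suc i)) \<omega> - pinned_process X (\<tau> i) \<omega>) {..<n}"
    if "0 \<le> \<tau> 0" "\<And>i. i < n \<Longrightarrow> \<tau> i \<le> \<tau> (Suc i)" for \<tau> :: "nat \<Rightarrow> real" and n
    using indep_increments[OF that] by (simp add: pinned_process_def)
qed (use index in \<open>auto simp: pinned_process_def intro!: tendsto_intros right_continuous measurable_pinned_process\<close>)

lemma kato_class_pinned: "kato_class M (pinned_process X) = kato_class M X"
proof -
  have eq: "(\<integral>\<^sup>+ \<omega>. ennreal \<bar>W (x + pinned_process X s \<omega>)\<bar> \<partial>M) = (\<integral>\<^sup>+ \<omega>. ennreal \<bar>W (x + X s \<omega>)\<bar> \<partial>M)"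
    if [measurable]: "W \<in> borel_measurable borel" and s: "0 \<le> s" for W :: "'a \<Rightarrow> real" and x s
  proof -
    have "(\<integral>\<^sup>+ \<omega>. ennreal \<bar>W (x + pinned_process X s \<omega>)\<bar> \<partial>M)
        = (\<integral>\<^sup>+ y. ennreal \<bar>W (x + y)\<bar> \<partial>distr M borel (pinned_process X s))"
      using measurable_pinned_process[OF s] by (subst nn_integral_distr) auto
    also have "\<dots> = (\<integral>\<^sup>+ \<omega>. ennreal \<bar>W (x + X s \<omega>)\<bar> \<partial>M)"
      unfolding distr_pinned_process[OF s] using rv[OF s] by (subst nn_integral_distr) auto
    finally show ?thesis .
  qed
  have "(\<integral>\<^sup>+ s\<in>{0..t}. (\<integral>\<^sup>+ \<omega>. ennreal \<bar>W (x + pinned_process X s \<omega>)\<bar> \<partial>M) \<partial>lborel)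
      = (\<integral>\<^sup>+ s\<in>{0..t}. (\<integral>\<^sup>+ \<omega>. ennreal \<bar>W (x + X s \<omega>)\<bar> \<partial>M) \<partial>lborel)"
    if "W \<in> borel_measurable borel" for W :: "'a \<Rightarrow> real" and x t
    using eq[OF that] by (intro nn_integral_cong) (auto simp: indicator_def)
  then show ?thesis by (auto simp: kato_class_def cong: conj_cong)
qed

lemma kato_decomposable_pinned: "kato_decomposable M (pinned_process X) V \<longleftrightarrow> kato_decomposable M X V"
  by (simp add: kato_decomposable_def kato_class_loc_def kato_class_pinned)

lemma feynman_kac_pinned:
  assumes [measurable]: "V \<in> borel_measurable borel" "f \<in> borel_measurable borel" and t: "0 \<le> t"
  shows "feynman_kac M (pinned_process X) V t f x = feynman_kac M X V t f x"
proof -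
  interpret pinned: pinned_stable_process M \<alpha> "pinned_process X" by (rule pinned_process_is_pinned)
  note [measurable] = rv[OF t] rv[OF order_refl] pinned.measurable_X[OF t]
  have eq: "(LINT s:{0..t}|lborel. V (x + X s \<omega>)) = path_integral V t (x + X 0 \<omega>) (pinned.traj t \<omega>)"
    if "\<omega> \<in> space M" for \<omega> x
    unfolding pinned.path_integral_path[OF that] by (simp add: pinned_process_def add.assoc)
  have eq': "(LINT s:{0..t}|lborel. V (x + pinned_process X s \<omega>)) = path_integral V t x (pinned.traj t \<omega>)"
    if "\<omega> \<in> space M" for \<omega> x
    unfolding pinned.path_integral_path[OF that] by simp
  have "feynman_kac M X V t f x
      = (CLINT \<omega>|M. complex_of_real (exp (- path_integral V t (x + X 0 \<omega>) (pinned.traj t \<omega>))) * f (x + X t \<omega>))"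
    unfolding feynman_kac_def by (intro Bochner_Integration.integral_cong) (auto simp: eq)
  also have "\<dots> = (CLINT \<omega>|M. complex_of_real (exp (- path_integral V t x (pinned.traj t \<omega>))) * f (x + pinned_process X t \<omega>))"
  proof (rule Bochner_Integration.integral_cong_AE)
    show "AE \<omega> in M. complex_of_real (exp (- path_integral V t (x + X 0 \<omega>) (pinned.traj t \<omega>))) * f (x + X t \<omega>)
        = complex_of_real (exp (- path_integral V t x (pinned.traj t \<omega>))) * f (x + pinned_process X t \<omega>)"
      using start by eventually_elim (simp add: pinned_process_def)
  qed (use t in measurable)
  also have "\<dots> = feynman_kac M (pinned_process X) V t f x"
    unfolding feynman_kac_def by (intro Bochner_Integration.integral_cong) (auto simp: eq')
  finally show ?thesis by simp
qed

lemma hamiltonian_pinned: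
  assumes V: "V \<in> borel_measurable borel"
  shows "hamiltonian M (pinned_process X) V = hamiltonian M X V"
proof -
  let ?D = "\<lambda>Z f g t. \<integral>\<^sup>+ x. ennreal ((norm ((f x - feynman_kac M Z V t f x) / complex_of_real t - g x))\<^sup>2) \<partial>lborel"
  have "(?D (pinned_process X) f g \<longlongrightarrow> 0) (at_right 0)
    \<longleftrightarrow> (?D X f g \<longlongrightarrow> 0) (at_right 0)" if "f \<in> borel_measurable borel" for f g :: "'a \<Rightarrow> complex"
  proof (rule tendsto_cong)
    show "eventually (\<lambda>t. ?D (pinned_process X) f g t
        = ?D X f g t) (at_right 0)"
      using eventually_at_right_less[of "0::real"]
      by eventually_elim (simp add: feynman_kac_pinned[OF V that])
  qed
  then show ?thesis by (auto simp: hamiltonian_def L2_def)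
qed

lemma ground_energy_pinned:
  "V \<in> borel_measurable borel \<Longrightarrow> ground_energy M (pinned_process X) V = ground_energy M X V"
  by (simp add: ground_energy_def hamiltonian_pinned)

lemma ground_state_pinned:
  "V \<in> borel_measurable borel \<Longrightarrow> ground_state M (pinned_process X) V \<phi> \<longleftrightarrow> ground_state M X V \<phi>"
  by (simp add: ground_state_def hamiltonian_pinned ground_energy_pinned)

lemma feynman_kac_kernel_pinned:
  assumes V: "V \<in> borel_measurable borel"
  shows "feynman_kac_kernel M (pinned_process X) V u \<longleftrightarrow> feynman_kac_kernel M X V u"
proof -
  have "feynman_kac M (pinned_process X) V t f x = feynman_kac M X V t f x" if "f \<in> L2" "0 < t" for t f x
    using that by (intro feynman_kac_pinned V) (auto simp: L2_def)
  then show ?thesis by (simp add: feynman_kac_kernel_def cong: ball_cong)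
qed

end

section \<open>Necessary growth of the potential\<close>

theorem theorem4p3:
  fixes M :: "'w measure" and \<alpha> :: real
    and X :: "real \<Rightarrow> 'w \<Rightarrow> 'a::euclidean_space"
    and V :: "'a \<Rightarrow> real"
    and u :: "real \<Rightarrow> 'a \<Rightarrow> 'a \<Rightarrow> real"
    and \<phi> :: "'a \<Rightarrow> real"
  assumes "stable_process M \<alpha> X"
    and "kato_decomposable M X V"
    and "filterlim V at_top at_infinity"
    and "feynman_kac_kernel M X V u"
    and "ground_state M X V \<phi>"
  shows
    "(IUC (ground_energy M X V) u \<phi> \<longrightarrow>
        (\<forall>\<epsilon>\<in>{0<..1}. (sup_log_ratio V \<epsilon> \<longlongrightarrow> \<infinity>) at_infinity)) \<and>
     (AIUC (ground_energy M X V) u \<phi> \<longrightarrow>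
        (\<exists>C>0. \<forall>\<epsilon>\<in>{0<..1}. \<exists>R>2. \<forall>x. norm x > R \<longrightarrow> sup_log_ratio V \<epsilon> x \<ge> ereal C))"
proof -
  interpret stable_process M \<alpha> X by fact
  have V: "V \<in> borel_measurable borel" using assms(2) by (simp add: kato_decomposable_def)
  have ker: "feynman_kac_kernel M (pinned_process X) V u" and gs: "ground_state M (pinned_process X) V \<phi>"
    and energy: "ground_energy M (pinned_process X) V = ground_energy M X V"
    using assms(4,5) by (simp_all add: feynman_kac_kernel_pinned ground_state_pinned ground_energy_pinned V)
  interpret schrodinger_potential M \<alpha> "pinned_process X" V
    by (intro schrodinger_potential.intro pinned_process_is_pinned schrodinger_potential_axioms.intro)
      (simp add: kato_decomposable_pinned assms(2))
  show ?thesis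
    using ultracontractivity_lower_bounds[OF assms(3) ker gs] unfolding energy by blast
qed

end
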